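(* Let $0<\rho<1$, $T>0$, $0<\xi_0\le T$, $0<\xi_2\le T$, $\xi_2\ne\xi_0$, $\alpha\in(0,1)$, and let $A$, $\lambda_k$, $v_k$, $K_0$ be as in the context. Let $W\in D(A)$, let $f\in C([0,T];D(A^\varepsilon))$ for some $\varepsilon\in(0,1)$, and let the orthogonality conditions be satisfied, i.e. $(f(t),v_k)=0$ for all $t\in(0,T]$ and all $k\in K_0$, and the element $\varphi$ to be found is required to satisfy $(\varphi,v_k)=0$ for all $k\in K_0$. Then there is a unique pair $\{u(t),\varphi\}$ (with this property of $\varphi$) such that $\varphi\in H$, $u\in C([0,T];H)$, $D_t^\rho u(t),\,Au(t)\in C((0,T];H)$, and $$D_t^\rho u(t)+Au(t)=f(t),\quad 0<t\le T;\qquad u(\xi_0)=\alpha u(0)+\varphi;\qquad u(\xi_2)=W.$$ Moreover, this solution has the form $$\varphi=\sum_{k\notin K_0}\left[\frac{E_\rho(-\lambda_k\xi_0^\rho)-\alpha}{E_\rho(-\lambda_k\xi_2^\rho)}\,[W_k-\omega_k(\xi_2)]+\omega_k(\xi_0)\right]v_k,$$ $$u(t)=\sum_{k\notin K_0}\left[\frac{\varphi_k-\omega_k(\xi_0)}{E_\rho(-\lambda_k\xi_0^\rho)-\alpha}\,E_\rho(-\lambda_kt^\rho)+\omega_k(t)\right]v_k+\sum_{k\in K_0}\frac{E_\rho(-\lambda_kt^\rho)\,W_k}{E_\rho(-\lambda_k\xi_2^\rho)}\,v_k,$$ where $$\omega_k(t)=\int_0^t\eta^{\rho-1}E_{\r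ho,\rho}(-\lambda_k\eta^\rho)f_k(t-\eta)\,d\eta.$$
   Context: $H$ is a separable Hilbert space with scalar product $(\cdot,\cdot)$ and norm $\|\cdot\|$. $A:H\to H$ is an unbounded positive selfadjoint operator with domain $D(A)$, having a system of orthonormal eigenfunctions $\{v_k\}_{k\ge1}$ complete in $H$, $Av_k=\lambda_kv_k$, with eigenvalues (repeated according to multiplicity) $0<\lambda_1\le\lambda_2\le\cdots\to+\infty$; the sequence $\{\lambda_k\}$ has no finite limit points. $h_k=(h,v_k)$ denotes the $k$-th Fourier coefficient of $h\in H$ (so $W_k=(W,v_k)$, $\varphi_k=(\varphi,v_k)$), and $h_k(t)=(h(t),v_k)$ for $H$-valued functions (so $f_k(t)=(f(t),v_k)$). For real $\tau$, the power of $A$ is $A^\tau h=\sum_{k=1}^\infty\lambda_k^\tau h_kv_k$ with domain $D(A^\tau)=\{h\in H:\sum_{k=1}^\infty\lambda_k^{2\tau}|h_k|^2<\infty\}$, which is a Hilbert space with the norm $\|h\|_\tau^2=\sum_{k=1}^\infty\lambda_k^{2\tau}|h_k|^2=\|A^\tau h\|^2$. For a function $h$ with values in $H$, the Caputo fractional derivative of order $0<\rho<1$ is $$D_t^\rho h(t)=\frac1{\Gamma(1-\rho)}\int_0^t\frac{h'(\xi)}{(t-\xi)^\rho}\,d\xi,\quad t>0,$$ provided the right-hand side exists. $C(I;X)$ is the set of continuous functions on the interval $I$ with values in $X$. The Mittag-Leffler functions are $E_{\rho,\mu}(z)=\sum_{n=0}^\infty\frac{z^n}{\Gamma(\rho n+\mu)}$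 and $E_\rho(z)=E_{\rho,1}(z)$. $K_0=\{k\ge1: E_\rho(-\lambda_k\xi_0^\rho)=\alpha\}$. Since $t\mapsto E_\rho(-t)$ is strictly decreasing for $t>0$, this set is either empty or the finite set $\{k_0,k_0+1,\dots,k_0+p_0-1\}$ of indices of a single eigenvalue $\lambda_{k_0}$ of multiplicity $p_0$. If $K_0=\emptyset$, the orthogonality conditions are void and $\sum_{k\notin K_0}$ means $\sum_{k=1}^\infty$.
   Formalization: In the Caputo derivative, h'(ξ)dξ is read as the Stieltjes differential dh(ξ), which agrees with the displayed formula for differentiable h; with h' taken literally, existence fails for some f merely continuous in t, since u can be nowhere differentiable. *)

theory Defs
  imports "HOL-Analysis.Analysis"
begin

section \<open>Real and complex Hilbert spaces\<close>

text \<open>The scalar field is either \<open>\<real>\<close> or \<open>\<complex>\<close>; the class axioms admit no other field. (A field that is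
  finite-dimensional over \<open>\<real>\<close> is isomorphic to one of them, and then \<open>norm_sq\<close> forces the norm to be
  the absolute value and \<open>sconj\<close> the usual conjugation.)\<close>

class scalar_field = real_normed_field + euclidean_space +
  fixes sconj :: "'a \<Rightarrow> 'a"
  assumes sconj_add: "sconj (x + y) = sconj x + sconj y"
    and sconj_mult: "sconj (x * y) = sconj x * sconj y"
    and sconj_sconj: "sconj (sconj x) = x"
    and mult_sconj: "x * sconj x = (norm x)\<^sup>2 *\<^sub>R 1"

instantiation real :: scalar_field
begin
definition sconj_real :: "real \<Rightarrow> real" where "sconj_real x = x"
instance by standard (auto simp: sconj_real_def power2_eq_square)
end

instantiation complex :: scalar_field
begin
definition sconj_complex :: "complex \<Rightarrow> complex" where "sconj_complex = cnj"
instance by standard (auto simp: sconj_complex_def complex_norm_square[symmetric] scaleR_conv_of_real)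
end

locale hilbert_space = vector_space scl
  for scl :: "'s::scalar_field \<Rightarrow> 'h::banach \<Rightarrow> 'h" +
  fixes ip :: "'h \<Rightarrow> 'h \<Rightarrow> 's"
  assumes scl_of_real: "scl (of_real r) x = r *\<^sub>R x"
    and ip_add: "ip (x + y) z = ip x z + ip y z"
    and ip_scl: "ip (scl c x) y = c * ip x y"
    and ip_sconj: "ip y x = sconj (ip x y)"
    and ip_self: "ip x x = of_real ((norm x)\<^sup>2)"

lemma hilbert_space_real_inner:
  "hilbert_space scaleR (inner :: 'h::{real_inner,banach} \<Rightarrow> 'h \<Rightarrow> real)"
  by unfold_locales
    (auto simp: algebra_simps inner_add_left sconj_real_def inner_commute power2_norm_eq_inner)

lemma hilbert_space_complex: "hilbert_space (*) (\<lambda>x y :: complex. x * cnj y)"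
  by unfold_locales
    (auto simp: algebra_simps sconj_complex_def scaleR_conv_of_real complex_norm_square[symmetric])

section \<open>The operator and its powers\<close>

text \<open>An unbounded operator is a domain \<open>D\<close> together with a map whose values outside \<open>D\<close> are irrelevant.
  The last conjunct says that the operator coincides, domain included, with its adjoint.\<close>

definition selfadjoint_op ::
    "('s::scalar_field \<Rightarrow> 'h::banach \<Rightarrow> 'h) \<Rightarrow> ('h \<Rightarrow> 'h \<Rightarrow> 's) \<Rightarrow> 'h set \<Rightarrow> ('h \<Rightarrow> 'h) \<Rightarrow> bool" where
  "selfadjoint_op scl ip D A \<longleftrightarrow>
     0 \<in> D \<and>
     (\<forall>x\<in>D. \<forall>y\<in>D. x + y \<in> D \<and> A (x + y) = A x + A y) \<and>
     (\<forall>c. \<forall>x\<in>D. scl c x \<in> D \<and> A (scl c x) = scl c (A x)) \<and>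
     closure D = UNIV \<and>
     (\<forall>y z. (\<forall>x\<in>D. ip (A x) y = ip x z) \<longleftrightarrow> y \<in> D \<and> z = A y)"

definition positive_op ::
    "('h::banach \<Rightarrow> 'h \<Rightarrow> 's::scalar_field) \<Rightarrow> 'h set \<Rightarrow> ('h \<Rightarrow> 'h) \<Rightarrow> bool" where
  "positive_op ip D A \<longleftrightarrow> (\<forall>x\<in>D. x \<noteq> 0 \<longrightarrow> (\<exists>r>0. ip (A x) x = of_real r))"

definition unbounded_op :: "'h::banach set \<Rightarrow> ('h \<Rightarrow> 'h) \<Rightarrow> bool" where
  "unbounded_op D A \<longleftrightarrow> \<not> (\<exists>B. \<forall>x\<in>D. norm (A x) \<le> B * norm x)"

definition complete_orthonormal ::
    "('h::banach \<Rightarrow> 'h \<Rightarrow> 's::scalar_field) \<Rightarrow> (nat \<Rightarrow> 'h) \<Rightarrow> bool" where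
  "complete_orthonormal ip v \<longleftrightarrow>
     (\<forall>j k. ip (v j) (v k) = (if j = k then 1 else 0)) \<and>
     (\<forall>h. (\<forall>k. ip h (v k) = 0) \<longrightarrow> h = 0)"

text \<open>Eigenvalues and eigenvectors are numbered from \<open>0\<close> instead of \<open>1\<close>.\<close>

locale spectral_operator = hilbert_space scl ip
  for scl :: "'s::scalar_field \<Rightarrow> 'h::banach \<Rightarrow> 'h" and ip :: "'h \<Rightarrow> 'h \<Rightarrow> 's" +
  fixes D :: "'h set" and A :: "'h \<Rightarrow> 'h" and lam :: "nat \<Rightarrow> real" and v :: "nat \<Rightarrow> 'h"
  assumes separable: "\<exists>S :: 'h set. countable S \<and> closure S = UNIV"
    and selfadjoint: "selfadjoint_op scl ip D A"
    and positive: "positive_op ip D A"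
    and unbounded: "unbounded_op D A"
    and onb: "complete_orthonormal ip v"
    and eigen: "v k \<in> D" "A (v k) = scl (of_real (lam k)) (v k)"
    and lam_pos: "0 < lam 0"
    and lam_mono: "mono lam"
    and lam_lim: "filterlim lam at_top sequentially"

definition power_dom ::
    "('h::banach \<Rightarrow> 'h \<Rightarrow> 's::scalar_field) \<Rightarrow> (nat \<Rightarrow> real) \<Rightarrow> (nat \<Rightarrow> 'h) \<Rightarrow> real \<Rightarrow> 'h set" where
  "power_dom ip lam v \<tau> = {h. summable (\<lambda>k. lam k powr (2 * \<tau>) * (norm (ip h (v k)))\<^sup>2)}"

definition power_norm ::
    "('h::banach \<Rightarrow> 'h \<Rightarrow> 's::scalar_field) \<Rightarrow> (nat \<Rightarrow> real) \<Rightarrow> (nat \<Rightarrow> 'h) \<Rightarrow> real \<Rightarrow> 'h \<Rightarrow> real" where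
  "power_norm ip lam v \<tau> h = sqrt (\<Sum>k. lam k powr (2 * \<tau>) * (norm (ip h (v k)))\<^sup>2)"

definition continuous_power_dom ::
    "('h::banach \<Rightarrow> 'h \<Rightarrow> 's::scalar_field) \<Rightarrow> (nat \<Rightarrow> real) \<Rightarrow> (nat \<Rightarrow> 'h) \<Rightarrow> real \<Rightarrow>
      real set \<Rightarrow> (real \<Rightarrow> 'h) \<Rightarrow> bool" where
  "continuous_power_dom ip lam v \<tau> I f \<longleftrightarrow>
     (\<forall>t\<in>I. f t \<in> power_dom ip lam v \<tau>) \<and>
     (\<forall>t\<in>I. ((\<lambda>s. power_norm ip lam v \<tau> (f s - f t)) \<longlongrightarrow> 0) (at t within I))"

section \<open>The Caputo derivative\<close>

text \<open>\<open>has_stieltjes_integral \<kappa> h y a b\<close> says that the integral of \<open>\<kappa>\<close> against \<open>dh\<close> over \<open>[a, b]\<close> is \<open>y\<close>.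
  It is \<open>has_integral\<close> with the length of each interval replaced by the increment of \<open>h\<close>.\<close>

definition has_stieltjes_integral ::
    "(real \<Rightarrow> real) \<Rightarrow> (real \<Rightarrow> 'a::real_normed_vector) \<Rightarrow> 'a \<Rightarrow> real \<Rightarrow> real \<Rightarrow> bool" where
  "has_stieltjes_integral \<kappa> h y a b \<longleftrightarrow>
     (\<forall>e>0. \<exists>\<gamma>. gauge \<gamma> \<and>
        (\<forall>p. p tagged_division_of {a..b} \<and> \<gamma> fine p \<longrightarrow>
           norm ((\<Sum>(x, K)\<in>p. \<kappa> x *\<^sub>R (h (Sup K) - h (Inf K))) - y) < e))"

text \<open>In the Caputo integral, \<open>h'(\<xi>) d\<xi>\<close> is read as \<open>dh(\<xi>)\<close>. If \<open>h\<close> is continuous on \<open>[0, t]\<close> and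
  differentiable on \<open>(0, t)\<close>, this is the integral of \<open>(t - \<xi>) powr (-\<rho>)\<close> times \<open>h'\<close>, see \<open>has_caputo_derivative_iff_classical\<close> below.
  The extension is needed: for a source \<open>f\<close> that is merely continuous in time (a Weierstrass function,
  say), the solution of \<open>D\<^sup>\<rho> u + \<lambda> u = f\<close> can fail to be differentiable at every point.
  The kernel has the value \<open>0\<close> at the endpoint \<open>\<xi> = t\<close>, because \<open>0 powr a = 0\<close>.\<close>

definition has_caputo_derivative ::
    "real \<Rightarrow> (real \<Rightarrow> 'a::real_normed_vector) \<Rightarrow> 'a \<Rightarrow> real \<Rightarrow> bool" where
  "has_caputo_derivative \<rho> h d t \<longleftrightarrow>
     (\<exists>y. has_stieltjes_integral (\<lambda>\<xi>. (t - \<xi>) powr (-\<rho>)) h y 0 t \<and> d = (1 / Gamma (1 - \<rho>)) *\<^sub>R y)"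

lemma gauge_limit_cong:
  fixes R S :: "(real \<times> real set) set \<Rightarrow> 'a::real_normed_vector"
  assumes RS: "\<And>e. 0 < e \<Longrightarrow> \<exists>\<gamma>. gauge \<gamma> \<and>
      (\<forall>p. p tagged_division_of {a..b} \<and> \<gamma> fine p \<longrightarrow> norm (R p - S p) < e)"
    and S: "\<forall>e>0. \<exists>\<gamma>. gauge \<gamma> \<and>
      (\<forall>p. p tagged_division_of {a..b} \<and> \<gamma> fine p \<longrightarrow> norm (S p - y) < e)"
  shows "\<forall>e>0. \<exists>\<gamma>. gauge \<gamma> \<and>
      (\<forall>p. p tagged_division_of {a..b} \<and> \<gamma> fine p \<longrightarrow> norm (R p - y) < e)"
proof (intro allI impI)
  fix e :: real
  assume "0 < e"
  then have e2: "0 < e / 2" by simp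
  from RS[OF e2] obtain \<gamma>1 where 1: "gauge \<gamma>1 \<and>
      (\<forall>p. p tagged_division_of {a..b} \<and> \<gamma>1 fine p \<longrightarrow> norm (R p - S p) < e / 2)"
    by (elim exE)
  from S[rule_format, OF e2] obtain \<gamma>2 where 2: "gauge \<gamma>2 \<and>
      (\<forall>p. p tagged_division_of {a..b} \<and> \<gamma>2 fine p \<longrightarrow> norm (S p - y) < e / 2)"
    by (elim exE) simp
  show "\<exists>\<gamma>. gauge \<gamma> \<and>
      (\<forall>p. p tagged_division_of {a..b} \<and> \<gamma> fine p \<longrightarrow> norm (R p - y) < e)"
  proof (intro exI conjI allI impI)
    show "gauge (\<lambda>x. \<gamma>1 x \<inter> \<gamma>2 x)" using 1 2 by (simp add: gauge_Int)
    fix p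
    assume p: "p tagged_division_of {a..b} \<and> (\<lambda>x. \<gamma>1 x \<inter> \<gamma>2 x) fine p"
    then have "\<gamma>1 fine p" "\<gamma>2 fine p" by (simp_all add: fine_Int)
    then have "norm (R p - S p) < e / 2" "norm (S p - y) < e / 2" using 1 2 p by simp_all
    then show "norm (R p - y) < e"
      using norm_triangle_ineq[of "R p - S p" "S p - y"] by simp
  qed
qed

lemma straddle_bound:
  fixes h :: "real \<Rightarrow> 'a::real_normed_vector"
  assumes "(h has_vector_derivative h') (at x)" "0 < c"
  shows "\<exists>d>0. \<forall>u v. u \<le> x \<and> x \<le> v \<and> u \<in> ball x d \<and> v \<in> ball x d \<longrightarrow>
           norm (h v - h u - (v - u) *\<^sub>R h') \<le> c * (v - u)"
proof -
  obtain d where d: "d > 0"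
    "\<And>y. \<bar>y - x\<bar> < d \<Longrightarrow> norm (h y - h x - (y - x) *\<^sub>R h') \<le> c * \<bar>y - x\<bar>"
    using assms(1)[unfolded has_vector_derivative_def has_derivative_at_alt] assms(2)
    by (metis real_norm_def)
  have "norm (h v - h u - (v - u) *\<^sub>R h') \<le> c * (v - u)"
    if "u \<le> x" "x \<le> v" "u \<in> ball x d" "v \<in> ball x d" for u v
  proof -
    have "h v - h u - (v - u) *\<^sub>R h' = (h v - h x - (v - x) *\<^sub>R h') - (h u - h x - (u - x) *\<^sub>R h')"
      by (simp add: algebra_simps)
    then have "norm (h v - h u - (v - u) *\<^sub>R h') \<le> c * \<bar>v - x\<bar> + c * \<bar>u - x\<bar>"
      using d(2)[of v] d(2)[of u] that
      by (smt (verit, best) dist_commute dist_real_def mem_ball norm_triangle_ineq4)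
    also have "\<dots> = c * (v - u)"
      using that by (simp add: algebra_simps)
    finally show ?thesis .
  qed
  then show ?thesis using d(1) by blast
qed

lemma stieltjes_close:
  fixes h h' :: "real \<Rightarrow> 'a::real_normed_vector" and \<kappa> :: "real \<Rightarrow> real"
  assumes t: "0 < t" and cont: "continuous_on {0..t} h"
    and deriv: "\<And>x. 0 < x \<Longrightarrow> x < t \<Longrightarrow> (h has_vector_derivative h' x) (at x)"
    and \<kappa>: "\<kappa> t = 0" and h': "h' 0 = 0" and e: "0 < e"
  shows "\<exists>\<gamma>. gauge \<gamma> \<and> (\<forall>p. p tagged_division_of {0..t} \<and> \<gamma> fine p \<longrightarrow>
     norm ((\<Sum>(x, K)\<in>p. \<kappa> x *\<^sub>R (h (Sup K) - h (Inf K)))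
         - (\<Sum>(x, K)\<in>p. measure lborel K *\<^sub>R (\<kappa> x *\<^sub>R h' x))) < e)"
proof -
  define c where "c = e / (4 * t)"
  have c: "c > 0" using e t by (simp add: c_def)
  have "\<exists>d>0. \<forall>u v. u \<le> x \<and> x \<le> v \<and> u \<in> ball x d \<and> v \<in> ball x d \<and> 0 < x \<and> x < t \<longrightarrow>
           norm (h v - h u - (v - u) *\<^sub>R h' x) \<le> c / (1 + \<bar>\<kappa> x\<bar>) * (v - u)" for x
  proof (cases "0 < x \<and> x < t")
    case True
    have "c / (1 + \<bar>\<kappa> x\<bar>) > 0" using c by (intro divide_pos_pos) auto
    moreover have "(h has_vector_derivative h' x) (at x)" using deriv True by simp
    ultimately obtain d where "d > 0" "\<forall>u v. u \<le> x \<and> x \<le> v \<and> u \<in> ball x d \<and> v \<in> ball x d \<longrightarrow>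
        norm (h v - h u - (v - u) *\<^sub>R h' x) \<le> c / (1 + \<bar>\<kappa> x\<bar>) * (v - u)"
      using straddle_bound by meson
    then show ?thesis by meson
  qed (auto intro: exI[of _ 1])
  then obtain d where d: "\<And>x. d x > 0"
    "\<And>x u v. \<lbrakk>u \<le> x; x \<le> v; u \<in> ball x (d x); v \<in> ball x (d x); 0 < x; x < t\<rbrakk> \<Longrightarrow>
        norm (h v - h u - (v - u) *\<^sub>R h' x) \<le> c / (1 + \<bar>\<kappa> x\<bar>) * (v - u)"
    by metis
  have "e / (4 * (1 + \<bar>\<kappa> 0\<bar>)) > 0" using e by (intro divide_pos_pos) auto
  then obtain d0 where d0: "d0 > 0"
    "\<And>s. s \<in> {0..t} \<Longrightarrow> s < d0 \<Longrightarrow> norm (h s - h 0) < e / (4 * (1 + \<bar>\<kappa> 0\<bar>))"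
  proof -
    assume *: "\<And>d0. \<lbrakk>0 < d0; \<And>s. s \<in> {0..t} \<Longrightarrow> s < d0 \<Longrightarrow>
        norm (h s - h 0) < e / (4 * (1 + \<bar>\<kappa> 0\<bar>))\<rbrakk> \<Longrightarrow> thesis"
    assume "e / (4 * (1 + \<bar>\<kappa> 0\<bar>)) > 0"
    moreover have "0 \<in> {0..t}" using t by simp
    ultimately obtain d0 where "d0 > 0"
      "\<forall>s\<in>{0..t}. dist s 0 < d0 \<longrightarrow> dist (h s) (h 0) < e / (4 * (1 + \<bar>\<kappa> 0\<bar>))"
      using cont unfolding continuous_on_iff by blast
    then show thesis by (intro *[of d0]) (auto simp: dist_norm)
  qed
  define \<gamma> where "\<gamma> x = ball x (if x = 0 then d0 else d x)" for x :: real
  have g: "gauge \<gamma>" unfolding \<gamma>_def using d(1) d0(1) by (intro gauge_ball_dependent) (simp add: d0(1))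
  have "norm ((\<Sum>(x, K)\<in>p. \<kappa> x *\<^sub>R (h (Sup K) - h (Inf K)))
         - (\<Sum>(x, K)\<in>p. measure lborel K *\<^sub>R (\<kappa> x *\<^sub>R h' x))) < e"
    if p: "p tagged_division_of {0..t}" "\<gamma> fine p" for p
  proof -
    note tp = tagged_division_ofD[OF p(1)]
    define F where "F = (\<lambda>(x, K). \<kappa> x *\<^sub>R (h (Sup K) - h (Inf K)) - measure lborel K *\<^sub>R (\<kappa> x *\<^sub>R h' x))"
    define q where "q = {(x, K)\<in>p. x = 0 \<and> Sup K \<noteq> 0}"
    have qp: "q \<subseteq> p" by (auto simp: q_def)
    have fq: "finite q" using tp(1) qp finite_subset by blast
    have shape: "\<exists>a b. K = {a..b} \<and> a \<le> x \<and> x \<le> b \<and> 0 \<le> a \<and> b \<le> t \<and> Inf K = a \<and> Sup K = b \<and>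
        measure lborel K = b - a \<and> K \<subseteq> \<gamma> x" if xp: "(x, K) \<in> p" for x K
    proof -
      obtain a b where ab: "K = {a..b}" using tp(4)[OF xp] by auto
      have "x \<in> K" "K \<subseteq> {0..t}" "K \<subseteq> \<gamma> x"
        using tp(2,3)[OF xp] p(2) xp by (auto simp: fine_def)
      then show ?thesis using ab by (intro exI[of _ a] exI[of _ b]) auto
    qed
    have F_out: "norm (F z) \<le> c * measure lborel (snd z)" if z: "z \<in> p - q" for z
    proof -
      obtain x K where xK: "z = (x, K)" by (cases z)
      with z have xp: "(x, K) \<in> p" by auto
      obtain a b where K: "K = {a..b}" "a \<le> x" "x \<le> b" "0 \<le> a" "b \<le> t" "Inf K = a" "Sup K = b"
        "measure lborel K = b - a" "K \<subseteq> \<gamma> x" using shape[OF xp] by blast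
      consider "x = 0" | "x = t" | "0 < x" "x < t" using K by linarith
      then show ?thesis
      proof cases
        case 1
        then have "Sup K = 0" using z xK by (auto simp: q_def)
        then have "a = 0" "b = 0" using K by auto
        then have "F z = 0" using h' xK 1 K(6-8) by (simp add: F_def)
        then show ?thesis using c by simp
      next
        case 2
        then have "F z = 0" using xK \<kappa> by (simp add: F_def)
        then show ?thesis using c by simp
      next
        case 3
        have "a \<in> ball x (d x)" "b \<in> ball x (d x)"
          using K 3 by (auto simp: \<gamma>_def subset_iff split: if_splits)
        then have *: "norm (h b - h a - (b - a) *\<^sub>R h' x) \<le> c / (1 + \<bar>\<kappa> x\<bar>) * (b - a)"
          using d(2) K 3 by blast
        have "F z = \<kappa> x *\<^sub>R (h b - h a - (b - a) *\<^sub>R h' x)"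
          by (simp add: F_def xK K(6-8) algebra_simps)
        then have "norm (F z) \<le> \<bar>\<kappa> x\<bar> * (c / (1 + \<bar>\<kappa> x\<bar>) * (b - a))"
          using mult_left_mono[OF *, of "\<bar>\<kappa> x\<bar>"] by simp
        also have "\<dots> = \<bar>\<kappa> x\<bar> / (1 + \<bar>\<kappa> x\<bar>) * (c * (b - a))"
          by simp
        also have "\<dots> \<le> 1 * (c * (b - a))"
          using c K by (intro mult_right_mono) auto
        finally show ?thesis using xK K by simp
      qed
    qed
    have F_in: "norm (F z) \<le> e / 4" if z: "z \<in> q" for z
    proof -
      obtain x K where xK: "z = (x, K)" by (cases z)
      with z have xp: "(x, K) \<in> p" and x0: "x = 0" by (auto simp: q_def)
      obtain a b where K: "K = {a..b}" "a \<le> x" "x \<le> b" "0 \<le> a" "b \<le> t" "Inf K = a" "Sup K = b"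
        "measure lborel K = b - a" "K \<subseteq> \<gamma> x" using shape[OF xp] by blast
      have "b \<in> \<gamma> 0" using K x0 by auto
      then have "b < d0" by (auto simp: \<gamma>_def)
      then have *: "norm (h b - h 0) \<le> e / (4 * (1 + \<bar>\<kappa> 0\<bar>))"
        using d0(2)[of b] K x0 by auto
      have "norm (F z) = \<bar>\<kappa> 0\<bar> * norm (h b - h 0)"
        using K x0 h' by (simp add: F_def xK)
      also have "\<dots> \<le> \<bar>\<kappa> 0\<bar> * (e / (4 * (1 + \<bar>\<kappa> 0\<bar>)))"
        by (rule mult_left_mono[OF *]) simp
      also have "\<dots> = \<bar>\<kappa> 0\<bar> / (1 + \<bar>\<kappa> 0\<bar>) * (e / 4)"
        by (simp add: field_simps)
      also have "\<dots> \<le> 1 * (e / 4)"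
        using e by (intro mult_right_mono) auto
      finally show ?thesis by simp
    qed
    have "z = w" if "z \<in> q" "w \<in> q" for z w
    proof (rule ccontr)
      assume ne: "z \<noteq> w"
      obtain K L where KL: "z = (0, K)" "w = (0, L)" "(0, K) \<in> p" "(0, L) \<in> p" "Sup K \<noteq> 0" "Sup L \<noteq> 0"
        using \<open>z \<in> q\<close> \<open>w \<in> q\<close> by (auto simp: q_def)
      obtain b where b: "K = {0..b}" "0 < b" using shape[OF KL(3)] KL(5) by fastforce
      obtain b' where b': "L = {0..b'}" "0 < b'" using shape[OF KL(4)] KL(6) by fastforce
      have "interior K \<inter> interior L = {}" using tp(5)[OF KL(3,4)] ne KL by auto
      moreover have "min b b' / 2 \<in> interior K \<inter> interior L" using b b' by auto
      ultimately show False by blast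
    qed
    then have "card q \<le> 1" using fq by (simp add: card_le_Suc0_iff_eq)
    have "(\<Sum>(x, K)\<in>p. \<kappa> x *\<^sub>R (h (Sup K) - h (Inf K)))
         - (\<Sum>(x, K)\<in>p. measure lborel K *\<^sub>R (\<kappa> x *\<^sub>R h' x)) = sum F p"
      unfolding F_def sum_subtractf[symmetric] by (intro sum.cong) auto
    also have "norm \<dots> = norm (sum F (p - q) + sum F q)"
      using sum.subset_diff[OF qp tp(1), of F] by simp
    also have "\<dots> \<le> (\<Sum>z\<in>p - q. c * measure lborel (snd z)) + (\<Sum>z\<in>q. e / 4)"
      using F_out F_in by (intro norm_triangle_le add_mono sum_norm_le) auto
    also have "(\<Sum>z\<in>p - q. c * measure lborel (snd z)) \<le> (\<Sum>z\<in>p. c * measure lborel (snd z))"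
      using tp(1) c by (intro sum_mono2) auto
    also have "\<dots> = c * t"
      using additive_content_tagged_division[of p 0 t] p(1) t
      by (simp add: sum_distrib_left[symmetric] case_prod_beta)
    also have "(\<Sum>z\<in>q. e / 4) \<le> 1 * (e / 4)"
      using \<open>card q \<le> 1\<close> e by (simp only: sum_constant) (intro mult_right_mono, auto)
    also have "c * t + 1 * (e / 4) < e" using e t by (simp add: c_def)
    finally show ?thesis by simp
  qed
  then show ?thesis using g by blast
qed

text \<open>Both integrals below exist or fail to exist together, and if they exist they are equal.\<close>

lemma has_caputo_derivative_iff_classical:
  fixes h h' :: "real \<Rightarrow> 'a::real_normed_vector"
  assumes t: "0 < t" and cont: "continuous_on {0..t} h"
    and deriv: "\<And>x. 0 < x \<Longrightarrow> x < t \<Longrightarrow> (h has_vector_derivative h' x) (at x)"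
  shows "has_caputo_derivative \<rho> h d t \<longleftrightarrow>
    (\<exists>y. ((\<lambda>\<xi>. (t - \<xi>) powr (-\<rho>) *\<^sub>R h' \<xi>) has_integral y) {0..t} \<and> d = (1 / Gamma (1 - \<rho>)) *\<^sub>R y)"
proof -
  define \<kappa> where "\<kappa> = (\<lambda>\<xi>. (t - \<xi>) powr (-\<rho>))"
  define g where "g = (\<lambda>x. if x = 0 then 0 else h' x)"
  define R where "R p = (\<Sum>(x, K)\<in>p. \<kappa> x *\<^sub>R (h (Sup K) - h (Inf K)))" for p
  define S where "S p = (\<Sum>(x, K)\<in>p. measure lborel K *\<^sub>R (\<kappa> x *\<^sub>R g x))" for p :: "(real \<times> real set) set"
  have \<kappa>g: "\<kappa> t = 0" "g 0 = 0" by (simp_all add: \<kappa>_def g_def)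
  have dg: "(h has_vector_derivative g x) (at x)" if "0 < x" "x < t" for x
    using deriv[OF that] that by (simp add: g_def)
  have close: "\<exists>\<gamma>. gauge \<gamma> \<and>
      (\<forall>p. p tagged_division_of {0..t} \<and> \<gamma> fine p \<longrightarrow> norm (R p - S p) < e)" if "0 < e" for e
    unfolding R_def S_def by (rule stieltjes_close[where h' = g and \<kappa> = \<kappa>, OF t cont _ \<kappa>g that]) (rule dg)
  have close': "\<exists>\<gamma>. gauge \<gamma> \<and>
      (\<forall>p. p tagged_division_of {0..t} \<and> \<gamma> fine p \<longrightarrow> norm (S p - R p) < e)" if "0 < e" for e
    unfolding norm_minus_commute[of "S p" "R p" for p] by (rule close[OF that])
  have "has_stieltjes_integral \<kappa> h y 0 t \<longleftrightarrow> ((\<lambda>x. \<kappa> x *\<^sub>R g x) has_integral y) {0..t}" for y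
  proof
    assume "has_stieltjes_integral \<kappa> h y 0 t"
    then show "((\<lambda>x. \<kappa> x *\<^sub>R g x) has_integral y) {0..t}"
      unfolding has_stieltjes_integral_def has_integral_real R_def[symmetric] S_def[symmetric]
      by (intro gauge_limit_cong[where R = S and S = R] close')
  next
    assume "((\<lambda>x. \<kappa> x *\<^sub>R g x) has_integral y) {0..t}"
    then show "has_stieltjes_integral \<kappa> h y 0 t"
      unfolding has_stieltjes_integral_def has_integral_real R_def[symmetric] S_def[symmetric]
      by (intro gauge_limit_cong[where R = R and S = S] close)
  qed
  moreover have "((\<lambda>x. \<kappa> x *\<^sub>R g x) has_integral y) {0..t} \<longleftrightarrow>
      ((\<lambda>x. \<kappa> x *\<^sub>R h' x) has_integral y) {0..t}" for y
    by (rule has_integral_spike_eq[of "{0}"]) (auto simp: g_def)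
  ultimately have "has_stieltjes_integral \<kappa> h y 0 t \<longleftrightarrow>
      ((\<lambda>x. \<kappa> x *\<^sub>R h' x) has_integral y) {0..t}" for y
    by (simp only:)
  from this[unfolded \<kappa>_def] show ?thesis
    unfolding has_caputo_derivative_def by (simp only:)
qed

section \<open>The nonlocal problem\<close>

definition mittag_leffler :: "real \<Rightarrow> real \<Rightarrow> real \<Rightarrow> real" where
  "mittag_leffler \<rho> \<mu> z = (\<Sum>n. z ^ n / Gamma (\<rho> * real n + \<mu>))"

definition resonant_indices :: "real \<Rightarrow> real \<Rightarrow> real \<Rightarrow> (nat \<Rightarrow> real) \<Rightarrow> nat set" where
  "resonant_indices \<rho> \<alpha> \<xi>\<^sub>0 lam = {k. mittag_leffler \<rho> 1 (- lam k * \<xi>\<^sub>0 powr \<rho>) = \<alpha>}"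

definition duhamel :: "real \<Rightarrow> real \<Rightarrow> (real \<Rightarrow> 's::scalar_field) \<Rightarrow> real \<Rightarrow> 's" where
  "duhamel \<rho> l g t =
     integral {0..t} (\<lambda>\<eta>. (\<eta> powr (\<rho> - 1) * mittag_leffler \<rho> \<rho> (- l * \<eta> powr \<rho>)) *\<^sub>R g (t - \<eta>))"

definition nonlocal_solution ::
    "'h::banach set \<Rightarrow> ('h \<Rightarrow> 'h) \<Rightarrow> real \<Rightarrow> real \<Rightarrow> real \<Rightarrow> real \<Rightarrow> real \<Rightarrow> (real \<Rightarrow> 'h) \<Rightarrow> 'h \<Rightarrow>
      (real \<Rightarrow> 'h) \<Rightarrow> 'h \<Rightarrow> bool" where
  "nonlocal_solution D A \<rho> T \<alpha> \<xi>\<^sub>0 \<xi>\<^sub>2 f W u \<phi> \<longleftrightarrow>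
     continuous_on {0..T} u \<and>
     (\<forall>t\<in>{0<..T}. u t \<in> D) \<and>
     continuous_on {0<..T} (\<lambda>t. A (u t)) \<and>
     (\<exists>Du. continuous_on {0<..T} Du \<and>
        (\<forall>t\<in>{0<..T}. has_caputo_derivative \<rho> u (Du t) t \<and> Du t + A (u t) = f t)) \<and>
     u \<xi>\<^sub>0 = \<alpha> *\<^sub>R u 0 + \<phi> \<and>
     u \<xi>\<^sub>2 = W"

end

theory Submission
  imports Defs
begin

text \<open>The Stieltjes integral that defines the Caputo derivative at \<open>t\<close> is the limit of its truncations to
  \<open>[0, c]\<close>, which can be integrated by parts. This has two consequences. At a maximum over \<open>[0, t]\<close> the
  derivative is bounded below, so \<open>D\<^sup>\<rho> z + l z = 0\<close> has only the zero solution with \<open>z 0 = 0\<close>; the same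
  maximum principle yields the bounds on Mittag-Leffler functions. And the derivative inverts the
  fractional integral of any continuous function, because the truncations average this function against an
  approximate identity.

  The coefficients of a solution are therefore \<open>E (- lam k * t powr \<rho>) * u\<^sub>k(0) + \<omega>\<^sub>k(t)\<close>, where the
  condition at \<open>\<xi>\<^sub>2\<close> determines \<open>u\<^sub>k(0)\<close> and the condition at \<open>\<xi>\<^sub>0\<close> then determines \<open>\<phi>\<^sub>k\<close>. Conversely,
  \<open>E (- lam k * \<xi>\<^sub>2 powr \<rho>)\<close> is bounded below by a multiple of \<open>1 / lam k\<close>, and the loss of one power of \<open>A\<close>
  is compensated by \<open>W \<in> D\<close> and by \<open>A \<omega>(t) \<in> H\<close>, for which \<open>f\<close> takes values in the domain of \<open>A\<close> to the power \<open>\<epsilon>\<close>.\<close>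

section \<open>The Stieltjes form of the Caputo derivative and the maximum principle\<close>

text \<open>Since \<open>f\<close> is only continuous in time, the coefficients of \<open>u\<close>
  need not be differentiable. Derivative identities are therefore replaced by Volterra equations,
  which express \<open>Gamma \<rho> * (y t - y 0)\<close> as the integral of
  \<open>(t - s) powr (\<rho> - 1) * g s\<close>; power series and convolutions satisfy them by
  direct computation. Uniqueness is a scalar matter, because bounded functionals carry the
  derivative to the coefficients. Existence is not: differentiability of each coefficient does not
  by itself make the Stieltjes integral of the whole series converge. Hence the inversion theorem is
  vector-valued and admits the singularity \<open>s powr (-\<rho>)\<close> that \<open>A u\<close>
  may have at 0, while its Volterra hypothesis is tested only on functionals that see finitely many
  coefficients. The gain for the source term is that \<open>l * r t\<close> is at most a multiple of
  \<open>l powr \<epsilon> * t powr (\<rho> * \<epsilon> - 1)\<close>, whose singularity is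
  integrable. At a resonant index the factor of the initial coefficient in the condition at the
  first point vanishes, and so does the Duhamel coefficient; orthogonality of \<open>\<phi>\<close>
  is thus consistent, and the second point still fixes the initial coefficient.\<close>

text \<open>Integration by parts of the kernel \<open>(t - \<xi>) powr (-\<rho>)\<close> against
  \<open>du\<close> over \<open>[0, c]\<close>. Only values of \<open>u\<close> and an ordinary
  integral remain, so continuity of \<open>u\<close> suffices; for \<open>c < t\<close> the kernel
  is smooth on the interval.\<close>

definition caputo_parts :: "real \<Rightarrow> (real \<Rightarrow> 'a::banach) \<Rightarrow> real \<Rightarrow> real \<Rightarrow> 'a" where
  "caputo_parts \<rho> u t c = (t - c) powr (-\<rho>) *\<^sub>R u c - t powr (-\<rho>) *\<^sub>R u 0
     - integral {0..c} (\<lambda>\<xi>. (\<rho> * (t - \<xi>) powr (-\<rho> - 1)) *\<^sub>R u \<xi>)"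

lemma caputo_kernel_has_derivative:
  fixes t \<rho> :: real
  assumes "x < t"
  shows "((\<lambda>\<xi>. (t - \<xi>) powr (-\<rho>)) has_real_derivative \<rho> * (t - x) powr (-\<rho> - 1)) (at x within S)"
  using assms by (auto intro!: derivative_eq_intros simp: powr_diff)

lemma continuous_on_caputo_kernel_deriv:
  fixes u :: "real \<Rightarrow> 'a::banach"
  assumes "continuous_on {0..t} u" "c < t" "0 \<le> a"
  shows "continuous_on {a..c} (\<lambda>\<xi>. (\<rho> * (t - \<xi>) powr (-\<rho> - 1)) *\<^sub>R u \<xi>)"
  using assms by (intro continuous_intros continuous_on_subset[OF assms(1)]) auto

text \<open>Local form of the integration by parts. The error of one Riemann-Stieltjes term splits
  into three terms, each pairing the variation of the kernel with the oscillation of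
  \<open>u\<close> around the tag. A bound proportional to \<open>b - a\<close> is what allows the
  errors to be added over a tagged division.\<close>

lemma caputo_parts_increment:
  fixes u :: "real \<Rightarrow> 'a::banach"
  assumes u: "continuous_on {0..t} u" and \<rho>: "0 < \<rho>" and x: "0 \<le> x" "x < t" and e: "0 < e"
  shows "\<exists>d>0. \<forall>a b. 0 \<le> a \<and> a \<le> x \<and> x \<le> b \<and> x - d < a \<and> b < x + d \<longrightarrow> b < t \<and>
     norm ((t - x) powr (-\<rho>) *\<^sub>R (u b - u a) - (caputo_parts \<rho> u t b - caputo_parts \<rho> u t a)) \<le> e * (b - a)"
proof -
  define \<kappa> where "\<kappa> \<xi> = (t - \<xi>) powr (-\<rho>)" for \<xi>
  define \<kappa>' where "\<kappa>' \<xi> = \<rho> * (t - \<xi>) powr (-\<rho> - 1)" for \<xi>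
  define d0 where "d0 = (t - x) / 2"
  \<comment> \<open>\<open>\<kappa>'\<close> increases towards \<open>t\<close>, so its value at the
    right end of the neighbourhood bounds it there and serves as a Lipschitz constant of
    \<open>\<kappa>\<close>.\<close>
  define M where "M = \<kappa>' (x + d0)"
  have d0: "d0 > 0" "x + d0 < t" using x by (auto simp: d0_def field_simps)
  have M: "M > 0" using d0 \<rho> by (auto simp: M_def \<kappa>'_def)
  have \<kappa>'_le: "0 \<le> \<kappa>' \<xi>" "\<kappa>' \<xi> \<le> M" if "\<xi> \<le> x + d0" for \<xi>
    using that d0 \<rho> by (auto simp: M_def \<kappa>'_def intro!: powr_mono2')
  have abs\<kappa>': "\<bar>\<kappa>' \<xi>\<bar> \<le> M" if "\<xi> \<le> x + d0" for \<xi>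
    using \<kappa>'_le[OF that] by simp
  have deriv: "(\<kappa> has_real_derivative \<kappa>' \<xi>) (at \<xi> within S)" if "\<xi> < t" for \<xi> S
    unfolding \<kappa>_def \<kappa>'_def by (rule caputo_kernel_has_derivative[OF that])
  have int\<kappa>': "(\<kappa>' has_integral (\<kappa> b - \<kappa> a)) {a..b}" if "a \<le> b" "b < t" for a b
    using that by (intro fundamental_theorem_of_calculus)
      (auto simp flip: has_real_derivative_iff_has_vector_derivative intro!: deriv)
  \<comment> \<open>The three error terms cost \<open>M * \<eta>\<close> times \<open>b - a\<close>,
    \<open>b - x\<close> and \<open>x - a\<close>, hence \<open>2 * M * \<eta> * (b - a)\<close> in
    all.\<close>
  define \<eta> where "\<eta> = e / (2 * M)"
  have "\<eta> > 0" using e M by (simp add: \<eta>_def)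
  then obtain d1 where d1: "d1 > 0" "\<And>y. y \<in> {0..t} \<Longrightarrow> \<bar>y - x\<bar> < d1 \<Longrightarrow> norm (u y - u x) < \<eta>"
    using u x unfolding continuous_on_iff dist_norm by (metis atLeastAtMost_iff less_imp_le real_norm_def)
  define d where "d = min d0 d1"
  have "b < t \<and> norm (\<kappa> x *\<^sub>R (u b - u a) - (caputo_parts \<rho> u t b - caputo_parts \<rho> u t a)) \<le> e * (b - a)"
    if ab: "0 \<le> a" "a \<le> x" "x \<le> b" "x - d < a" "b < x + d" for a b
  proof
    show bt: "b < t" using ab d0 by (auto simp: d_def)
    have near: "norm (u y - u x) \<le> \<eta>" if "y \<in> {a..b}" for y
      using that ab bt x by (intro less_imp_le d1(2)) (auto simp: d_def)
    have near\<kappa>': "\<bar>\<kappa>' \<xi>\<bar> \<le> M" if "\<xi> \<le> b" for \<xi>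
      by (rule abs\<kappa>') (use ab that in \<open>auto simp: d_def\<close>)
    have \<kappa>b: "\<bar>\<kappa> b - \<kappa> x\<bar> \<le> M * (b - x)"
      by (rule order_trans[OF has_integral_bound_real[OF _ _ int\<kappa>', of M "{}", unfolded real_norm_def]]) (use near\<kappa>' ab bt M in auto)
    have \<kappa>a: "\<bar>\<kappa> x - \<kappa> a\<bar> \<le> M * (x - a)"
      by (rule order_trans[OF has_integral_bound_real[OF _ _ int\<kappa>', of M "{}", unfolded real_norm_def]]) (use near\<kappa>' ab bt M in auto)
    have cont: "continuous_on {a'..b} (\<lambda>\<xi>. \<kappa>' \<xi> *\<^sub>R u \<xi>)" if "0 \<le> a'" for a'
      unfolding \<kappa>'_def by (rule continuous_on_caputo_kernel_deriv[OF u bt that])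
    have split: "integral {0..a} (\<lambda>\<xi>. \<kappa>' \<xi> *\<^sub>R u \<xi>) + integral {a..b} (\<lambda>\<xi>. \<kappa>' \<xi> *\<^sub>R u \<xi>) =
        integral {0..b} (\<lambda>\<xi>. \<kappa>' \<xi> *\<^sub>R u \<xi>)"
      using ab cont[of 0] by (intro Henstock_Kurzweil_Integration.integral_combine integrable_continuous_real) auto
    define J where "J = integral {a..b} (\<lambda>\<xi>. \<kappa>' \<xi> *\<^sub>R (u \<xi> - u x))"
    have J: "((\<lambda>\<xi>. \<kappa>' \<xi> *\<^sub>R (u \<xi> - u x)) has_integral (integral {a..b} (\<lambda>\<xi>. \<kappa>' \<xi> *\<^sub>R u \<xi>) - (\<kappa> b - \<kappa> a) *\<^sub>R u x)) {a..b}"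
      unfolding scaleR_diff_right using ab bt cont[of a]
      by (intro has_integral_diff integrable_integral integrable_continuous_real has_integral_scaleR_left int\<kappa>') auto
    have Jb: "norm (integral {a..b} (\<lambda>\<xi>. \<kappa>' \<xi> *\<^sub>R u \<xi>) - (\<kappa> b - \<kappa> a) *\<^sub>R u x) \<le> M * \<eta> * (b - a)"
    proof (rule order_trans[OF has_integral_bound_real[OF _ _ J, of "M * \<eta>" "{}"]])
      show "0 \<le> M * \<eta>" using M \<open>\<eta> > 0\<close> by simp
      show "norm (\<kappa>' \<xi> *\<^sub>R (u \<xi> - u x)) \<le> M * \<eta>" if "\<xi> \<in> {a..b} - {}" for \<xi>
        using \<kappa>'_le[of \<xi>] near[of \<xi>] that ab M by (auto simp: d_def intro!: mult_mono)
    qed (use ab in auto)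
    have eq: "\<kappa> x *\<^sub>R (u b - u a) - (caputo_parts \<rho> u t b - caputo_parts \<rho> u t a) =
       (integral {a..b} (\<lambda>\<xi>. \<kappa>' \<xi> *\<^sub>R u \<xi>) - (\<kappa> b - \<kappa> a) *\<^sub>R u x)
       - (\<kappa> b - \<kappa> x) *\<^sub>R (u b - u x) - (\<kappa> x - \<kappa> a) *\<^sub>R (u a - u x)"
      unfolding caputo_parts_def \<kappa>_def[symmetric] \<kappa>'_def[symmetric] split[symmetric]
      by (simp add: algebra_simps)
    have "norm \<dots> \<le> M * \<eta> * (b - a) + M * (b - x) * \<eta> + M * (x - a) * \<eta>"
      using ab M by (intro norm_triangle_le_diff add_mono Jb) (auto intro!: mult_mono \<kappa>a \<kappa>b near)
    also have "\<dots> = e * (b - a)" using M by (simp add: \<eta>_def field_simps)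
    finally show "norm (\<kappa> x *\<^sub>R (u b - u a) - (caputo_parts \<rho> u t b - caputo_parts \<rho> u t a)) \<le> e * (b - a)"
      by (simp only: eq)
  qed
  moreover have "d > 0" using d0 d1 by (simp add: d_def)
  ultimately show ?thesis unfolding \<kappa>_def by blast
qed

lemma caputo_parts_0 [simp]: "caputo_parts \<rho> u t 0 = 0"
  by (simp add: caputo_parts_def)

lemma caputo_parts_gauge:
  fixes u :: "real \<Rightarrow> 'a::banach"
  assumes u: "continuous_on {0..t} u" and \<rho>: "0 < \<rho>" and e: "0 < e"
  obtains d where "\<And>x. d x > 0"
    "\<And>x a b. \<lbrakk>0 \<le> a; a \<le> x; x \<le> b; x < t; x - d x < a; b < x + d x\<rbrakk> \<Longrightarrow> b < t"
    "\<And>x a b. \<lbrakk>0 \<le> a; a \<le> x; x \<le> b; x < t; x - d x < a; b < x + d x\<rbrakk> \<Longrightarrow>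
     norm ((t - x) powr (-\<rho>) *\<^sub>R (u b - u a) - (caputo_parts \<rho> u t b - caputo_parts \<rho> u t a)) \<le> e * (b - a)"
proof -
  have "\<exists>d>0. 0 \<le> x \<and> x < t \<longrightarrow> (\<forall>a b. 0 \<le> a \<and> a \<le> x \<and> x \<le> b \<and> x - d < a \<and> b < x + d \<longrightarrow> b < t \<and>
     norm ((t - x) powr (-\<rho>) *\<^sub>R (u b - u a) - (caputo_parts \<rho> u t b - caputo_parts \<rho> u t a)) \<le> e * (b - a))" for x
  proof (cases "0 \<le> x \<and> x < t")
    case True
    then show ?thesis using caputo_parts_increment[OF u \<rho> _ _ e, of x] by auto
  qed (auto intro: exI[of _ 1])
  then obtain d where d: "\<And>x. d x > 0" "\<And>x. 0 \<le> x \<and> x < t \<longrightarrow> (\<forall>a b. 0 \<le> a \<and> a \<le> x \<and> x \<le> b \<and> x - d x < a \<and> b < x + d x \<longrightarrow> b < t \<and>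
     norm ((t - x) powr (-\<rho>) *\<^sub>R (u b - u a) - (caputo_parts \<rho> u t b - caputo_parts \<rho> u t a)) \<le> e * (b - a))"
    by metis
  show thesis
  proof (rule that[of d])
    fix x a b
    assume *: "0 \<le> a" "a \<le> x" "x \<le> b" "x < t" "x - d x < a" "b < x + d x"
    then have "0 \<le> x" by linarith
    then show "b < t" "norm ((t - x) powr (-\<rho>) *\<^sub>R (u b - u a) - (caputo_parts \<rho> u t b - caputo_parts \<rho> u t a)) \<le> e * (b - a)"
      using d(2)[of x] * by blast+
  qed (rule d(1))
qed

lemma tagged_interval:
  fixes p :: "(real \<times> real set) set"
  assumes "p tagged_division_of {0..t}" "(x, K) \<in> p"
  obtains a b where "K = {a..b}" "0 \<le> a" "a \<le> x" "x \<le> b" "b \<le> t" "Inf K = a" "Sup K = b"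
    "measure lborel K = b - a"
proof -
  obtain a b where ab: "K = {a..b}" using tagged_division_ofD(4)[OF assms] by auto
  have "x \<in> K" "K \<subseteq> {0..t}" using tagged_division_ofD(2,3)[OF assms] by auto
  then show thesis by (intro that[of a b]) (auto simp: ab)
qed

lemma sum_content_tagged:
  assumes "p tagged_division_of {0..t::real}" "0 \<le> t"
  shows "(\<Sum>(x, K)\<in>p. e * measure lborel K) = e * t"
  using additive_content_tagged_division[of p 0 t] assms
  by (simp add: sum_distrib_left[symmetric] case_prod_beta)

text \<open>Since the kernel is \<open>0\<close> at the tag \<open>t\<close>, the interval with this tag does not contribute to the Riemann sums.
  Hence the integral is the limit of the integrals over \<open>[0, c]\<close>, and these can be integrated by parts.\<close>

lemma has_stieltjes_integral_caputo_iff: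
  fixes u :: "real \<Rightarrow> 'a::banach"
  assumes u: "continuous_on {0..t} u" and \<rho>: "0 < \<rho>" and t: "0 < t"
  shows "has_stieltjes_integral (\<lambda>\<xi>. (t - \<xi>) powr (-\<rho>)) u y 0 t \<longleftrightarrow> (caputo_parts \<rho> u t \<longlongrightarrow> y) (at_left t)"
proof
  define \<kappa> where "\<kappa> \<xi> = (t - \<xi>) powr (-\<rho>)" for \<xi>
  define L where "L = caputo_parts \<rho> u t"
  {
    assume lim: "(caputo_parts \<rho> u t \<longlongrightarrow> y) (at_left t)"
    show "has_stieltjes_integral (\<lambda>\<xi>. (t - \<xi>) powr (-\<rho>)) u y 0 t"
      unfolding has_stieltjes_integral_def
    proof (intro allI impI)
      fix e :: real assume e: "e > 0"
      define e1 where "e1 = e / (4 * t)"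
      have e1: "e1 > 0" using e t by (simp add: e1_def)
      obtain d where d: "\<And>x. d x > 0"
        "\<And>x a b. \<lbrakk>0 \<le> a; a \<le> x; x \<le> b; x < t; x - d x < a; b < x + d x\<rbrakk> \<Longrightarrow> b < t"
        "\<And>x a b. \<lbrakk>0 \<le> a; a \<le> x; x \<le> b; x < t; x - d x < a; b < x + d x\<rbrakk> \<Longrightarrow>
          norm (\<kappa> x *\<^sub>R (u b - u a) - (L b - L a)) \<le> e1 * (b - a)"
        using caputo_parts_gauge[OF u \<rho> e1] unfolding \<kappa>_def L_def by metis
      have "\<forall>\<^sub>F c in at_left t. norm (L c - y) < e / 4"
        using tendstoD[OF lim, of "e / 4"] e by (simp add: L_def dist_norm)
      then obtain s where s: "s < t" "\<And>c. s < c \<Longrightarrow> c < t \<Longrightarrow> norm (L c - y) < e / 4"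
        unfolding eventually_at_left_field by auto
      \<comment> \<open>Extending the truncated integral by the prospective limit \<open>y\<close>
        at \<open>t\<close> makes the telescoping sum over the whole division equal to
        \<open>y\<close>.\<close>
      define F where "F x = (if x < t then L x else y)" for x
      \<comment> \<open>The gauge at \<open>t\<close> forces an interval with tag \<open>t\<close>
        to begin after \<open>s\<close>, where \<open>L\<close> is already close to
        \<open>y\<close>.\<close>
      define r where "r x = (if x = t then t - s else d x)" for x
      have "gauge (\<lambda>x. ball x (r x))"
        using d(1) s by (intro gauge_ball_dependent) (auto simp: r_def)
      moreover have "norm ((\<Sum>(x, K)\<in>p. (t - x) powr - \<rho> *\<^sub>R (u (Sup K) - u (Inf K))) - y) < e"
        if p: "p tagged_division_of {0..t} \<and> (\<lambda>x. ball x (r x)) fine p" for p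
      proof -
        define q where "q = {(x, K)\<in>p. x = t \<and> Inf K \<noteq> t}"
        have qp: "q \<subseteq> p" by (auto simp: q_def)
        have fp: "finite p" using p by blast
        define G where "G = (\<lambda>(x, K). \<kappa> x *\<^sub>R (u (Sup K) - u (Inf K)) - (F (Sup K) - F (Inf K)))"
        have ball: "K \<subseteq> ball x (r x)" if "(x, K) \<in> p" for x K
          using p that by (auto simp: fine_def)
        have out: "norm (G z) \<le> (case z of (x, K) \<Rightarrow> e1 * measure lborel K)" if z: "z \<in> p - q" for z
        proof -
          obtain x K where xK: "z = (x, K)" by (cases z)
          then have xp: "(x, K) \<in> p" using z by auto
          obtain a b where K: "K = {a..b}" "0 \<le> a" "a \<le> x" "x \<le> b" "b \<le> t" "Inf K = a" "Sup K = b"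
            "measure lborel K = b - a" using tagged_interval[OF conjunct1[OF p] xp] .
          show ?thesis
          proof (cases "x < t")
            case True
            have "a \<in> K" "b \<in> K" using K by auto
            then have "a \<in> ball x (d x)" "b \<in> ball x (d x)"
              using ball[OF xp] True by (auto simp: r_def)
            then have *: "x - d x < a" "b < x + d x" using K by (auto simp: dist_real_def)
            then have "b < t" using d(2)[of a x b] K True by auto
            then have "G z = \<kappa> x *\<^sub>R (u b - u a) - (L b - L a)"
              using K by (simp add: G_def xK F_def)
            then show ?thesis using d(3)[of a x b] K True * by (auto simp: xK)
          next
            case False
            then have "x = t" "b = t" "a = t" using K z by (auto simp: q_def xK)
            then show ?thesis using K(6-8) by (simp add: G_def xK)
          qed
        qed
        have "in": "norm (G z) \<le> e / 4" if z: "z \<in> q" for z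
        proof -
          obtain x K where xK: "z = (x, K)" by (cases z)
          then have xp: "(x, K) \<in> p" "x = t" "Inf K \<noteq> t" using z by (auto simp: q_def)
          obtain a b where K: "K = {a..b}" "0 \<le> a" "a \<le> x" "x \<le> b" "b \<le> t" "Inf K = a" "Sup K = b"
            "measure lborel K = b - a" using tagged_interval[OF conjunct1[OF p] xp(1)] .
          have "a \<in> ball t (t - s)" using ball[OF xp(1)] K xp by (auto simp: r_def)
          then have "s < a" "a < t" "b = t" using K xp by (auto simp: dist_real_def)
          then show ?thesis
            using s(2)[of a] K xp by (simp add: G_def xK \<kappa>_def F_def norm_minus_commute)
        qed
        \<comment> \<open>Two nondegenerate intervals with the common tag \<open>t\<close> would
          both end at \<open>t\<close> and overlap, so the error \<open>e / 4\<close> occurs at most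
          once.\<close>
        have "z = w" if zw: "z \<in> q" "w \<in> q" for z w
        proof (rule ccontr)
          assume ne: "z \<noteq> w"
          obtain K M where KM: "z = (t, K)" "w = (t, M)" "(t, K) \<in> p" "(t, M) \<in> p" "Inf K \<noteq> t" "Inf M \<noteq> t"
            using zw by (auto simp: q_def)
          obtain a where a: "K = {a..t}" "a < t"
            using tagged_interval[OF conjunct1[OF p] KM(3)] KM(5) by (metis antisym less_le)
          obtain a' where a': "M = {a'..t}" "a' < t"
            using tagged_interval[OF conjunct1[OF p] KM(4)] KM(6) by (metis antisym less_le)
          have "interior K \<inter> interior M = {}" using tagged_division_ofD(5)[OF conjunct1[OF p] KM(3,4)] ne KM by auto
          moreover have "(max a a' + t) / 2 \<in> interior K \<inter> interior M" using a a' by auto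
          ultimately show False by blast
        qed
        then have "card q \<le> 1" using finite_subset[OF qp fp] by (simp add: card_le_Suc0_iff_eq)
        have tele: "(\<Sum>(x, K)\<in>p. F (Sup K) - F (Inf K)) = y"
          using additive_tagged_division_1[OF less_imp_le[OF t] conjunct1[OF p], of F] t
          by (simp add: F_def L_def)
        have "(\<Sum>(x, K)\<in>p. \<kappa> x *\<^sub>R (u (Sup K) - u (Inf K))) - y = sum G p"
          unfolding G_def by (subst tele[symmetric]) (simp add: sum_subtractf case_prod_beta)
        also have "norm \<dots> = norm (sum G (p - q) + sum G q)"
          using sum.subset_diff[OF qp fp, of G] by simp
        also have "\<dots> \<le> (\<Sum>(x, K)\<in>p - q. e1 * measure lborel K) + (\<Sum>z\<in>q. e / 4)"
          using "in" out by (intro norm_triangle_le add_mono sum_norm_le) auto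
        also have "(\<Sum>(x, K)\<in>p - q. e1 * measure lborel K) \<le> (\<Sum>(x, K)\<in>p. e1 * measure lborel K)"
          using fp e1 by (intro sum_mono2) auto
        also have "\<dots> = e1 * t" using p t by (intro sum_content_tagged) auto
        also have "(\<Sum>z\<in>q. e / 4) \<le> 1 * (e / 4)"
          using \<open>card q \<le> 1\<close> e by (simp only: sum_constant) (intro mult_right_mono, auto)
        also have "e1 * t + 1 * (e / 4) < e" using e t by (simp add: e1_def)
        finally show ?thesis by (simp add: \<kappa>_def)
      qed
      ultimately show "\<exists>\<gamma>. gauge \<gamma> \<and> (\<forall>p. p tagged_division_of {0..t} \<and> \<gamma> fine p \<longrightarrow>
          norm ((\<Sum>(x, K)\<in>p. (t - x) powr - \<rho> *\<^sub>R (u (Sup K) - u (Inf K))) - y) < e)" by blast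
    qed
  next
    assume int: "has_stieltjes_integral (\<lambda>\<xi>. (t - \<xi>) powr (-\<rho>)) u y 0 t"
    show "(caputo_parts \<rho> u t \<longlongrightarrow> y) (at_left t)"
    proof (rule tendstoI)
      fix e :: real assume e: "e > 0"
      define e1 where "e1 = e / (4 * t)"
      have e1: "e1 > 0" using e t by (simp add: e1_def)
      obtain d where d: "\<And>x. d x > 0"
        "\<And>x a b. \<lbrakk>0 \<le> a; a \<le> x; x \<le> b; x < t; x - d x < a; b < x + d x\<rbrakk> \<Longrightarrow> b < t"
        "\<And>x a b. \<lbrakk>0 \<le> a; a \<le> x; x \<le> b; x < t; x - d x < a; b < x + d x\<rbrakk> \<Longrightarrow>
          norm (\<kappa> x *\<^sub>R (u b - u a) - (L b - L a)) \<le> e1 * (b - a)"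
        using caputo_parts_gauge[OF u \<rho> e1] unfolding \<kappa>_def L_def by metis
      have "e / 2 > 0" using e by simp
      from int[unfolded has_stieltjes_integral_def, THEN spec, THEN mp, OF this, folded \<kappa>_def]
      obtain \<gamma> where \<gamma>0: "gauge \<gamma> \<and> (\<forall>p. p tagged_division_of {0..t} \<and> \<gamma> fine p \<longrightarrow>
          norm ((\<Sum>(x, K)\<in>p. \<kappa> x *\<^sub>R (u (Sup K) - u (Inf K))) - y) < e / 2)"
        by (elim exE)
      then have \<gamma>: "gauge \<gamma>" "\<And>p. p tagged_division_of {0..t} \<Longrightarrow> \<gamma> fine p \<Longrightarrow>
          norm ((\<Sum>(x, K)\<in>p. \<kappa> x *\<^sub>R (u (Sup K) - u (Inf K))) - y) < e / 2"
        by simp_all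
      obtain r where r: "r > 0" "ball t r \<subseteq> \<gamma> t"
        using \<gamma>(1) unfolding gauge_def by (meson open_contains_ball)
      have "dist (L c) y < e" if c: "max 0 (t - r) < c" "c < t" for c
      proof -
        have "gauge (\<lambda>x. \<gamma> x \<inter> ball x (d x))"
          using \<gamma>(1) d(1) by (intro gauge_Int gauge_ball_dependent) auto
        from fine_division_exists_real[OF this, of 0 c] obtain p where
          p: "p tagged_division_of {0..c}" "(\<lambda>x. \<gamma> x \<inter> ball x (d x)) fine p" .
        have fp: "finite p" using p by blast
        \<comment> \<open>Appending \<open>[c, t]\<close> with tag \<open>t\<close> completes the
          division without changing the Riemann sum, because the kernel vanishes at this
          tag.\<close>
        define P where "P = p \<union> {(t, {c..t})}"
        have "P tagged_division_of ({0..c} \<union> {c..t})"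
          unfolding P_def using c by (intro tagged_division_Un p tagged_division_of_self_real) auto
        also have "{0..c} \<union> {c..t} = {0..t}" using c by auto
        finally have P: "P tagged_division_of {0..t}" .
        have "\<gamma> fine P"
          unfolding P_def using p(2) r(2) c by (intro fine_Un) (auto simp: fine_def dist_real_def subset_iff)
        then have 1: "norm ((\<Sum>(x, K)\<in>P. \<kappa> x *\<^sub>R (u (Sup K) - u (Inf K))) - y) < e / 2"
          by (rule \<gamma>(2)[OF P])
        have new: "(t, {c..t}) \<notin> p"
          using tagged_interval[OF p(1), of t "{c..t}"] c by auto
        have "(\<Sum>(x, K)\<in>P. \<kappa> x *\<^sub>R (u (Sup K) - u (Inf K))) = (\<Sum>(x, K)\<in>p. \<kappa> x *\<^sub>R (u (Sup K) - u (Inf K)))"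
          unfolding P_def using fp new by (simp add: \<kappa>_def)
        moreover have "norm ((\<Sum>(x, K)\<in>p. \<kappa> x *\<^sub>R (u (Sup K) - u (Inf K))) - L c) \<le> e1 * c"
        proof -
          have "L c = (\<Sum>(x, K)\<in>p. L (Sup K) - L (Inf K))"
            using additive_tagged_division_1[of 0 c p L] c p(1) by (simp add: L_def)
          then have "(\<Sum>(x, K)\<in>p. \<kappa> x *\<^sub>R (u (Sup K) - u (Inf K))) - L c =
              (\<Sum>(x, K)\<in>p. \<kappa> x *\<^sub>R (u (Sup K) - u (Inf K)) - (L (Sup K) - L (Inf K)))"
            by (simp add: sum_subtractf case_prod_beta)
          also have "norm \<dots> \<le> (\<Sum>(x, K)\<in>p. e1 * measure lborel K)"
          proof (rule sum_norm_le, clarify)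
            fix x K assume xp: "(x, K) \<in> p"
            obtain a b where K: "K = {a..b}" "0 \<le> a" "a \<le> x" "x \<le> b" "b \<le> c" "Inf K = a" "Sup K = b"
              "measure lborel K = b - a" using tagged_interval[OF p(1) xp] .
            have "K \<subseteq> ball x (d x)" using p(2) xp by (auto simp: fine_def)
            moreover have "a \<in> K" "b \<in> K" using K by auto
            ultimately have "a \<in> ball x (d x)" "b \<in> ball x (d x)" by blast+
            then have *: "x - d x < a" "b < x + d x" using K by (auto simp: dist_real_def)
            then show "norm (\<kappa> x *\<^sub>R (u (Sup K) - u (Inf K)) - (L (Sup K) - L (Inf K))) \<le> e1 * measure lborel K"
              using d(3)[of a x b] K c by auto
          qed
          also have "\<dots> = e1 * c" using p(1) c by (intro sum_content_tagged) auto
          finally show ?thesis .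
        qed
        moreover have "e1 * c \<le> e1 * t" using e1 c by simp
        moreover have "e1 * t = e / 4" using t by (simp add: e1_def)
        ultimately have "norm (L c - y) < e / 2 + e / 4"
          using 1 norm_triangle_ineq[of "L c - (\<Sum>(x, K)\<in>p. \<kappa> x *\<^sub>R (u (Sup K) - u (Inf K)))"
              "(\<Sum>(x, K)\<in>p. \<kappa> x *\<^sub>R (u (Sup K) - u (Inf K))) - y"]
          by (simp add: norm_minus_commute)
        then show ?thesis using e by (simp add: dist_norm)
      qed
      then show "\<forall>\<^sub>F c in at_left t. dist (caputo_parts \<rho> u t c) y < e"
        unfolding eventually_at_left_field L_def using r t by (intro exI[of _ "max 0 (t - r)"]) auto
    qed
  }
qed

text \<open>The working form of the derivative: linearity, the behaviour at a maximum and the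
  inversion of fractional integrals are all proved from this limit.\<close>

lemma has_caputo_derivative_iff:
  fixes u :: "real \<Rightarrow> 'a::banach"
  assumes u: "continuous_on {0..t} u" and \<rho>: "0 < \<rho>" "\<rho> < 1" and t: "0 < t"
  shows "has_caputo_derivative \<rho> u d t \<longleftrightarrow> (caputo_parts \<rho> u t \<longlongrightarrow> Gamma (1 - \<rho>) *\<^sub>R d) (at_left t)"
proof -
  have "Gamma (1 - \<rho>) > 0" using \<rho> by (intro Gamma_real_pos) auto
  then have "d = (1 / Gamma (1 - \<rho>)) *\<^sub>R y \<longleftrightarrow> y = Gamma (1 - \<rho>) *\<^sub>R d" for y
    by auto
  then show ?thesis
    unfolding has_caputo_derivative_def has_stieltjes_integral_caputo_iff[OF u \<rho>(1) t] by simp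
qed

section \<open>Linearity of the Caputo derivative\<close>

lemma caputo_parts_linear:
  fixes u :: "real \<Rightarrow> 'a::banach"
  assumes "bounded_linear P" "continuous_on {0..t} u" "0 \<le> c" "c < t"
  shows "caputo_parts \<rho> (\<lambda>x. P (u x)) t c = P (caputo_parts \<rho> u t c)"
proof -
  interpret P: bounded_linear P by fact
  have "(\<lambda>\<xi>. (\<rho> * (t - \<xi>) powr (-\<rho> - 1)) *\<^sub>R u \<xi>) integrable_on {0..c}"
    using assms by (intro integrable_continuous_real continuous_on_caputo_kernel_deriv) auto
  from integral_linear[OF this assms(1)] show ?thesis
    by (simp add: caputo_parts_def P.diff P.scaleR o_def)
qed

lemma caputo_parts_diff:
  fixes u w :: "real \<Rightarrow> 'a::banach"
  assumes "continuous_on {0..t} u" "continuous_on {0..t} w" "0 \<le> c" "c < t"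
  shows "caputo_parts \<rho> (\<lambda>x. u x - w x) t c = caputo_parts \<rho> u t c - caputo_parts \<rho> w t c"
proof -
  have "(\<lambda>\<xi>. (\<rho> * (t - \<xi>) powr (-\<rho> - 1)) *\<^sub>R u \<xi>) integrable_on {0..c}"
    "(\<lambda>\<xi>. (\<rho> * (t - \<xi>) powr (-\<rho> - 1)) *\<^sub>R w \<xi>) integrable_on {0..c}"
    using assms by (auto intro!: integrable_continuous_real continuous_on_caputo_kernel_deriv)
  then show ?thesis
    by (simp add: caputo_parts_def Henstock_Kurzweil_Integration.integral_diff algebra_simps)
qed

lemma eventually_at_left_interval:
  assumes "0 < (t::real)" "\<And>c. 0 < c \<Longrightarrow> c < t \<Longrightarrow> P c"
  shows "eventually P (at_left t)"
  unfolding eventually_at_left_field using assms by (intro exI[of _ 0]) auto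

lemma has_caputo_derivative_linear:
  fixes u :: "real \<Rightarrow> 'a::banach" and P :: "'a \<Rightarrow> 'b::banach"
  assumes P: "bounded_linear P" and u: "continuous_on {0..t} u" and \<rho>: "0 < \<rho>" "\<rho> < 1" and t: "0 < t"
    and d: "has_caputo_derivative \<rho> u d t"
  shows "has_caputo_derivative \<rho> (\<lambda>x. P (u x)) (P d) t"
proof -
  interpret P: bounded_linear P by fact
  have Pu: "continuous_on {0..t} (\<lambda>x. P (u x))" by (rule P.continuous_on[OF u])
  have "((\<lambda>c. P (caputo_parts \<rho> u t c)) \<longlongrightarrow> P (Gamma (1 - \<rho>) *\<^sub>R d)) (at_left t)"
    using d[unfolded has_caputo_derivative_iff[OF u \<rho> t]] by (rule P.tendsto)
  then show ?thesis
    unfolding has_caputo_derivative_iff[OF Pu \<rho> t] P.scaleR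
    by (rule Lim_transform_eventually)
      (use t in \<open>auto intro!: eventually_at_left_interval caputo_parts_linear[OF P u, symmetric]\<close>)
qed

lemma has_caputo_derivative_diff:
  fixes u w :: "real \<Rightarrow> 'a::banach"
  assumes u: "continuous_on {0..t} u" and w: "continuous_on {0..t} w"
    and \<rho>: "0 < \<rho>" "\<rho> < 1" and t: "0 < t"
    and d: "has_caputo_derivative \<rho> u d t" "has_caputo_derivative \<rho> w d' t"
  shows "has_caputo_derivative \<rho> (\<lambda>x. u x - w x) (d - d') t"
proof -
  have uw: "continuous_on {0..t} (\<lambda>x. u x - w x)" using u w by (intro continuous_intros)
  have "((\<lambda>c. caputo_parts \<rho> u t c - caputo_parts \<rho> w t c) \<longlongrightarrow> Gamma (1 - \<rho>) *\<^sub>R d - Gamma (1 - \<rho>) *\<^sub>R d') (at_left t)"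
    using d unfolding has_caputo_derivative_iff[OF u \<rho> t] has_caputo_derivative_iff[OF w \<rho> t]
    by (rule tendsto_diff)
  then show ?thesis
    unfolding has_caputo_derivative_iff[OF uw \<rho> t] scaleR_diff_right
    by (rule Lim_transform_eventually)
      (use t in \<open>auto intro!: eventually_at_left_interval caputo_parts_diff[OF u w, symmetric]\<close>)
qed

text \<open>With \<open>m = z t\<close> the integral over \<open>[0, c]\<close> is \<open>t powr (-\<rho>) * (m - z 0) + N c - \<kappa> c * (m - z c)\<close>,
  where \<open>N\<close> is a primitive of \<open>\<kappa>' * (m - z)\<close>. If the limit of \<open>N - \<kappa> * (m - z)\<close> were below \<open>-b < 0\<close>, then
  \<open>(N + b) / \<kappa>\<close> would be nondecreasing near \<open>t\<close>, which keeps \<open>m - z c \<ge> (N c + b) / \<kappa> c\<close> away from \<open>0\<close>.\<close>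

lemma caputo_derivative_at_max:
  fixes z :: "real \<Rightarrow> real"
  assumes z: "continuous_on {0..t} z" and \<rho>: "0 < \<rho>" "\<rho> < 1" and t: "0 < t"
    and max: "\<And>s. 0 \<le> s \<Longrightarrow> s \<le> t \<Longrightarrow> z s \<le> z t"
    and d: "has_caputo_derivative \<rho> z d t"
  shows "t powr (-\<rho>) * (z t - z 0) \<le> Gamma (1 - \<rho>) * d"
proof (rule ccontr)
  assume neg: "\<not> ?thesis"
  define y where "y s = z t - z s" for s
  define \<kappa> where "\<kappa> \<xi> = (t - \<xi>) powr (-\<rho>)" for \<xi>
  define \<kappa>' where "\<kappa>' \<xi> = \<rho> * (t - \<xi>) powr (-\<rho> - 1)" for \<xi>
  define N where "N c = integral {0..c} (\<lambda>\<xi>. \<kappa>' \<xi> * y \<xi>)" for c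
  \<comment> \<open>Half of the gap: the truncated integrals tend to
    \<open>t powr (-\<rho>) * (z t - z 0) - 2 * b\<close>, so near \<open>t\<close> they stay below
    the claimed bound by at least \<open>b\<close>.\<close>
  define b where "b = (t powr (-\<rho>) * (z t - z 0) - Gamma (1 - \<rho>) * d) / 2"
  have b: "b > 0" using neg by (simp add: b_def)
  have y: "continuous_on {0..t} y" unfolding y_def by (intro continuous_intros z)
  have y0: "0 \<le> y s" if "0 \<le> s" "s \<le> t" for s using max that by (simp add: y_def)
  have \<kappa>0: "\<kappa> c > 0" "\<kappa>' c > 0" if "c < t" for c using that \<rho> by (auto simp: \<kappa>_def \<kappa>'_def)
  have deriv: "(\<kappa> has_real_derivative \<kappa>' \<xi>) (at \<xi> within S)" if "\<xi> < t" for \<xi> S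
    unfolding \<kappa>_def \<kappa>'_def by (rule caputo_kernel_has_derivative[OF that])
  have cont: "continuous_on {0..c} (\<lambda>\<xi>. \<kappa>' \<xi> * y \<xi>)" if "c < t" for c
    using continuous_on_caputo_kernel_deriv[OF y that] by (simp add: \<kappa>'_def)
  have parts: "caputo_parts \<rho> z t c = \<kappa> 0 * (z t - z 0) + (N c - \<kappa> c * y c)" if c: "0 < c" "c < t" for c
  proof -
    have "(\<kappa>' has_integral (\<kappa> c - \<kappa> 0)) {0..c}"
      using c by (intro fundamental_theorem_of_calculus)
        (auto simp flip: has_real_derivative_iff_has_vector_derivative intro!: deriv)
    then have "((\<lambda>\<xi>. \<kappa>' \<xi> * z t - \<kappa>' \<xi> * y \<xi>) has_integral ((\<kappa> c - \<kappa> 0) * z t - N c)) {0..c}"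
      unfolding N_def using cont[OF c(2)]
      by (intro has_integral_diff has_integral_mult_left integrable_integral integrable_continuous_real)
    then have "((\<lambda>\<xi>. \<kappa>' \<xi> * z \<xi>) has_integral ((\<kappa> c - \<kappa> 0) * z t - N c)) {0..c}"
      by (simp add: y_def algebra_simps)
    then have "integral {0..c} (\<lambda>\<xi>. \<kappa>' \<xi> * z \<xi>) = (\<kappa> c - \<kappa> 0) * z t - N c"
      by (rule integral_unique)
    then show ?thesis
      unfolding caputo_parts_def real_scaleR_def \<kappa>'_def[symmetric]
      by (simp add: \<kappa>_def y_def algebra_simps)
  qed
  have "\<forall>\<^sub>F c in at_left t. caputo_parts \<rho> z t c < \<kappa> 0 * (z t - z 0) - b"
    using d[unfolded has_caputo_derivative_iff[OF z \<rho> t]]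
    by (rule order_tendstoD) (use b in \<open>simp add: \<kappa>_def b_def field_simps\<close>)
  then obtain s where s: "s < t" "\<And>c. s < c \<Longrightarrow> c < t \<Longrightarrow> caputo_parts \<rho> z t c < \<kappa> 0 * (z t - z 0) - b"
    unfolding eventually_at_left_field by auto
  define c0 where "c0 = (max s 0 + t) / 2"
  have c0: "s < c0" "0 < c0" "c0 < t" using s t by (auto simp: c0_def)
  have key: "N c + b \<le> \<kappa> c * y c" if "c0 \<le> c" "c < t" for c
    using parts[of c] s(2)[of c] that c0 by force
  define q where "q = (N c0 + b) / \<kappa> c0"
  have "N c0 \<ge> 0"
    unfolding N_def using cont[OF c0(3)] y0 \<kappa>0 c0
    by (intro Henstock_Kurzweil_Integration.integral_nonneg integrable_continuous_real) (auto intro!: mult_nonneg_nonneg simp: less_imp_le)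
  then have q: "q > 0" using b \<kappa>0 c0 by (simp add: q_def)
  have dN: "(N has_real_derivative \<kappa>' c * y c) (at c)" if "0 < c" "c < t" for c
  proof -
    have "(N has_vector_derivative \<kappa>' c * y c) (at c within {0..(c + t) / 2})"
      unfolding N_def using that by (intro integral_has_vector_derivative cont) auto
    moreover have "at c within {0..(c + t) / 2} = at c"
      using that by (intro at_within_interior) (auto simp: interior_atLeastAtMost_real)
    ultimately show ?thesis by (simp add: has_real_derivative_iff_has_vector_derivative)
  qed
  have qy: "q \<le> y c" if c: "c0 \<le> c" "c < t" for c
  proof -
    have "q \<le> (N c + b) / \<kappa> c"
      unfolding q_def
    proof (rule DERIV_nonneg_imp_nondecreasing[OF c(1)])
      fix x assume x: "c0 \<le> x" "x \<le> c"
      then have xt: "0 < x" "x < t" using c c0 by auto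
      have "((\<lambda>c. (N c + b) / \<kappa> c) has_real_derivative
          ((\<kappa>' x * y x + 0) * \<kappa> x - (N x + b) * \<kappa>' x) / (\<kappa> x * \<kappa> x)) (at x)"
        using \<kappa>0[OF xt(2)] xt by (intro DERIV_divide DERIV_add dN deriv DERIV_const) auto
      moreover have "((\<kappa>' x * y x + 0) * \<kappa> x - (N x + b) * \<kappa>' x) / (\<kappa> x * \<kappa> x) \<ge> 0"
        using mult_left_mono[OF key[of x], of "\<kappa>' x"] \<kappa>0[OF xt(2)] x xt
        by (intro divide_nonneg_nonneg) (auto simp: algebra_simps)
      ultimately show "\<exists>y. ((\<lambda>c. (N c + b) / \<kappa> c) has_real_derivative y) (at x) \<and> 0 \<le> y" by blast
    qed
    also have "\<dots> \<le> y c" using key[OF c] \<kappa>0[OF c(2)] by (simp add: field_simps)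
    finally show ?thesis .
  qed
  have "(y \<longlongrightarrow> y t) (at_left t)"
  proof -
    have "(y \<longlongrightarrow> y t) (at t within {0..t})" using y t by (auto simp: continuous_on_def)
    then show ?thesis by (simp add: at_within_Icc_at_left[OF t])
  qed
  moreover have "\<forall>\<^sub>F c in at_left t. q \<le> y c"
    unfolding eventually_at_left_field using c0 qy by (intro exI[of _ c0]) auto
  ultimately have "q \<le> y t" by (intro tendsto_lowerbound) auto
  then show False using q by (simp add: y_def)
qed

text \<open>A positive maximum over \<open>[0, T]\<close> would be attained at some
  \<open>t > 0\<close>, where the derivative is nonnegative and \<open>l * z t\<close> positive,
  against the differential inequality. Its other use is to give the signs of the relaxation
  functions.\<close>

lemma caputo_nonpos:
  fixes z d :: "real \<Rightarrow> real"
  assumes z: "continuous_on {0..T} z" and \<rho>: "0 < \<rho>" "\<rho> < 1" and l: "0 < l" and z0: "z 0 \<le> 0"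
    and d: "\<And>t. 0 < t \<Longrightarrow> t \<le> T \<Longrightarrow> has_caputo_derivative \<rho> z (d t) t"
    and le: "\<And>t. 0 < t \<Longrightarrow> t \<le> T \<Longrightarrow> d t + l * z t \<le> 0"
    and s: "0 \<le> s" "s \<le> T"
  shows "z s \<le> 0"
proof (rule ccontr)
  assume "\<not> z s \<le> 0"
  obtain t where t: "t \<in> {0..T}" "\<And>x. x \<in> {0..T} \<Longrightarrow> z x \<le> z t"
    using continuous_attains_sup[OF _ _ z] s by auto
  have zt: "z t > 0" using t(2)[of s] s \<open>\<not> z s \<le> 0\<close> by auto
  then have t0: "0 < t" "t \<le> T" using t z0 by (auto simp: less_le)
  have "0 \<le> t powr (-\<rho>) * (z t - z 0)" using zt z0 by simp
  also have "\<dots> \<le> Gamma (1 - \<rho>) * d t"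
    using t t0 by (intro caputo_derivative_at_max[OF continuous_on_subset[OF z] \<rho> t0(1) _ d[OF t0]]) auto
  finally have "0 \<le> Gamma (1 - \<rho>) * d t" .
  moreover have "0 < Gamma (1 - \<rho>)" using \<rho> by (intro Gamma_real_pos) simp
  ultimately have "0 \<le> d t" by (simp add: zero_le_mult_iff)
  then show False using le[OF t0] mult_pos_pos[OF l zt] by linarith
qed

lemma caputo_unique_zero:
  fixes z :: "real \<Rightarrow> real"
  assumes z: "continuous_on {0..T} z" and \<rho>: "0 < \<rho>" "\<rho> < 1" and l: "0 < l" and z0: "z 0 = 0"
    and d: "\<And>t. 0 < t \<Longrightarrow> t \<le> T \<Longrightarrow> has_caputo_derivative \<rho> z (- l * z t) t"
    and s: "0 \<le> s" "s \<le> T"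
  shows "z s = 0"
proof -
  have "z s \<le> 0"
    by (rule caputo_nonpos[OF z \<rho> l _ d _ s]) (use z0 in auto)
  moreover have "has_caputo_derivative \<rho> (\<lambda>x. - z x) (- (- l * z t)) t" if "0 < t" "t \<le> T" for t
    using that by (intro has_caputo_derivative_linear[of uminus, OF _ continuous_on_subset[OF z] \<rho>] d)
      (auto intro: bounded_linear_minus bounded_linear_ident)
  then have "- z s \<le> 0"
    by (intro caputo_nonpos[of T "\<lambda>x. - z x" \<rho> l "\<lambda>t. - (- l * z t)", OF _ \<rho> l _ _ _ s] continuous_intros z)
      (use z0 in auto)
  ultimately show ?thesis by simp
qed

section \<open>Fractional integrals of power series\<close>

lemma continuous_on_Icc_bounded:
  fixes h :: "real \<Rightarrow> 'a::real_normed_vector"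
  assumes "continuous_on {a..b} h"
  obtains B where "0 < B" "\<And>x. x \<in> {a..b} \<Longrightarrow> norm (h x) \<le> B"
proof -
  have "bounded (h ` {a..b})" by (intro compact_imp_bounded compact_continuous_image assms) auto
  then show thesis using that by (auto simp: bounded_pos)
qed

text \<open>The inversion theorem is stated for functions dominated by a multiple of
  \<open>s powr (-\<rho>)\<close>; this puts bounded functions into that class.\<close>

lemma bound_by_powr_minus:
  fixes \<rho> s t :: real
  assumes "0 < s" "s \<le> t" "0 \<le> \<rho>" "0 \<le> B" "x \<le> B"
  shows "x \<le> B * t powr \<rho> * s powr - \<rho>"
proof -
  have "1 \<le> t powr \<rho> * s powr - \<rho>"
    using powr_mono2[of \<rho> s t] assms by (simp add: powr_minus field_simps)
  from mult_left_mono[OF this assms(4)] assms(5) show ?thesis by (simp add: mult.assoc)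
qed

text \<open>The bridge between the two integrals: antiderivatives and Beta integrals yield gauge
  integrals, while Fubini and termwise integration need Lebesgue integrability, which nonnegativity
  provides.\<close>

lemma set_integrable_lborel_nonneg:
  fixes f :: "real \<Rightarrow> real"
  assumes "f integrable_on S" "\<And>x. x \<in> S \<Longrightarrow> 0 \<le> f x" "f \<in> borel_measurable borel" "S \<in> sets borel"
  shows "set_integrable lborel S f"
proof -
  have "f absolutely_integrable_on S" by (rule nonnegative_absolutely_integrable_1) (use assms in auto)
  then show ?thesis
    using assms(3,4) unfolding set_integrable_def by (subst (asm) integrable_completion) auto
qed

lemma has_integral_fractional_power:
  fixes \<beta> \<nu> t :: real
  assumes "0 < \<beta>" "0 < \<nu>" "0 < t"
  shows "((\<lambda>s. (t - s) powr (\<beta> - 1) * s powr (\<nu> - 1)) has_integral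
    Gamma \<beta> * Gamma \<nu> / Gamma (\<nu> + \<beta>) * t powr (\<nu> + \<beta> - 1)) {0..t}"
proof -
  have "((\<lambda>x. (x / t) powr (\<nu> - 1) * (1 - x / t) powr (\<beta> - 1)) has_integral t * Beta \<nu> \<beta>) {0..t}"
    using has_integral_affinity'[of "\<lambda>t. t powr (\<nu> - 1) * (1 - t) powr (\<beta> - 1)" "Beta \<nu> \<beta>" 0 1 "1 / t" 0]
      has_integral_Beta_real[OF assms(2,1)] assms(3) by (simp add: mult.commute)
  then have I: "((\<lambda>x. t powr (\<nu> + \<beta> - 2) * ((x / t) powr (\<nu> - 1) * (1 - x / t) powr (\<beta> - 1))) has_integral
      t powr (\<nu> + \<beta> - 2) * (t * Beta \<nu> \<beta>)) {0..t}"
    by (rule has_integral_mult_right)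
  have eq: "t powr (\<nu> + \<beta> - 2) * ((x / t) powr (\<nu> - 1) * (1 - x / t) powr (\<beta> - 1)) =
      (t - x) powr (\<beta> - 1) * x powr (\<nu> - 1)" if "x \<in> {0..t}" for x
  proof -
    have "1 - x / t = (t - x) / t" using assms(3) by (simp add: field_simps)
    moreover have "t powr (\<nu> + \<beta> - 2) = t powr (\<nu> - 1) * t powr (\<beta> - 1)" by (simp flip: powr_add)
    ultimately show ?thesis using that assms(3) by (simp add: powr_divide)
  qed
  have rhs: "t powr (\<nu> + \<beta> - 2) * (t * Beta \<nu> \<beta>) =
      Gamma \<beta> * Gamma \<nu> / Gamma (\<nu> + \<beta>) * t powr (\<nu> + \<beta> - 1)"
    using assms(3) by (simp add: Beta_def powr_diff field_simps power2_eq_square)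
  show ?thesis using has_integral_eq[OF eq I] unfolding rhs .
qed

text \<open>Log-convexity of Gamma at the point \<open>y\<close>, which lies between
  \<open>y - 1\<close> and \<open>y + \<rho>\<close> with weights
  \<open>\<rho> / (1 + \<rho>)\<close> and \<open>1 / (1 + \<rho>)\<close>;
  \<open>Gamma (y - 1)\<close> is then rewritten as \<open>Gamma y / (y - 1)\<close>. The resulting
  growth of Gamma is the input of the ratio test for Mittag-Leffler series.\<close>

lemma Gamma_shift_ge:
  fixes \<rho> y :: real
  assumes "0 < \<rho>" "1 < y"
  shows "(y - 1) powr \<rho> * Gamma y \<le> Gamma (y + \<rho>)"
proof -
  define u where "u = 1 / (1 + \<rho>)"
  have u: "0 < u" "u < 1" "u * (1 + \<rho>) = 1" using assms by (auto simp: u_def)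
  have pos: "Gamma (y - 1) > 0" "Gamma y > 0" "Gamma (y + \<rho>) > 0"
    using assms by (auto intro!: Gamma_real_pos)
  have "(1 - u) * (y - 1) + u * (y + \<rho>) = y - 1 + u * (1 + \<rho>)" by (simp add: algebra_simps)
  then have comb: "(1 - u) * (y - 1) + u * (y + \<rho>) = y" using u(3) by simp
  have "(ln \<circ> Gamma) ((1 - u) *\<^sub>R (y - 1) + u *\<^sub>R (y + \<rho>)) \<le>
      (1 - u) * (ln \<circ> Gamma) (y - 1) + u * (ln \<circ> Gamma) (y + \<rho>)"
    by (rule convex_onD[OF log_convex_Gamma_real]) (use assms u in auto)
  then have "(1 + \<rho>) * ln (Gamma y) \<le> (1 + \<rho>) * ((1 - u) * ln (Gamma (y - 1)) + u * ln (Gamma (y + \<rho>)))"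
    using assms comb by (intro mult_left_mono) auto
  also have "\<dots> = ((1 + \<rho>) - u * (1 + \<rho>)) * ln (Gamma (y - 1)) + (u * (1 + \<rho>)) * ln (Gamma (y + \<rho>))"
    by (simp add: algebra_simps)
  also have "\<dots> = \<rho> * ln (Gamma (y - 1)) + ln (Gamma (y + \<rho>))"
    by (simp only: u(3)) simp
  also have "Gamma (y - 1) = Gamma y / (y - 1)"
  proof -
    have "y - 1 \<notin> \<int>\<^sub>\<le>\<^sub>0" using assms by (auto dest: nonpos_Ints_nonpos)
    from Gamma_plus1[OF this] show ?thesis using assms by simp
  qed
  also have "ln (Gamma y / (y - 1)) = ln (Gamma y) - ln (y - 1)"
    by (rule ln_divide_pos) (use pos(2) assms in simp_all)
  finally have "\<rho> * ln (y - 1) + ln (Gamma y) \<le> ln (Gamma (y + \<rho>))" by (simp add: algebra_simps)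
  moreover have "ln ((y - 1) powr \<rho> * Gamma y) = \<rho> * ln (y - 1) + ln (Gamma y)"
    using assms(2) by (subst ln_mult_pos[OF _ pos(2)]) (auto simp: ln_powr)
  moreover have "0 < (y - 1) powr \<rho> * Gamma y" using pos(2) assms by simp
  ultimately show ?thesis using pos(3) by (metis ln_le_cancel_iff)
qed

lemma summable_mittag_leffler:
  fixes \<rho> \<mu> x :: real
  assumes \<rho>: "0 < \<rho>" and \<mu>: "0 < \<mu>"
  shows "summable (\<lambda>n. x ^ n / Gamma (\<rho> * real n + \<mu>))"
proof -
  have "\<forall>\<^sub>F y in at_top. 2 * \<bar>x\<bar> \<le> (y - 1) powr \<rho>"
    using \<rho> by real_asymp
  then obtain Y where Y: "\<And>y. y \<ge> Y \<Longrightarrow> 2 * \<bar>x\<bar> \<le> (y - 1) powr \<rho>"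
    by (auto simp: eventually_at_top_linorder)
  obtain N where N: "max Y 2 / \<rho> \<le> real N" using real_arch_simple by blast
  show ?thesis
  proof (rule summable_ratio_test[of "1/2" N])
    fix n assume "n \<ge> N"
    define y where "y = \<rho> * real n + \<mu>"
    have "max Y 2 / \<rho> \<le> real n" using N \<open>n \<ge> N\<close> by linarith
    then have "max Y 2 \<le> \<rho> * real n" using \<rho> by (simp add: pos_divide_le_eq mult.commute)
    then have y: "y \<ge> Y" "y > 1" using \<mu> by (auto simp: y_def)
    have pos: "Gamma y > 0" "Gamma (y + \<rho>) > 0" using y \<rho> by (auto intro!: Gamma_real_pos)
    have "2 * \<bar>x\<bar> * Gamma y \<le> (y - 1) powr \<rho> * Gamma y"
      using Y[OF y(1)] pos by (intro mult_right_mono) auto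
    also have "\<dots> \<le> Gamma (y + \<rho>)" using Gamma_shift_ge[OF \<rho> y(2)] .
    finally have "\<bar>x\<bar> / Gamma (y + \<rho>) \<le> 1 / 2 * (1 / Gamma y)"
      using pos by (simp add: field_simps)
    from mult_left_mono[OF this, of "\<bar>x\<bar> ^ n"]
    have "\<bar>x\<bar> ^ n * \<bar>x\<bar> / Gamma (y + \<rho>) \<le> 1 / 2 * (\<bar>x\<bar> ^ n / Gamma y)" by simp
    moreover have "\<rho> * real (Suc n) + \<mu> = y + \<rho>" by (simp add: y_def algebra_simps)
    ultimately show "norm (x ^ Suc n / Gamma (\<rho> * real (Suc n) + \<mu>)) \<le> 1 / 2 * norm (x ^ n / Gamma (\<rho> * real n + \<mu>))"
      using pos unfolding y_def[symmetric] by (simp add: abs_mult power_abs mult.commute)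
  qed simp
qed

definition fractional_series :: "real \<Rightarrow> (nat \<Rightarrow> real) \<Rightarrow> real \<Rightarrow> real \<Rightarrow> real" where
  "fractional_series \<rho> a \<mu> t = (\<Sum>n. a n * (t powr (\<rho> * real n + \<mu> - 1) / Gamma (\<rho> * real n + \<mu>)))"

lemma summable_fractional_series:
  assumes \<rho>: "0 < \<rho>" and \<mu>: "0 < \<mu>" and a: "\<And>n. \<bar>a n\<bar> \<le> R ^ n" and t: "0 \<le> t"
  shows "summable (\<lambda>n. \<bar>a n * (t powr (\<rho> * real n + \<mu> - 1) / Gamma (\<rho> * real n + \<mu>))\<bar>)"
proof (cases "t = 0")
  case False
  have "summable (\<lambda>n. t powr (\<mu> - 1) * ((R * t powr \<rho>) ^ n / Gamma (\<rho> * real n + \<mu>)))"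
    using \<rho> \<mu> by (intro summable_mult summable_mittag_leffler)
  then show ?thesis
  proof (rule summable_comparison_test'[where N = 0])
    fix n
    have G: "Gamma (\<rho> * real n + \<mu>) > 0" using \<rho> \<mu> by (intro Gamma_real_pos add_nonneg_pos) auto
    have "t powr (\<rho> * real n + \<mu> - 1) = t powr (\<mu> - 1) * (t powr \<rho>) ^ n"
      using False t by (simp add: powr_power flip: powr_add) (simp add: algebra_simps)
    moreover have "\<bar>a n\<bar> * (t powr (\<mu> - 1) * (t powr \<rho>) ^ n / Gamma (\<rho> * real n + \<mu>)) \<le>
        R ^ n * (t powr (\<mu> - 1) * (t powr \<rho>) ^ n / Gamma (\<rho> * real n + \<mu>))"
      using a[of n] G by (intro mult_right_mono) auto
    ultimately show "norm \<bar>a n * (t powr (\<rho> * real n + \<mu> - 1) / Gamma (\<rho> * real n + \<mu>))\<bar> \<le>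
        t powr (\<mu> - 1) * ((R * t powr \<rho>) ^ n / Gamma (\<rho> * real n + \<mu>))"
      using G by (simp add: abs_mult power_mult_distrib algebra_simps)
  qed
qed auto

lemma fractional_series_measurable [measurable]: "fractional_series \<rho> a \<mu> \<in> borel_measurable borel"
  unfolding fractional_series_def[abs_def] by measurable

lemma fractional_integral_series:
  assumes \<rho>: "0 < \<rho>" and \<mu>: "0 < \<mu>" and \<beta>: "0 < \<beta>" and a: "\<And>n. \<bar>a n\<bar> \<le> R ^ n" and t: "0 < t"
  shows "set_integrable lborel {0..t} (\<lambda>s. (t - s) powr (\<beta> - 1) * fractional_series \<rho> a \<mu> s)"
    and "((\<lambda>s. (t - s) powr (\<beta> - 1) * fractional_series \<rho> a \<mu> s) has_integral
      Gamma \<beta> * fractional_series \<rho> a (\<mu> + \<beta>) t) {0..t}"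
proof -
  define c where "c n = a n / Gamma (\<rho> * real n + \<mu>)" for n
  define k where "k n s = (t - s) powr (\<beta> - 1) * s powr (\<rho> * real n + \<mu> - 1)" for n s
  define f where "f n s = indicat_real {0..t} s * (c n * k n s)" for n s
  have \<mu>n: "0 < \<rho> * real n + \<mu>" for n using \<rho> \<mu> by (intro add_nonneg_pos) auto
  have G: "Gamma (\<rho> * real n + \<mu>) > 0" for n by (rule Gamma_real_pos[OF \<mu>n])
  define I where "I n = Gamma \<beta> * Gamma (\<rho> * real n + \<mu>) / Gamma (\<rho> * real n + \<mu> + \<beta>) * t powr (\<rho> * real n + \<mu> + \<beta> - 1)" for n
  have kI: "(k n has_integral I n) {0..t}" for n
    using has_integral_fractional_power[OF \<beta> \<mu>n t] unfolding k_def I_def .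
  have k_int: "set_integrable lborel {0..t} (k n)" for n
    by (rule set_integrable_lborel_nonneg) (use kI in \<open>auto simp: k_def[abs_def]\<close>)
  have k_eq: "(\<integral>s. indicator {0..t} s * k n s \<partial>lborel) = I n" for n
    using set_borel_integral_eq_integral(2)[OF k_int] integral_unique[OF kI]
    by (simp add: set_lebesgue_integral_def)
  have f_int: "integrable lborel (f n)" for n
  proof -
    have "f n = (\<lambda>s. c n * (indicator {0..t} s * k n s))" by (simp add: f_def fun_eq_iff)
    then show ?thesis using k_int[of n] by (simp add: set_integrable_def)
  qed
  have f_eq: "(\<integral>s. f n s \<partial>lborel) = c n * I n" for n
    using k_eq[of n] by (simp add: f_def mult.left_commute[of _ "c n"])
  have "norm (f n s) = \<bar>c n\<bar> * (indicator {0..t} s * k n s)" for n s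
    by (simp add: f_def k_def abs_mult)
  then have f_norm: "(\<integral>s. norm (f n s) \<partial>lborel) = \<bar>c n\<bar> * I n" for n
    using k_eq[of n] by simp
  have cI: "c n * I n = Gamma \<beta> * (a n * (t powr (\<rho> * real n + (\<mu> + \<beta>) - 1) / Gamma (\<rho> * real n + (\<mu> + \<beta>))))" for n
    using G[of n] by (simp add: c_def I_def add.assoc)
  have I0: "I n \<ge> 0" for n by (rule has_integral_nonneg[OF kI]) (simp add: k_def)
  \<comment> \<open>After integration the terms are those of the series with index
    \<open>\<mu> + \<beta>\<close>, so the L1 norms are summable even where the integrands are
    singular at 0.\<close>
  have sum1: "summable (\<lambda>n. \<integral>s. norm (f n s) \<partial>lborel)"
  proof -
    have "summable (\<lambda>n. Gamma \<beta> * \<bar>a n * (t powr (\<rho> * real n + (\<mu> + \<beta>) - 1) / Gamma (\<rho> * real n + (\<mu> + \<beta>)))\<bar>)"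
      using \<rho> \<mu> \<beta> a t by (intro summable_mult summable_fractional_series[where R = R]) auto
    also have "(\<lambda>n. Gamma \<beta> * \<bar>a n * (t powr (\<rho> * real n + (\<mu> + \<beta>) - 1) / Gamma (\<rho> * real n + (\<mu> + \<beta>)))\<bar>) = (\<lambda>n. \<bar>c n * I n\<bar>)"
      using Gamma_real_pos[OF \<beta>] by (simp add: cI abs_mult)
    also have "\<dots> = (\<lambda>n. \<integral>s. norm (f n s) \<partial>lborel)"
      by (simp only: f_norm abs_mult abs_of_nonneg[OF I0])
    finally show ?thesis .
  qed
  have f_series: "f n s = indicator {0..t} s * (t - s) powr (\<beta> - 1) *
      (a n * (s powr (\<rho> * real n + \<mu> - 1) / Gamma (\<rho> * real n + \<mu>)))" for n s
    by (simp add: f_def k_def c_def)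
  have sum2: "summable (\<lambda>n. norm (f n s))" for s
  proof (cases "s \<in> {0..t}")
    case True
    then have "summable (\<lambda>n. (t - s) powr (\<beta> - 1) * \<bar>a n * (s powr (\<rho> * real n + \<mu> - 1) / Gamma (\<rho> * real n + \<mu>))\<bar>)"
      using \<rho> \<mu> a by (intro summable_mult summable_fractional_series[where R = R]) auto
    then show ?thesis using True by (simp add: f_series abs_mult)
  qed (simp add: f_series)
  have f_sum: "(\<Sum>n. f n s) = indicator {0..t} s * ((t - s) powr (\<beta> - 1) * fractional_series \<rho> a \<mu> s)" for s
  proof (cases "s \<in> {0..t}")
    case True
    then have "summable (\<lambda>n. a n * (s powr (\<rho> * real n + \<mu> - 1) / Gamma (\<rho> * real n + \<mu>)))"
      using \<rho> \<mu> a by (intro summable_rabs_cancel[OF summable_fractional_series[where R = R]]) auto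
    from suminf_mult[OF this, of "indicator {0..t} s * (t - s) powr (\<beta> - 1)"]
    show ?thesis unfolding f_series fractional_series_def by (simp only: mult.assoc)
  qed (simp add: f_series)
  have "integrable lborel (\<lambda>s. \<Sum>n. f n s)"
    by (rule integrable_suminf[OF f_int AE_I2[OF sum2] sum1])
  then show int: "set_integrable lborel {0..t} (\<lambda>s. (t - s) powr (\<beta> - 1) * fractional_series \<rho> a \<mu> s)"
    by (simp add: f_sum set_integrable_def)
  have "(\<integral>s. (\<Sum>n. f n s) \<partial>lborel) = (\<Sum>n. \<integral>s. f n s \<partial>lborel)"
    by (rule integral_suminf[OF f_int AE_I2[OF sum2] sum1])
  also have "\<dots> = (\<Sum>n. Gamma \<beta> * (a n * (t powr (\<rho> * real n + (\<mu> + \<beta>) - 1) / Gamma (\<rho> * real n + (\<mu> + \<beta>)))))"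
    by (simp only: f_eq cI)
  also have "\<dots> = Gamma \<beta> * fractional_series \<rho> a (\<mu> + \<beta>) t"
    unfolding fractional_series_def using \<rho> \<mu> \<beta> a t
    by (intro suminf_mult summable_rabs_cancel[OF summable_fractional_series[where R = R]]) auto
  finally have "integral {0..t} (\<lambda>s. (t - s) powr (\<beta> - 1) * fractional_series \<rho> a \<mu> s) =
      Gamma \<beta> * fractional_series \<rho> a (\<mu> + \<beta>) t"
    using set_borel_integral_eq_integral(2)[OF int] by (simp add: f_sum set_lebesgue_integral_def)
  then show "((\<lambda>s. (t - s) powr (\<beta> - 1) * fractional_series \<rho> a \<mu> s) has_integral
      Gamma \<beta> * fractional_series \<rho> a (\<mu> + \<beta>) t) {0..t}"
    using set_borel_integral_eq_integral(1)[OF int] by (simp add: has_integral_iff)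
qed

lemma fractional_series_mittag_leffler:
  assumes "0 < t" "0 < \<rho>" "0 < \<mu>"
  shows "fractional_series \<rho> (\<lambda>n. (- l) ^ n) \<mu> t = t powr (\<mu> - 1) * mittag_leffler \<rho> \<mu> (- l * t powr \<rho>)"
proof -
  have "(- l) ^ n * (t powr (\<rho> * real n + \<mu> - 1) / Gamma (\<rho> * real n + \<mu>)) =
      t powr (\<mu> - 1) * ((- l * t powr \<rho>) ^ n / Gamma (\<rho> * real n + \<mu>))" for n
  proof -
    have "t powr (\<rho> * real n + \<mu> - 1) = t powr (\<mu> - 1) * (t powr \<rho>) ^ n"
      using assms(1) by (simp add: powr_power flip: powr_add) (simp add: algebra_simps)
    then show ?thesis by (simp only: power_mult_distrib) simp
  qed
  then show ?thesis
    unfolding fractional_series_def mittag_leffler_def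
    by (simp only: suminf_mult[OF summable_mittag_leffler[OF assms(2,3)]])
qed

lemma mittag_leffler_0 [simp]: "mittag_leffler \<rho> \<mu> 0 = 1 / Gamma \<mu>"
  using powser_zero[of "\<lambda>n. 1 / Gamma (\<rho> * real n + \<mu>)"] by (simp add: mittag_leffler_def)

lemma continuous_on_mittag_leffler [continuous_intros]:
  assumes "0 < \<rho>" "0 < \<mu>" "continuous_on S g"
  shows "continuous_on S (\<lambda>x. mittag_leffler \<rho> \<mu> (g x))"
proof -
  have "isCont (mittag_leffler \<rho> \<mu>) z" for z
  proof -
    have "isCont (\<lambda>x. \<Sum>n. (1 / Gamma (\<rho> * real n + \<mu>)) * x ^ n) z"
      using summable_mittag_leffler[OF assms(1,2), of "\<bar>z\<bar> + 1"]
      by (intro isCont_powser[of _ "\<bar>z\<bar> + 1"]) auto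
    then show ?thesis by (simp add: mittag_leffler_def[abs_def])
  qed
  then have "continuous_on UNIV (mittag_leffler \<rho> \<mu>)" by (simp add: continuous_at_imp_continuous_on)
  from continuous_on_compose2[OF this assms(3)] show ?thesis by simp
qed

section \<open>The Caputo derivative inverts the fractional integral\<close>

lemma set_integrable_lborel_bound:
  fixes f g :: "real \<Rightarrow> real"
  assumes "set_integrable lborel S g" "\<And>x. x \<in> S \<Longrightarrow> \<bar>f x\<bar> \<le> g x" "f \<in> borel_measurable borel" "S \<in> sets borel"
  shows "set_integrable lborel S f"
  by (rule set_integrable_bound[OF assms(1)])
    (use assms in \<open>auto simp: set_borel_measurable_def intro!: AE_I2 order_trans[OF assms(2)]\<close>)

text \<open>Fubini over the triangle \<open>s \<le> \<xi> \<le> c\<close>. Since \<open>a\<close>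
  and \<open>b\<close> are nonnegative, the inner integral \<open>k\<close> also integrates the
  absolute value, and integrability of \<open>k * p\<close> is all that absolute integrability over
  the triangle requires.\<close>

lemma fubini_triangle:
  fixes a b p k :: "real \<Rightarrow> real"
  assumes [measurable]: "a \<in> borel_measurable borel" "b \<in> borel_measurable borel" "p \<in> borel_measurable borel"
    and nonneg: "\<And>x. 0 \<le> a x" "\<And>x. 0 \<le> b x"
    and k: "\<And>s. 0 \<le> s \<Longrightarrow> s < c \<Longrightarrow> ((\<lambda>\<xi>. a \<xi> * b (\<xi> - s)) has_integral k s) {s..c}"
    and kp: "set_integrable lborel {0..<c} (\<lambda>s. k s * p s)"
  shows "((\<lambda>\<xi>. a \<xi> * integral {0..\<xi>} (\<lambda>s. b (\<xi> - s) * p s)) has_integral (LBINT s:{0..<c}. k s * p s)) {0..c}"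
proof -
  define F where "F s \<xi> = (if 0 \<le> s \<and> s < c \<and> s \<le> \<xi> \<and> \<xi> \<le> c then a \<xi> * b (\<xi> - s) * p s else 0)" for s \<xi>
  have F_meas [measurable]: "case_prod F \<in> borel_measurable (lborel \<Otimes>\<^sub>M lborel)"
    unfolding F_def by measurable
  have sec: "F s = (\<lambda>\<xi>. p s * (indicator {s..c} \<xi> * (a \<xi> * b (\<xi> - s))))" if "0 \<le> s" "s < c" for s
    using that by (auto simp: F_def fun_eq_iff indicator_def)
  have sec0: "F s = (\<lambda>\<xi>. 0)" if "\<not> (0 \<le> s \<and> s < c)" for s
    using that by (auto simp: F_def fun_eq_iff)
  have ab: "set_integrable lborel {s..c} (\<lambda>\<xi>. a \<xi> * b (\<xi> - s))" if "0 \<le> s" "s < c" for s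
    by (rule set_integrable_lborel_nonneg) (use k[OF that] nonneg in auto)
  have ab_eq: "(\<integral>\<xi>. indicator {s..c} \<xi> * (a \<xi> * b (\<xi> - s)) \<partial>lborel) = k s" if "0 \<le> s" "s < c" for s
    using set_borel_integral_eq_integral(2)[OF ab[OF that]] integral_unique[OF k[OF that]]
    by (simp add: set_lebesgue_integral_def)
  have int_sec: "integrable lborel (F s)" for s
  proof (cases "0 \<le> s \<and> s < c")
    case True
    then show ?thesis using ab[of s] by (simp add: sec set_integrable_def)
  qed (simp add: sec0)
  have eq_sec: "(\<integral>\<xi>. F s \<xi> \<partial>lborel) = indicator {0..<c} s * (k s * p s)" for s
  proof (cases "0 \<le> s \<and> s < c")
    case True
    then show ?thesis using ab_eq[of s] by (simp add: sec)
  qed (auto simp: sec0)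
  have "norm (F s \<xi>) = \<bar>p s\<bar> * (indicator {s..c} \<xi> * (a \<xi> * b (\<xi> - s)))" if "0 \<le> s" "s < c" for s \<xi>
    using nonneg by (simp add: sec[OF that] abs_mult)
  then have norm_sec: "(\<integral>\<xi>. norm (F s \<xi>) \<partial>lborel) = norm (indicator {0..<c} s * (k s * p s))" for s
  proof (cases "0 \<le> s \<and> s < c")
    case True
    have "k s \<ge> 0" using k[of s] True nonneg by (auto intro: has_integral_nonneg)
    then show ?thesis
      using ab_eq[of s] True \<open>\<And>s \<xi>. 0 \<le> s \<Longrightarrow> s < c \<Longrightarrow> norm (F s \<xi>) = _ s \<xi>\<close> by (simp add: abs_mult)
  qed (auto simp: sec0)
  have "integrable (lborel \<Otimes>\<^sub>M lborel) (case_prod F)"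
  proof (rule lborel_pair.Fubini_integrable)
    show "integrable lborel (\<lambda>s. \<integral>\<xi>. norm (case_prod F (s, \<xi>)) \<partial>lborel)"
      using integrable_norm[OF kp[unfolded set_integrable_def]] by (simp add: norm_sec[unfolded real_norm_def])
  qed (use int_sec in auto)
  then have "(\<integral>\<xi>. (\<integral>s. F s \<xi> \<partial>lborel) \<partial>lborel) = (LBINT s:{0..<c}. k s * p s)"
    and int: "integrable lborel (\<lambda>\<xi>. \<integral>s. F s \<xi> \<partial>lborel)"
    and ae: "AE \<xi> in lborel. integrable lborel (\<lambda>s. F s \<xi>)"
    using lborel_pair.Fubini_integral[of F] lborel_pair.integrable_snd[of F] lborel_pair.AE_integrable_snd[of F]
    by (simp_all add: eq_sec set_lebesgue_integral_def)
  then have "((\<lambda>\<xi>. \<integral>s. F s \<xi> \<partial>lborel) has_integral (LBINT s:{0..<c}. k s * p s)) UNIV"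
    using has_integral_integral_lborel[OF int] by simp
  note G = this
  have eq: "(\<lambda>\<xi>. \<integral>s. F s \<xi> \<partial>lborel) = (\<lambda>\<xi>. if \<xi> \<in> {0..c} then \<integral>s. F s \<xi> \<partial>lborel else 0)"
  proof
    fix \<xi>
    show "(\<integral>s. F s \<xi> \<partial>lborel) = (if \<xi> \<in> {0..c} then \<integral>s. F s \<xi> \<partial>lborel else 0)"
    proof (cases "\<xi> \<in> {0..c}")
      case False
      then have "(\<lambda>s. F s \<xi>) = (\<lambda>s. 0)" by (auto simp: F_def fun_eq_iff)
      then show ?thesis using False by simp
    qed simp
  qed
  have "((\<lambda>\<xi>. \<integral>s. F s \<xi> \<partial>lborel) has_integral (LBINT s:{0..<c}. k s * p s)) {0..c}"
    using G by (subst (asm) eq) (rule has_integral_restrict_UNIV[THEN iffD1])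
  \<comment> \<open>The point \<open>c\<close> is set aside because the support of \<open>F\<close>
    leaves out \<open>s = c\<close>.\<close>
  moreover have "AE \<xi> in lborel. \<xi> \<in> {0..c} \<longrightarrow>
      (\<integral>s. F s \<xi> \<partial>lborel) = a \<xi> * integral {0..\<xi>} (\<lambda>s. b (\<xi> - s) * p s)"
    using ae AE_lborel_singleton[of c]
  proof eventually_elim
    case (elim \<xi>)
    show ?case
    proof
      assume "\<xi> \<in> {0..c}"
      then have Fe: "(\<lambda>s. F s \<xi>) = (\<lambda>s. a \<xi> * (indicator {0..\<xi>} s * (b (\<xi> - s) * p s)))"
        using elim by (auto simp: F_def fun_eq_iff indicator_def)
      show "(\<integral>s. F s \<xi> \<partial>lborel) = a \<xi> * integral {0..\<xi>} (\<lambda>s. b (\<xi> - s) * p s)"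
      \<comment> \<open>Integrability of the section passes to the inner integrand only after
        division by \<open>a \<xi>\<close>; for \<open>a \<xi> = 0\<close> both sides
        vanish.\<close>
      proof (cases "a \<xi> = 0")
        case False
        then have "set_integrable lborel {0..\<xi>} (\<lambda>s. b (\<xi> - s) * p s)"
          using elim(1) unfolding Fe by (simp add: set_integrable_def)
        from set_borel_integral_eq_integral(2)[OF this] show ?thesis
          unfolding Fe by (simp add: set_lebesgue_integral_def)
      qed (simp add: Fe)
    qed
  qed
  ultimately show ?thesis by (subst (asm) has_integral_AE) auto
qed

section \<open>The Abel kernel and its integrals\<close>

lemma set_integrable_powr_singular:
  fixes \<rho> \<tau> :: real
  assumes "0 < \<rho>" "\<rho> < 1" "0 < \<tau>"
  shows "set_integrable lborel {0..\<tau>} (\<lambda>s. C * ((\<tau> - s) powr (\<rho> - 1) * s powr (-\<rho>)))"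
    "set_integrable lborel {0..\<tau>} (\<lambda>s. C * s powr (-\<rho>))"
proof -
  have "(\<lambda>s. (\<tau> - s) powr (\<rho> - 1) * s powr (-\<rho>)) integrable_on {0..\<tau>}"
    using has_integral_fractional_power[of \<rho> "1 - \<rho>" \<tau>] assms by (auto intro: has_integral_integrable)
  then have "set_integrable lborel {0..\<tau>} (\<lambda>s. (\<tau> - s) powr (\<rho> - 1) * s powr (-\<rho>))"
    by (intro set_integrable_lborel_nonneg) auto
  then show "set_integrable lborel {0..\<tau>} (\<lambda>s. C * ((\<tau> - s) powr (\<rho> - 1) * s powr (-\<rho>)))"
    by (rule set_integrable_mult_right)
  have "(\<lambda>s. s powr (-\<rho>)) integrable_on {0..\<tau>}"
    using assms by (intro integrable_on_powr_from_0) auto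
  then have "set_integrable lborel {0..\<tau>} (\<lambda>s. s powr (-\<rho>))"
    by (intro set_integrable_lborel_nonneg) auto
  then show "set_integrable lborel {0..\<tau>} (\<lambda>s. C * s powr (-\<rho>))"
    by (rule set_integrable_mult_right)
qed

text \<open>The quotient \<open>(\<xi> - s) / (t - \<xi>)\<close> has derivative
  \<open>(t - s) / (t - \<xi>)\<^sup>2\<close>, so its power \<open>\<rho>\<close> is an
  antiderivative up to the factor \<open>\<rho> * (t - s)\<close>. This is the inner integral when
  the truncated Caputo integral meets a fractional integral.\<close>

lemma abel_kernel_has_integral:
  fixes \<rho> t c s :: real
  assumes "0 < \<rho>" "s < c" "c < t"
  shows "((\<lambda>\<xi>. \<rho> * (t - \<xi>) powr (-\<rho> - 1) * (\<xi> - s) powr (\<rho> - 1)) has_integral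
    ((c - s) / (t - c)) powr \<rho> / (t - s)) {s..c}"
proof -
  define F where "F \<xi> = ((\<xi> - s) / (t - \<xi>)) powr \<rho> / (t - s)" for \<xi>
  have "((\<lambda>\<xi>. \<rho> * (t - \<xi>) powr (-\<rho> - 1) * (\<xi> - s) powr (\<rho> - 1)) has_integral F c - F s) {s..c}"
  proof (rule fundamental_theorem_of_calculus_interior)
    show "continuous_on {s..c} F"
      unfolding F_def using assms by (intro continuous_intros continuous_on_powr') auto
    fix x assume x: "x \<in> {s<..<c}"
    have "(F has_real_derivative (\<rho> * ((x - s) / (t - x)) powr (\<rho> - 1) * ((1 * (t - x) - (x - s) * (0 - 1)) / (t - x)\<^sup>2)) / (t - s)) (at x)"
      unfolding F_def using x assms
      by (auto intro!: derivative_eq_intros simp: power2_eq_square)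
    also have "(1 * (t - x) - (x - s) * (0 - 1)) = t - s" by simp
    also have "(\<rho> * ((x - s) / (t - x)) powr (\<rho> - 1) * ((t - s) / (t - x)\<^sup>2)) / (t - s) =
        \<rho> * (((x - s) powr (\<rho> - 1) / (t - x) powr (\<rho> - 1)) / (t - x) powr 2)"
      using x assms by (simp add: powr_divide)
    also have "\<dots> = \<rho> * (t - x) powr (-\<rho> - 1) * (x - s) powr (\<rho> - 1)"
    proof -
      have "(t - x) powr (-\<rho> - 1) = 1 / ((t - x) powr (\<rho> - 1) * (t - x) powr 2)"
      proof -
        have "- \<rho> - 1 = - ((\<rho> - 1) + 2)" by simp
        then show ?thesis by (simp only: powr_minus_divide powr_add)
      qed
      then show ?thesis by simp
    qed
    finally show "(F has_vector_derivative \<rho> * (t - x) powr (-\<rho> - 1) * (x - s) powr (\<rho> - 1)) (at x)"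
      by (simp add: has_real_derivative_iff_has_vector_derivative)
  qed (use assms in simp)
  then show ?thesis by (simp add: F_def)
qed

text \<open>What remains of the truncated Caputo integral after Fubini, namely the difference of
  \<open>(t - c) powr (-\<rho>) * (c - s) powr (\<rho> - 1)\<close> and
  \<open>((c - s) / (t - c)) powr \<rho> / (t - s)\<close>. As \<open>c\<close> tends to
  \<open>t\<close> it is an approximate identity at \<open>t\<close> with mass
  \<open>Gamma \<rho> * Gamma (1 - \<rho>)\<close>.\<close>

definition abel_kernel :: "real \<Rightarrow> real \<Rightarrow> real \<Rightarrow> real \<Rightarrow> real" where
  "abel_kernel \<rho> t c s = (t - c) powr (1 - \<rho>) * (c - s) powr (\<rho> - 1) / (t - s)"

lemma abel_kernel_nonneg: "s \<le> c \<Longrightarrow> c < t \<Longrightarrow> 0 \<le> abel_kernel \<rho> t c s"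
  by (simp add: abel_kernel_def)

lemma abel_kernel_measurable [measurable]: "abel_kernel \<rho> t c \<in> borel_measurable borel"
  unfolding abel_kernel_def[abs_def] by measurable

lemma abel_kernel_set_integrable:
  fixes p :: "real \<Rightarrow> real"
  assumes \<rho>: "0 < \<rho>" "\<rho> < 1" and c: "0 < c" "c < t"
    and p: "p \<in> borel_measurable borel" "\<And>s. 0 < s \<Longrightarrow> s \<le> c \<Longrightarrow> \<bar>p s\<bar> \<le> C * s powr (-\<rho>)" "p 0 = 0"
  shows "set_integrable lborel {0..c} (\<lambda>s. abel_kernel \<rho> t c s * p s)"
proof (rule set_integrable_lborel_bound[OF set_integrable_powr_singular(1)[OF \<rho> c(1)]])
  fix s assume s: "s \<in> {0..c}"
  show "\<bar>abel_kernel \<rho> t c s * p s\<bar> \<le> (t - c) powr (1 - \<rho>) / (t - c) * C * ((c - s) powr (\<rho> - 1) * s powr (-\<rho>))"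
  proof (cases "s = 0")
    case False
    have "abel_kernel \<rho> t c s \<le> (t - c) powr (1 - \<rho>) * (c - s) powr (\<rho> - 1) / (t - c)"
      unfolding abel_kernel_def using s c by (intro divide_left_mono) auto
    then have "\<bar>abel_kernel \<rho> t c s * p s\<bar> \<le>
        (t - c) powr (1 - \<rho>) * (c - s) powr (\<rho> - 1) / (t - c) * (C * s powr (-\<rho>))"
      unfolding abs_mult using p(2)[of s] s c False abel_kernel_nonneg[of s c t \<rho>] by (intro mult_mono) auto
    then show ?thesis by (simp add: mult_ac)
  qed (simp add: p(3))
qed (use p(1) in measurable)

lemma abel_integral_set_integrable:
  fixes p :: "real \<Rightarrow> real"
  assumes \<rho>: "0 < \<rho>" "\<rho> < 1" and c: "0 < c"
    and p: "p \<in> borel_measurable borel" "\<And>s. 0 < s \<Longrightarrow> s \<le> c \<Longrightarrow> \<bar>p s\<bar> \<le> C * s powr (-\<rho>)" "p 0 = 0"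
  shows "set_integrable lborel {0..c} (\<lambda>s. (c - s) powr (\<rho> - 1) * p s)"
proof (rule set_integrable_lborel_bound[OF set_integrable_powr_singular(1)[OF \<rho> c]])
  fix s assume s: "s \<in> {0..c}"
  show "\<bar>(c - s) powr (\<rho> - 1) * p s\<bar> \<le> C * ((c - s) powr (\<rho> - 1) * s powr (-\<rho>))"
    using p(2)[of s] p(3) s mult_left_mono[of "\<bar>p s\<bar>" "C * s powr (-\<rho>)" "(c - s) powr (\<rho> - 1)"]
    by (cases "s = 0") (auto simp: abs_mult mult_ac)
qed (use p(1) in measurable)

text \<open>By Fubini, the truncated Caputo integral of a fractional integral of \<open>p\<close> averages \<open>p\<close> against an
  approximate identity at \<open>t\<close>.\<close>

lemma caputo_parts_fractional_integral:
  fixes p q :: "real \<Rightarrow> real"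
  assumes \<rho>: "0 < \<rho>" "\<rho> < 1" and c: "0 < c" "c < t"
    and p: "p \<in> borel_measurable borel" "\<And>s. 0 < s \<Longrightarrow> s \<le> t \<Longrightarrow> \<bar>p s\<bar> \<le> C * s powr (-\<rho>)" "p 0 = 0"
    and q: "\<And>\<tau>. 0 \<le> \<tau> \<Longrightarrow> \<tau> \<le> t \<Longrightarrow> Gamma \<rho> * (q \<tau> - q 0) = integral {0..\<tau>} (\<lambda>s. (\<tau> - s) powr (\<rho> - 1) * p s)"
  shows "Gamma \<rho> * caputo_parts \<rho> q t c = integral {0..c} (\<lambda>s. abel_kernel \<rho> t c s * p s)"
proof -
  define k where "k s = ((c - s) / (t - c)) powr \<rho> / (t - s)" for s
  have "0 \<le> C * c powr (-\<rho>)" using p(2)[of c] c by linarith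
  then have C: "C \<ge> 0" using c by (simp add: zero_le_mult_iff)
  have k_bound: "0 \<le> k s" "k s \<le> (c / (t - c)) powr \<rho> / (t - c)" if "0 \<le> s" "s \<le> c" for s
    unfolding k_def using that c \<rho> by (auto intro!: frac_le powr_mono2 divide_right_mono)
  have kp: "set_integrable lborel {0..c} (\<lambda>s. k s * p s)"
  proof (rule set_integrable_lborel_bound[OF set_integrable_powr_singular(2)[OF \<rho> c(1)]])
    fix s assume s: "s \<in> {0..c}"
    show "\<bar>k s * p s\<bar> \<le> (c / (t - c)) powr \<rho> / (t - c) * C * s powr (-\<rho>)"
    proof (cases "s = 0")
      case False
      then show ?thesis unfolding abs_mult mult.assoc
        using k_bound[of s] p(2)[of s] s c by (intro mult_mono) auto
    qed (simp add: p(3))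
  qed (use p(1) in \<open>auto simp: k_def[abs_def]\<close>)
  have kp': "set_integrable lborel {0..<c} (\<lambda>s. k s * p s)"
    by (rule set_integrable_subset[OF kp]) auto
  have fub: "((\<lambda>\<xi>. (if \<xi> < t then \<rho> * (t - \<xi>) powr (-\<rho> - 1) else 0) * integral {0..\<xi>} (\<lambda>s. (\<xi> - s) powr (\<rho> - 1) * p s))
      has_integral (LBINT s:{0..<c}. k s * p s)) {0..c}"
  proof (rule fubini_triangle)
    fix s assume s: "0 \<le> s" "s < c"
    show "((\<lambda>\<xi>. (if \<xi> < t then \<rho> * (t - \<xi>) powr (-\<rho> - 1) else 0) * (\<xi> - s) powr (\<rho> - 1)) has_integral k s) {s..c}"
      by (rule has_integral_eq[OF _ abel_kernel_has_integral[OF \<rho>(1) s(2) c(2), folded k_def]]) (use c in auto)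
  qed (use \<rho> p(1) kp' in auto)
  have "(LBINT s:{0..<c}. k s * p s) = integral {0..c} (\<lambda>s. k s * p s)"
  proof -
    have "indicator {0..<c} s * (k s * p s) = indicator {0..c} s * (k s * p s)" for s
      by (auto simp: indicator_def k_def)
    then show ?thesis
      using set_borel_integral_eq_integral(2)[OF kp]
      by (simp only: set_lebesgue_integral_def real_scaleR_def)
  qed
  note fub = fub[unfolded this]
  have conv: "((\<lambda>\<xi>. \<rho> * (t - \<xi>) powr (-\<rho> - 1) * integral {0..\<xi>} (\<lambda>s. (\<xi> - s) powr (\<rho> - 1) * p s))
      has_integral integral {0..c} (\<lambda>s. k s * p s)) {0..c}"
    by (rule has_integral_eq[OF _ fub]) (use c in auto)
  have "((\<lambda>\<xi>. \<rho> * (t - \<xi>) powr (-\<rho> - 1)) has_integral ((t - c) powr (-\<rho>) - (t - 0) powr (-\<rho>))) {0..c}"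
    using c by (intro fundamental_theorem_of_calculus)
      (auto simp flip: has_real_derivative_iff_has_vector_derivative intro!: caputo_kernel_has_derivative)
  from has_integral_add[OF has_integral_mult_right[OF this, of "Gamma \<rho> * q 0"] conv, simplified diff_zero]
  have "((\<lambda>\<xi>. Gamma \<rho> * (\<rho> * (t - \<xi>) powr (-\<rho> - 1) * q \<xi>)) has_integral
      Gamma \<rho> * q 0 * ((t - c) powr (-\<rho>) - t powr (-\<rho>)) + integral {0..c} (\<lambda>s. k s * p s)) {0..c}"
  proof (rule has_integral_eq[rotated])
    fix \<xi> assume "\<xi> \<in> {0..c}"
    then have "integral {0..\<xi>} (\<lambda>s. (\<xi> - s) powr (\<rho> - 1) * p s) = Gamma \<rho> * (q \<xi> - q 0)"
      using c by (intro q[symmetric]) auto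
    then show "Gamma \<rho> * q 0 * (\<rho> * (t - \<xi>) powr (-\<rho> - 1)) + \<rho> * (t - \<xi>) powr (-\<rho> - 1) *
        integral {0..\<xi>} (\<lambda>s. (\<xi> - s) powr (\<rho> - 1) * p s) = Gamma \<rho> * (\<rho> * (t - \<xi>) powr (-\<rho> - 1) * q \<xi>)"
      by (simp only:) (simp add: algebra_simps)
  qed
  then have 1: "Gamma \<rho> * integral {0..c} (\<lambda>\<xi>. \<rho> * (t - \<xi>) powr (-\<rho> - 1) * q \<xi>) =
      Gamma \<rho> * q 0 * ((t - c) powr (-\<rho>) - t powr (-\<rho>)) + integral {0..c} (\<lambda>s. k s * p s)"
    by (simp add: integral_unique flip: integral_mult_right)
  have int1: "(\<lambda>s. (c - s) powr (\<rho> - 1) * p s) integrable_on {0..c}"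
    by (rule set_borel_integral_eq_integral(1)[OF abel_integral_set_integrable[where C = C, OF \<rho> c(1) p(1) _ p(3)]]) (use p(2) c in auto)
  have int2: "(\<lambda>s. k s * p s) integrable_on {0..c}"
    by (rule set_borel_integral_eq_integral(1)[OF kp])
  have "Gamma \<rho> * caputo_parts \<rho> q t c = (t - c) powr (-\<rho>) * (Gamma \<rho> * (q c - q 0)) +
      (Gamma \<rho> * q 0 * ((t - c) powr (-\<rho>) - t powr (-\<rho>)) -
       Gamma \<rho> * integral {0..c} (\<lambda>\<xi>. \<rho> * (t - \<xi>) powr (-\<rho> - 1) * q \<xi>))"
    by (simp add: caputo_parts_def algebra_simps)
  also have "\<dots> = (t - c) powr (-\<rho>) * integral {0..c} (\<lambda>s. (c - s) powr (\<rho> - 1) * p s)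
      - integral {0..c} (\<lambda>s. k s * p s)"
    using q[of c] c 1 by simp
  also have "\<dots> = integral {0..c} (\<lambda>s. (t - c) powr (-\<rho>) * ((c - s) powr (\<rho> - 1) * p s) - k s * p s)"
    using int1 int2 by (simp add: Henstock_Kurzweil_Integration.integral_diff integrable_on_mult_right)
  also have "\<dots> = integral {0..c} (\<lambda>s. abel_kernel \<rho> t c s * p s)"
  proof (rule integral_cong)
    fix s assume s: "s \<in> {0..c}"
    have "(t - c) powr (-\<rho>) * (c - s) powr (\<rho> - 1) - k s = abel_kernel \<rho> t c s"
    proof (cases "s = c")
      case False
      then have pos: "0 < c - s" "0 < t - c" "0 < t - s" using s c by auto
      \<comment> \<open>Both terms are multiples of \<open>Z\<close>, and
        \<open>1 - (c - s) / (t - s) = (t - c) / (t - s)\<close>. The excluded point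
        \<open>s = c\<close> is harmless, as \<open>0 powr x = 0\<close>.\<close>
      define Z where "Z = (c - s) powr (\<rho> - 1) * (t - c) powr (-\<rho>)"
      have "(c - s) powr \<rho> = (c - s) * (c - s) powr (\<rho> - 1)" using pos by (simp add: powr_diff)
      then have "k s = (c - s) * Z / (t - s)"
        using pos by (simp add: k_def Z_def powr_divide powr_minus_divide)
      moreover have "(t - c) powr (1 - \<rho>) = (t - c) * (t - c) powr (-\<rho>)"
        using pos by (simp add: powr_diff powr_minus_divide)
      then have "abel_kernel \<rho> t c s = (t - c) * Z / (t - s)"
        by (simp add: abel_kernel_def Z_def)
      moreover have "Z - (c - s) * Z / (t - s) = (t - c) * Z / (t - s)"
        using pos by (simp add: field_simps)
      ultimately show ?thesis by (simp add: Z_def mult.commute)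
    qed (simp add: k_def abel_kernel_def)
    then show "(t - c) powr (-\<rho>) * ((c - s) powr (\<rho> - 1) * p s) - k s * p s = abel_kernel \<rho> t c s * p s"
      by (simp flip: left_diff_distrib mult.assoc)
  qed
  finally show ?thesis .
qed


lemma abel_kernel_integrable:
  assumes "0 < \<rho>" "\<rho> < 1" "0 < c" "c < t"
  shows "abel_kernel \<rho> t c integrable_on {0..c}"
proof -
  have "set_integrable lborel {0..c} (\<lambda>s. abel_kernel \<rho> t c s * indicator {0<..c} s)"
  proof (rule abel_kernel_set_integrable[OF assms])
    show "\<bar>indicat_real {0<..c} s\<bar> \<le> c powr \<rho> * s powr (-\<rho>)" if "0 < s" "s \<le> c" for s
      using that assms bound_by_powr_minus[of s c \<rho> 1 1] by simp
  qed auto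
  then have "(\<lambda>s. abel_kernel \<rho> t c s * indicator {0<..c} s) integrable_on {0..c}"
    by (rule set_borel_integral_eq_integral)
  then show ?thesis
    by (rule integrable_spike[of _ _ "{0}"]) auto
qed

text \<open>The mass is found by a test function. \<open>h\<close> is the fractional integral of the
  constant \<open>Gamma \<rho>\<close>, so its truncated Caputo integrals are exactly the integrals
  of the kernel; \<open>h\<close> is also differentiable away from 0, and the classical form of its
  derivative is a Beta integral.\<close>

lemma abel_kernel_total:
  assumes \<rho>: "0 < \<rho>" "\<rho> < 1" and t: "0 < t"
  shows "((\<lambda>c. integral {0..c} (abel_kernel \<rho> t c)) \<longlongrightarrow> Gamma \<rho> * Gamma (1 - \<rho>)) (at_left t)"
proof -
  define h where "h \<tau> = \<tau> powr \<rho> / \<rho>" for \<tau> :: real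
  have h: "continuous_on {0..t} h"
    unfolding h_def using \<rho> by (intro continuous_intros continuous_on_powr') auto
  have deriv: "(h has_vector_derivative x powr (\<rho> - 1)) (at x)" if "0 < x" for x
    unfolding h_def has_real_derivative_iff_has_vector_derivative[symmetric]
    using that \<rho> by (auto intro!: derivative_eq_intros)
  have "((\<lambda>\<xi>. (t - \<xi>) powr (-\<rho>) *\<^sub>R \<xi> powr (\<rho> - 1)) has_integral Gamma \<rho> * Gamma (1 - \<rho>)) {0..t}"
    using has_integral_fractional_power[of "1 - \<rho>" \<rho> t] \<rho> t by (simp add: mult.commute)
  then have "has_caputo_derivative \<rho> h ((1 / Gamma (1 - \<rho>)) *\<^sub>R (Gamma \<rho> * Gamma (1 - \<rho>))) t"
    using has_caputo_derivative_iff_classical[OF t h deriv] by blast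
  moreover have "Gamma (1 - \<rho>) > 0" "Gamma \<rho> > 0" using \<rho> by (auto intro!: Gamma_real_pos)
  ultimately have lim: "(caputo_parts \<rho> h t \<longlongrightarrow> Gamma \<rho> * Gamma (1 - \<rho>)) (at_left t)"
    unfolding has_caputo_derivative_iff[OF h \<rho> t] by (simp add: mult.commute)
  have "caputo_parts \<rho> h t c = integral {0..c} (abel_kernel \<rho> t c)" if c: "0 < c" "c < t" for c
  proof -
    have "Gamma \<rho> * caputo_parts \<rho> h t c = integral {0..c} (\<lambda>s. abel_kernel \<rho> t c s * (Gamma \<rho> * indicator {0<..} s))"
    proof (rule caputo_parts_fractional_integral[OF \<rho> c])
      show "\<bar>Gamma \<rho> * indicat_real {0<..} s\<bar> \<le> (Gamma \<rho> * t powr \<rho>) * s powr (-\<rho>)" if "0 < s" "s \<le> t" for s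
        using that \<rho> \<open>Gamma \<rho> > 0\<close> by (intro bound_by_powr_minus) auto
      show "Gamma \<rho> * (h \<tau> - h 0) = integral {0..\<tau>} (\<lambda>s. (\<tau> - s) powr (\<rho> - 1) * (Gamma \<rho> * indicator {0<..} s))"
        if "0 \<le> \<tau>" "\<tau> \<le> t" for \<tau>
      proof (cases "\<tau> = 0")
        case False
        have "((\<lambda>s. Gamma \<rho> * ((\<tau> - s) powr (\<rho> - 1) * s powr (1 - 1))) has_integral
            Gamma \<rho> * (Gamma \<rho> * Gamma 1 / Gamma (1 + \<rho>) * \<tau> powr (1 + \<rho> - 1))) {0..\<tau>}"
          using \<rho> that False by (intro has_integral_mult_right has_integral_fractional_power) auto
        then have "((\<lambda>s. (\<tau> - s) powr (\<rho> - 1) * (Gamma \<rho> * indicator {0<..} s)) has_integral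
            Gamma \<rho> * (Gamma \<rho> * Gamma 1 / Gamma (1 + \<rho>) * \<tau> powr (1 + \<rho> - 1))) {0..\<tau>}"
          by (rule has_integral_eq[rotated]) (auto simp: indicator_def)
        moreover have "Gamma (1 + \<rho>) = \<rho> * Gamma \<rho>"
          using Gamma_plus1[of \<rho>] \<rho> nonpos_Ints_nonpos[of \<rho>] by (auto simp: add.commute)
        ultimately show ?thesis
          using \<open>Gamma \<rho> > 0\<close> \<rho> by (simp add: integral_unique h_def)
      qed (simp add: h_def)
    qed auto
    also have "\<dots> = integral {0..c} (\<lambda>s. Gamma \<rho> * abel_kernel \<rho> t c s)"
      by (rule integral_spike[of "{0}"]) auto
    finally show ?thesis using \<open>Gamma \<rho> > 0\<close> by simp
  qed
  then show ?thesis
    by (intro Lim_transform_eventually[OF lim] eventually_at_left_interval[OF t])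
qed

text \<open>Near \<open>t\<close> the function \<open>G\<close> is small and the mass of the kernel
  is bounded; away from \<open>t\<close> the factor \<open>(t - c) powr (1 - \<rho>)\<close> makes
  the kernel vanish uniformly, and \<open>s powr (-\<rho>)\<close> is integrable.\<close>

lemma abel_kernel_concentrates:
  fixes G :: "real \<Rightarrow> real"
  assumes \<rho>: "0 < \<rho>" "\<rho> < 1" and t: "0 < t"
    and G: "G \<in> borel_measurable borel" "\<And>s. 0 < s \<Longrightarrow> s \<le> t \<Longrightarrow> \<bar>G s\<bar> \<le> C * s powr (-\<rho>)" "G 0 = 0"
    and lim: "(G \<longlongrightarrow> 0) (at_left t)"
  shows "((\<lambda>c. integral {0..c} (\<lambda>s. abel_kernel \<rho> t c s * \<bar>G s\<bar>)) \<longlongrightarrow> 0) (at_left t)"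
proof (rule tendstoI)
  fix e :: real assume e: "e > 0"
  have "0 \<le> C * t powr (-\<rho>)" using G(2)[of t] t by linarith
  then have C: "C \<ge> 0" using t by (simp add: zero_le_mult_iff)
  define M where "M = Gamma \<rho> * Gamma (1 - \<rho>) + 1"
  have M: "M > 0" using \<rho> by (auto simp: M_def intro!: add_pos_pos mult_pos_pos Gamma_real_pos)
  define e1 where "e1 = e / (2 * M)"
  have e1: "e1 > 0" using e M by (simp add: e1_def)
  obtain s0 where s0: "s0 < t" "\<And>s. s0 < s \<Longrightarrow> s < t \<Longrightarrow> \<bar>G s\<bar> < e1"
    using tendstoD[OF lim e1] unfolding eventually_at_left_field by auto
  define r where "r = max s0 0"
  have r: "0 \<le> r" "r < t" using s0 t by (auto simp: r_def)
  \<comment> \<open>For \<open>c > m\<close> and \<open>s \<le> r\<close> the distance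
    \<open>c - s\<close> is at least \<open>m - r\<close>, which keeps the singularity at
    \<open>s = c\<close> away from the region \<open>s \<le> r\<close>.\<close>
  define m where "m = (r + t) / 2"
  have m: "r < m" "m < t" using r by (auto simp: m_def field_simps)
  define B where "B = (m - r) powr (\<rho> - 1) / (t - r) * C"
  define J where "J = integral {0..t} (\<lambda>s. s powr (-\<rho>))"
  have Jint: "(\<lambda>s. s powr (-\<rho>)) integrable_on {0..t}"
    using \<rho> t by (intro integrable_on_powr_from_0) auto
  have "((\<lambda>c. (t - c) powr (1 - \<rho>) * B * J) \<longlongrightarrow> (t - t) powr (1 - \<rho>) * B * J) (at_left t)"
    by (intro tendsto_intros) (use \<rho> in \<open>auto simp: eventually_at_filter\<close>)
  then have "\<forall>\<^sub>F c in at_left t. (t - c) powr (1 - \<rho>) * B * J < e / 2"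
    by (rule order_tendstoD) (use \<rho> e in auto)
  moreover have "\<forall>\<^sub>F c in at_left t. integral {0..c} (abel_kernel \<rho> t c) < M"
    by (rule order_tendstoD[OF abel_kernel_total[OF \<rho> t]]) (simp add: M_def)
  moreover have "\<forall>\<^sub>F c in at_left t. m < c \<and> c < t"
    unfolding eventually_at_left_field using m by (intro exI[of _ m]) auto
  ultimately show "\<forall>\<^sub>F c in at_left t. dist (integral {0..c} (\<lambda>s. abel_kernel \<rho> t c s * \<bar>G s\<bar>)) 0 < e"
  proof eventually_elim
    case (elim c)
    then have c: "0 < c" "c < t" "m < c" using m r by auto
    have int: "(\<lambda>s. abel_kernel \<rho> t c s * \<bar>G s\<bar>) integrable_on {0..c}"
      by (rule set_borel_integral_eq_integral[OF abel_kernel_set_integrable[OF \<rho> c(1,2), where C = C]])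
        (use G c in auto)
    have intK: "abel_kernel \<rho> t c integrable_on {0..c}" by (rule abel_kernel_integrable[OF \<rho> c(1,2)])
    have intJ: "(\<lambda>s. s powr (-\<rho>)) integrable_on {0..c}"
      by (rule integrable_on_subinterval[OF Jint]) (use c in auto)
    have JJ: "integral {0..c} (\<lambda>s. s powr (-\<rho>)) \<le> J"
      unfolding J_def by (rule integral_subset_le[OF _ intJ Jint]) (use c in auto)
    have pt: "abel_kernel \<rho> t c s * \<bar>G s\<bar> \<le> e1 * abel_kernel \<rho> t c s + (t - c) powr (1 - \<rho>) * B * s powr (-\<rho>)"
      if s: "s \<in> {0..c}" for s
    proof -
      have K0: "0 \<le> abel_kernel \<rho> t c s" using s c by (intro abel_kernel_nonneg) auto
      have B0: "0 \<le> (t - c) powr (1 - \<rho>) * B * s powr (-\<rho>)"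
        using C r m by (auto simp: B_def intro!: mult_nonneg_nonneg)
      consider "s = 0" | "r < s" | "0 < s" "s \<le> r" using s r by fastforce
      then show ?thesis
      proof cases
        case 1
        then show ?thesis using G(3) K0 e1 by simp
      next
        case 2
        then have "\<bar>G s\<bar> \<le> e1" using s0(2)[of s] s c by (auto simp: r_def)
        then show ?thesis using mult_right_mono[of "\<bar>G s\<bar>" e1, OF _ K0] B0 by (simp add: mult.commute)
      next
        case 3
        have "abel_kernel \<rho> t c s \<le> (t - c) powr (1 - \<rho>) * (m - r) powr (\<rho> - 1) / (t - r)"
          unfolding abel_kernel_def using 3 c m r \<rho>
          by (intro frac_le mult_left_mono powr_mono2') auto
        then have "abel_kernel \<rho> t c s * \<bar>G s\<bar> \<le>
            (t - c) powr (1 - \<rho>) * (m - r) powr (\<rho> - 1) / (t - r) * (C * s powr (-\<rho>))"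
          using G(2)[of s] 3 r K0 by (intro mult_mono) auto
        also have "\<dots> = (t - c) powr (1 - \<rho>) * B * s powr (-\<rho>)" by (simp add: B_def)
        finally show ?thesis using e1 K0 by (simp add: add_increasing)
      qed
    qed
    have "integral {0..c} (\<lambda>s. abel_kernel \<rho> t c s * \<bar>G s\<bar>) \<le>
        integral {0..c} (\<lambda>s. e1 * abel_kernel \<rho> t c s + (t - c) powr (1 - \<rho>) * B * s powr (-\<rho>))"
      using int intK intJ pt by (intro integral_le integrable_add integrable_on_mult_right) auto
    also have "\<dots> = e1 * integral {0..c} (abel_kernel \<rho> t c) + (t - c) powr (1 - \<rho>) * B * integral {0..c} (\<lambda>s. s powr (-\<rho>))"
      using intK intJ by (subst Henstock_Kurzweil_Integration.integral_add) (auto intro!: integrable_on_mult_right)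
    also have "\<dots> \<le> e1 * M + (t - c) powr (1 - \<rho>) * B * J"
      using elim e1 JJ C r m by (intro add_mono mult_left_mono) (auto simp: B_def)
    also have "\<dots> < e" using elim M by (simp add: e1_def field_simps)
    finally have "integral {0..c} (\<lambda>s. abel_kernel \<rho> t c s * \<bar>G s\<bar>) < e" .
    moreover have "0 \<le> integral {0..c} (\<lambda>s. abel_kernel \<rho> t c s * \<bar>G s\<bar>)"
      using int c by (intro Henstock_Kurzweil_Integration.integral_nonneg) (auto intro!: mult_nonneg_nonneg abel_kernel_nonneg)
    ultimately show ?case by simp
  qed
qed

text \<open>The fundamental theorem for fractional integrals is stated weakly, for a norming family of real functionals,
  so that only integrals of real functions occur: the target space need not be second countable.\<close>

lemma caputo_fractional_integral:
  fixes u g :: "real \<Rightarrow> 'a::banach" and \<Lambda> :: "('a \<Rightarrow> real) set"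
  assumes \<rho>: "0 < \<rho>" "\<rho> < 1" and t: "0 < t"
    and u: "continuous_on {0..t} u" and g: "continuous_on {0<..t} g"
    and C: "\<And>s. 0 < s \<Longrightarrow> s \<le> t \<Longrightarrow> norm (g s) \<le> C * s powr (-\<rho>)"
    and \<Lambda>: "\<And>l. l \<in> \<Lambda> \<Longrightarrow> bounded_linear l" "\<And>l x. l \<in> \<Lambda> \<Longrightarrow> \<bar>l x\<bar> \<le> norm x"
    and norming: "\<And>x B. (\<And>l. l \<in> \<Lambda> \<Longrightarrow> \<bar>l x\<bar> \<le> B) \<Longrightarrow> norm x \<le> B"
    and volterra: "\<And>l \<tau>. l \<in> \<Lambda> \<Longrightarrow> 0 \<le> \<tau> \<Longrightarrow> \<tau> \<le> t \<Longrightarrow>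
      Gamma \<rho> * (l (u \<tau>) - l (u 0)) = integral {0..\<tau>} (\<lambda>s. (\<tau> - s) powr (\<rho> - 1) * l (g s))"
  shows "has_caputo_derivative \<rho> u (g t) t"
proof -
  have G\<rho>: "Gamma \<rho> > 0" using \<rho> by (intro Gamma_real_pos)
  \<comment> \<open>A real function that dominates \<open>l (g s - g t)\<close> for all functionals
    \<open>l\<close> at once. The indicator makes it Borel on the line, although \<open>g\<close> is
    continuous only on \<open>{0<..t}\<close>.\<close>
  define G where "G s = indicator {0<..t} s *\<^sub>R norm (g s - g t)" for s
  have G_meas: "G \<in> borel_measurable borel"
    unfolding G_def by (intro borel_measurable_continuous_on_indicator continuous_intros g) auto
  have G0: "G 0 = 0" by (simp add: G_def)
  have G_bound: "\<bar>G s\<bar> \<le> (2 * C) * s powr (-\<rho>)" if s: "0 < s" "s \<le> t" for s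
  proof -
    have "0 \<le> C * t powr (-\<rho>)" using C[OF t] norm_ge_zero[of "g t"] by linarith
    then have "C \<ge> 0" using t by (simp add: zero_le_mult_iff)
    then have "C * t powr (-\<rho>) \<le> C * s powr (-\<rho>)" using s \<rho> by (intro mult_left_mono powr_mono2') auto
    then show ?thesis
      using C[OF s] C[OF t] s norm_triangle_ineq4[of "g s" "g t"] by (simp add: G_def)
  qed
  have "continuous_on {t / 2..t} g" by (rule continuous_on_subset[OF g]) (use t in auto)
  then have "(g \<longlongrightarrow> g t) (at t within {t / 2..t})" using t by (auto simp: continuous_on_def)
  then have "(g \<longlongrightarrow> g t) (at_left t)"
    using t by (simp add: at_within_Icc_at_left)
  then have "((\<lambda>s. norm (g s - g t)) \<longlongrightarrow> 0) (at_left t)"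
    by (simp add: LIM_zero tendsto_norm_zero)
  then have G_lim: "(G \<longlongrightarrow> 0) (at_left t)"
    by (rule Lim_transform_eventually) (auto intro!: eventually_at_left_interval t simp: G_def)
  define K where "K c = integral {0..c} (abel_kernel \<rho> t c)" for c
  \<comment> \<open>The right-hand side does not depend on the functional, so the norming property
    turns the scalar estimates into a norm estimate.\<close>
  have bound: "norm (Gamma \<rho> *\<^sub>R caputo_parts \<rho> u t c - K c *\<^sub>R g t) \<le>
      integral {0..c} (\<lambda>s. abel_kernel \<rho> t c s * \<bar>G s\<bar>)" if c: "0 < c" "c < t" for c
  proof (rule norming)
    fix l assume l: "l \<in> \<Lambda>"
    interpret l: bounded_linear l by (rule \<Lambda>(1)[OF l])
    define p where "p s = indicator {0<..t} s *\<^sub>R l (g s)" for s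
    have p_meas: "p \<in> borel_measurable borel"
      unfolding p_def by (intro borel_measurable_continuous_on_indicator l.continuous_on g) auto
    have p_bound: "\<bar>p s\<bar> \<le> C * s powr (-\<rho>)" if "0 < s" "s \<le> t" for s
      using C[OF that] \<Lambda>(2)[OF l, of "g s"] that by (simp add: p_def)
    have p0: "p 0 = 0" by (simp add: p_def)
    have volt: "Gamma \<rho> * (l (u \<tau>) - l (u 0)) = integral {0..\<tau>} (\<lambda>s. (\<tau> - s) powr (\<rho> - 1) * p s)"
      if "0 \<le> \<tau>" "\<tau> \<le> t" for \<tau>
      unfolding volterra[OF l that] using that
      by (intro integral_spike[of "{0}"]) (auto simp: p_def)
    have "Gamma \<rho> * l (caputo_parts \<rho> u t c) = integral {0..c} (\<lambda>s. abel_kernel \<rho> t c s * p s)"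
      using caputo_parts_fractional_integral[where p = p and q = "\<lambda>x. l (u x)", OF \<rho> c p_meas p_bound p0 volt]
      by (simp add: caputo_parts_linear[OF \<Lambda>(1)[OF l] u] c less_imp_le)
    moreover have int1: "(\<lambda>s. abel_kernel \<rho> t c s * p s) integrable_on {0..c}"
      by (rule set_borel_integral_eq_integral[OF abel_kernel_set_integrable[OF \<rho> c p_meas p_bound p0]])
        (use c in auto)
    moreover have int2: "abel_kernel \<rho> t c integrable_on {0..c}" by (rule abel_kernel_integrable[OF \<rho> c])
    ultimately have eq: "l (Gamma \<rho> *\<^sub>R caputo_parts \<rho> u t c - K c *\<^sub>R g t) =
        integral {0..c} (\<lambda>s. abel_kernel \<rho> t c s * p s - abel_kernel \<rho> t c s * l (g t))"
      by (subst Henstock_Kurzweil_Integration.integral_diff)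
        (auto simp: l.diff l.scaleR K_def intro!: integrable_on_mult_left)
    have int3: "(\<lambda>s. abel_kernel \<rho> t c s * \<bar>G s\<bar>) integrable_on {0..c}"
      by (rule set_borel_integral_eq_integral[OF abel_kernel_set_integrable[OF \<rho> c, where C = "2 * C"]])
        (use G_meas G_bound G0 c in auto)
    \<comment> \<open>At \<open>s = 0\<close> both \<open>p\<close> and \<open>G\<close> are cut to
      0 and the pointwise estimate would fail; a separate value there changes no integral.\<close>
    have "norm (integral {0..c} (\<lambda>s. abel_kernel \<rho> t c s * p s - abel_kernel \<rho> t c s * l (g t))) \<le>
        integral {0..c} (\<lambda>s. if s = 0 then abel_kernel \<rho> t c s * \<bar>l (g t)\<bar> else abel_kernel \<rho> t c s * \<bar>G s\<bar>)"
    proof (rule integral_norm_bound_integral)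
      show "(\<lambda>s. abel_kernel \<rho> t c s * p s - abel_kernel \<rho> t c s * l (g t)) integrable_on {0..c}"
        by (intro integrable_diff int1 integrable_on_mult_left int2)
      show "(\<lambda>s. if s = 0 then abel_kernel \<rho> t c s * \<bar>l (g t)\<bar> else abel_kernel \<rho> t c s * \<bar>G s\<bar>) integrable_on {0..c}"
        by (rule integrable_spike[OF int3, of "{0}"]) auto
      fix s assume s: "s \<in> {0..c}"
      have K0: "0 \<le> abel_kernel \<rho> t c s" using s c by (intro abel_kernel_nonneg) auto
      show "norm (abel_kernel \<rho> t c s * p s - abel_kernel \<rho> t c s * l (g t)) \<le>
          (if s = 0 then abel_kernel \<rho> t c s * \<bar>l (g t)\<bar> else abel_kernel \<rho> t c s * \<bar>G s\<bar>)"
      proof (cases "s = 0")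
        case False
        then have "p s = l (g s)" "G s = norm (g s - g t)" using s c by (auto simp: p_def G_def)
        then have "\<bar>p s - l (g t)\<bar> \<le> \<bar>G s\<bar>" using \<Lambda>(2)[OF l, of "g s - g t"] by (simp add: l.diff)
        from mult_left_mono[OF this K0] show ?thesis
          using K0 False by (simp add: abs_mult flip: right_diff_distrib)
      qed (use K0 in \<open>simp add: p_def abs_mult\<close>)
    qed
    also have "\<dots> = integral {0..c} (\<lambda>s. abel_kernel \<rho> t c s * \<bar>G s\<bar>)"
      by (rule integral_spike[of "{0}"]) auto
    finally show "\<bar>l (Gamma \<rho> *\<^sub>R caputo_parts \<rho> u t c - K c *\<^sub>R g t)\<bar> \<le>
        integral {0..c} (\<lambda>s. abel_kernel \<rho> t c s * \<bar>G s\<bar>)"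
      unfolding eq by simp
  qed
  have "((\<lambda>c. Gamma \<rho> *\<^sub>R caputo_parts \<rho> u t c - K c *\<^sub>R g t) \<longlongrightarrow> 0) (at_left t)"
    by (rule Lim_null_comparison[OF _ abel_kernel_concentrates[OF \<rho> t G_meas G_bound G0 G_lim]])
      (rule eventually_at_left_interval[OF t bound])
  moreover have "((\<lambda>c. K c *\<^sub>R g t) \<longlongrightarrow> (Gamma \<rho> * Gamma (1 - \<rho>)) *\<^sub>R g t) (at_left t)"
    unfolding K_def by (intro tendsto_intros abel_kernel_total[OF \<rho> t])
  ultimately have "((\<lambda>c. (Gamma \<rho> *\<^sub>R caputo_parts \<rho> u t c - K c *\<^sub>R g t) + K c *\<^sub>R g t) \<longlongrightarrow>
      0 + (Gamma \<rho> * Gamma (1 - \<rho>)) *\<^sub>R g t) (at_left t)"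
    by (rule tendsto_add)
  from tendsto_scaleR[OF tendsto_const[of "1 / Gamma \<rho>"] this]
  show ?thesis
    unfolding has_caputo_derivative_iff[OF u \<rho> t] using G\<rho> by simp
qed

section \<open>Scalar relaxation equations\<close>

lemma caputo_fractional_integral_real:
  fixes u g :: "real \<Rightarrow> real"
  assumes \<rho>: "0 < \<rho>" "\<rho> < 1" and t: "0 < t"
    and u: "continuous_on {0..t} u" and g: "continuous_on {0..t} g"
    and volterra: "\<And>\<tau>. 0 < \<tau> \<Longrightarrow> \<tau> \<le> t \<Longrightarrow>
      Gamma \<rho> * (u \<tau> - u 0) = integral {0..\<tau>} (\<lambda>s. (\<tau> - s) powr (\<rho> - 1) * g s)"
  shows "has_caputo_derivative \<rho> u (g t) t"
proof -
  obtain B where B0: "0 < B" and B: "\<And>s. s \<in> {0..t} \<Longrightarrow> norm (g s) \<le> B"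
    using continuous_on_Icc_bounded[OF g] by metis
  show ?thesis
  proof (rule caputo_fractional_integral[where \<Lambda> = "{\<lambda>x. x}" and C = "B * t powr \<rho>", OF \<rho> t u])
    show "continuous_on {0<..t} g" by (rule continuous_on_subset[OF g]) auto
    show "norm (g s) \<le> B * t powr \<rho> * s powr - \<rho>" if "0 < s" "s \<le> t" for s
      using that B[of s] B0 \<rho> by (intro bound_by_powr_minus) auto
    show "Gamma \<rho> * (l (u \<tau>) - l (u 0)) = integral {0..\<tau>} (\<lambda>s. (\<tau> - s) powr (\<rho> - 1) * l (g s))"
      if "l \<in> {\<lambda>x. x}" "0 \<le> \<tau>" "\<tau> \<le> t" for l \<tau>
      using that volterra[of \<tau>] by (cases "\<tau> = 0") auto
  qed (auto intro: bounded_linear_ident)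
qed

lemma fractional_series_shift:
  assumes "0 < \<rho>" "0 < \<mu>" "\<And>n. \<bar>a n\<bar> \<le> R ^ n" "0 \<le> t"
  shows "fractional_series \<rho> a \<mu> t = a 0 * (t powr (\<mu> - 1) / Gamma \<mu>) + fractional_series \<rho> (\<lambda>n. a (Suc n)) (\<mu> + \<rho>) t"
proof -
  have "summable (\<lambda>n. a n * (t powr (\<rho> * real n + \<mu> - 1) / Gamma (\<rho> * real n + \<mu>)))"
    by (rule summable_rabs_cancel[OF summable_fractional_series]) (use assms in auto)
  from suminf_split_head[OF this] show ?thesis
    by (simp add: fractional_series_def algebra_simps)
qed

lemma fractional_series_cmult:
  assumes "0 < \<rho>" "0 < \<mu>" "\<And>n. \<bar>a n\<bar> \<le> R ^ n" "0 \<le> t"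
  shows "fractional_series \<rho> (\<lambda>n. c * a n) \<mu> t = c * fractional_series \<rho> a \<mu> t"
proof -
  have "summable (\<lambda>n. a n * (t powr (\<rho> * real n + \<mu> - 1) / Gamma (\<rho> * real n + \<mu>)))"
    by (rule summable_rabs_cancel[OF summable_fractional_series]) (use assms in auto)
  from suminf_mult[OF this, of c] show ?thesis
    unfolding fractional_series_def by (simp only: mult.assoc)
qed

text \<open>Splitting off the first term. Since raising \<open>\<mu>\<close> by
  \<open>\<rho>\<close> is a fractional integration, this recursion is the Volterra equation of the
  series.\<close>

lemma fractional_series_power_shift:
  assumes "0 < \<rho>" "0 < \<mu>" "0 \<le> t"
  shows "fractional_series \<rho> (\<lambda>n. (- l) ^ n) \<mu> t = t powr (\<mu> - 1) / Gamma \<mu> - l * fractional_series \<rho> (\<lambda>n. (- l) ^ n) (\<mu> + \<rho>) t"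
  using fractional_series_shift[OF assms(1,2), of "\<lambda>n. (- l) ^ n" "\<bar>l\<bar>" t]
    fractional_series_cmult[OF assms(1), of "\<mu> + \<rho>" "\<lambda>n. (- l) ^ n" "\<bar>l\<bar>" t "- l"] assms
  by (simp add: power_abs)

lemma has_integral_reflect_interval:
  fixes f :: "real \<Rightarrow> 'a::real_normed_vector"
  assumes "(f has_integral y) {0..t}"
  shows "((\<lambda>x. f (t - x)) has_integral y) {0..t}"
proof -
  have "((\<lambda>x. f (t - x)) has_integral y) ((\<lambda>x. t - x) ` {0..t})"
    using has_integral_affinity[of f y 0 t "- 1" t] assms by simp
  then show ?thesis by (simp add: image_diff_atLeastAtMost)
qed

text \<open>Reflection preserves existence of the integral, so in the divergent case both sides take
  the same default value.\<close>

lemma integral_reflect_interval: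
  fixes f :: "real \<Rightarrow> 'a::real_normed_vector"
  shows "integral {0..t} (\<lambda>x. f (t - x)) = integral {0..t} f"
proof -
  have "((\<lambda>x. f (t - x)) has_integral y) {0..t} \<longleftrightarrow> (f has_integral y) {0..t}" for y
  proof
    assume "((\<lambda>x. f (t - x)) has_integral y) {0..t}"
    from has_integral_reflect_interval[OF this] show "(f has_integral y) {0..t}" by simp
  qed (rule has_integral_reflect_interval)
  then show ?thesis by (simp add: integral_def integrable_on_def)
qed

section \<open>Relaxation functions: Volterra equations and bounds\<close>

locale relaxation =
  fixes \<rho> l :: real
  assumes \<rho>: "0 < \<rho>" "\<rho> < 1" and l: "0 < l"
begin

text \<open>\<open>e\<close> solves the homogeneous equation with \<open>e 0 = 1\<close>. The
  function \<open>r\<close> below is the Duhamel kernel; its integral over \<open>[0, t]\<close> is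
  \<open>(1 - e t) / l\<close>, so that it plays the part of \<open>- e' / l\<close>.\<close>

definition e :: "real \<Rightarrow> real" where "e t = mittag_leffler \<rho> 1 (- l * t powr \<rho>)"
definition r :: "real \<Rightarrow> real" where "r t = t powr (\<rho> - 1) * mittag_leffler \<rho> \<rho> (- l * t powr \<rho>)"
text \<open>Up to sign, \<open>q\<close> is the derivative of \<open>e\<close> in \<open>l\<close>; hence \<open>caputo_q\<close> is the \<open>l\<close>-derivative of \<open>caputo_e\<close>.\<close>

definition q :: "real \<Rightarrow> real" where "q t = t powr \<rho> / \<rho> * mittag_leffler \<rho> \<rho> (- l * t powr \<rho>)"

lemma Gamma_pos: "Gamma \<rho> > 0" "Gamma (1 - \<rho>) > 0"
  using \<rho> by (auto intro!: Gamma_real_pos)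

lemma e_0 [simp]: "e 0 = 1" and q_0 [simp]: "q 0 = 0"
  using \<rho> by (auto simp: e_def q_def)

lemma continuous_e [continuous_intros]: "continuous_on {0..T} e"
  unfolding e_def using \<rho> by (intro continuous_intros continuous_on_powr') auto

lemma continuous_q [continuous_intros]: "continuous_on {0..T} q"
  unfolding q_def using \<rho> by (intro continuous_intros continuous_on_powr') auto

lemma e_series: "0 < t \<Longrightarrow> e t = fractional_series \<rho> (\<lambda>n. (- l) ^ n) 1 t"
  using \<rho> by (simp add: e_def fractional_series_mittag_leffler)

lemma r_series: "0 \<le> t \<Longrightarrow> r t = fractional_series \<rho> (\<lambda>n. (- l) ^ n) \<rho> t"
  using \<rho> fractional_series_mittag_leffler[of t \<rho> \<rho> l]
  by (cases "t = 0") (auto simp: r_def fractional_series_def)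

text \<open>Differentiating in \<open>l\<close> brings in the factor \<open>n + 1\<close>. With
  \<open>y = \<rho> * real (Suc n)\<close> this factor is \<open>y / \<rho>\<close>, and
  \<open>Gamma (y + 1) = y * Gamma y\<close> absorbs the \<open>y\<close>; only
  \<open>1 / \<rho>\<close> and the series of \<open>r\<close> remain.\<close>

lemma q_series:
  assumes "0 < t"
  shows "q t = fractional_series \<rho> (\<lambda>n. (- l) ^ n * real (Suc n)) (1 + \<rho>) t"
proof -
  have "(- l) ^ n * real (Suc n) * (t powr (\<rho> * real n + (1 + \<rho>) - 1) / Gamma (\<rho> * real n + (1 + \<rho>))) =
      t / \<rho> * ((- l) ^ n * (t powr (\<rho> * real n + \<rho> - 1) / Gamma (\<rho> * real n + \<rho>)))" for n
  proof -
    define y where "y = \<rho> * real n + \<rho>"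
    have y: "y > 0" "y = \<rho> * real (Suc n)" using \<rho> by (auto simp: y_def algebra_simps intro: add_pos_nonneg)
    have "Gamma (y + 1) = y * Gamma y"
      using y(1) by (intro Gamma_plus1) (auto dest: nonpos_Ints_nonpos)
    moreover have "\<rho> * real n + (1 + \<rho>) = y + 1" by (simp add: y_def)
    ultimately have 1: "Gamma (\<rho> * real n + (1 + \<rho>)) = y * Gamma y" by (simp only:)
    have "t powr y = t * t powr (y - 1)" using assms by (simp add: powr_diff)
    moreover have "\<rho> * real n + (1 + \<rho>) - 1 = y" by (simp add: y_def)
    ultimately have 2: "t powr (\<rho> * real n + (1 + \<rho>) - 1) = t * t powr (y - 1)" by (simp only:)
    have 3: "real (Suc n) = y / \<rho>" using y(2) \<rho> by simp
    show ?thesis unfolding 1 2 3 y_def[symmetric] using y(1) by simp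
  qed
  then have "fractional_series \<rho> (\<lambda>n. (- l) ^ n * real (Suc n)) (1 + \<rho>) t =
      (\<Sum>n. t / \<rho> * ((- l) ^ n * (t powr (\<rho> * real n + \<rho> - 1) / Gamma (\<rho> * real n + \<rho>))))"
    by (simp only: fractional_series_def)
  also have "\<dots> = t / \<rho> * fractional_series \<rho> (\<lambda>n. (- l) ^ n) \<rho> t"
    unfolding fractional_series_def using \<rho> assms
    by (intro suminf_mult summable_rabs_cancel[OF summable_fractional_series[where R = l]]) (use l in \<open>auto simp: power_abs\<close>)
  also have "\<dots> = t / \<rho> * r t" using assms by (simp add: r_series)
  also have "\<dots> = q t" using assms by (simp add: r_def q_def powr_diff)
  finally show ?thesis by simp
qed

lemma e_volterra:
  assumes "0 < t"
  shows "((\<lambda>s. (t - s) powr (\<rho> - 1) * e s) has_integral Gamma \<rho> * ((1 - e t) / l)) {0..t}"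
proof -
  have "((\<lambda>s. (t - s) powr (\<rho> - 1) * fractional_series \<rho> (\<lambda>n. (- l) ^ n) 1 s) has_integral
      Gamma \<rho> * fractional_series \<rho> (\<lambda>n. (- l) ^ n) (1 + \<rho>) t) {0..t}"
    by (rule fractional_integral_series[where R = l]) (use \<rho> l assms in \<open>auto simp: power_abs\<close>)
  moreover have "fractional_series \<rho> (\<lambda>n. (- l) ^ n) (1 + \<rho>) t = (1 - e t) / l"
    using fractional_series_power_shift[of \<rho> 1 t l] \<rho> l assms by (simp add: e_series field_simps)
  ultimately have "((\<lambda>s. (t - s) powr (\<rho> - 1) * fractional_series \<rho> (\<lambda>n. (- l) ^ n) 1 s) has_integral
      Gamma \<rho> * ((1 - e t) / l)) {0..t}"
    by (simp only:)
  then show ?thesis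
    by (rule has_integral_spike[rotated 2, where S = "{0}"]) (auto simp: e_series)
qed

lemma caputo_e:
  assumes "0 < t"
  shows "has_caputo_derivative \<rho> e (- l * e t) t"
proof (rule caputo_fractional_integral_real[OF \<rho> assms])
  fix \<tau> :: real assume \<tau>: "0 < \<tau>"
  have "((\<lambda>s. - l * ((\<tau> - s) powr (\<rho> - 1) * e s)) has_integral - l * (Gamma \<rho> * ((1 - e \<tau>) / l))) {0..\<tau>}"
    by (rule has_integral_mult_right[OF e_volterra[OF \<tau>]])
  then have "((\<lambda>s. (\<tau> - s) powr (\<rho> - 1) * (- l * e s)) has_integral - l * (Gamma \<rho> * ((1 - e \<tau>) / l))) {0..\<tau>}"
    by (simp only: mult.left_commute)
  from integral_unique[OF this]
  show "Gamma \<rho> * (e \<tau> - e 0) = integral {0..\<tau>} (\<lambda>s. (\<tau> - s) powr (\<rho> - 1) * (- l * e s))"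
    using l by (simp add: divide_simps) (simp add: algebra_simps)
qed (intro continuous_intros)+

lemma e_nonneg:
  assumes "0 \<le> t"
  shows "0 \<le> e t"
proof -
  have "- e t \<le> 0"
  proof (rule caputo_nonpos[where z = "\<lambda>t. - e t" and T = t and d = "\<lambda>t. - (- l * e t)", OF _ \<rho> l])
    show "has_caputo_derivative \<rho> (\<lambda>t. - e t) (- (- l * e s)) s" if "0 < s" for s
      by (rule has_caputo_derivative_linear[OF bounded_linear_minus[OF bounded_linear_ident] continuous_e \<rho> that caputo_e[OF that]])
  qed (use assms in \<open>auto intro!: continuous_intros\<close>)
  then show ?thesis by simp
qed

lemma e_le_1:
  assumes "0 \<le> t"
  shows "e t \<le> 1"
proof (cases "t = 0")
  case False
  then have t: "0 < t" using assms by simp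
  have "0 \<le> Gamma \<rho> * ((1 - e t) / l)"
    by (rule has_integral_nonneg[OF e_volterra[OF t]]) (auto intro!: mult_nonneg_nonneg e_nonneg)
  then show ?thesis using Gamma_pos l by (simp add: zero_le_mult_iff zero_le_divide_iff)
qed simp

lemma caputo_q:
  assumes "0 < t"
  shows "has_caputo_derivative \<rho> q (e t - l * q t) t"
proof (rule caputo_fractional_integral_real[OF \<rho> assms])
  fix \<tau> :: real assume \<tau>: "0 < \<tau>"
  define a where "a n = (- l) ^ n * real (Suc n)" for n
  \<comment> \<open>The linear factor is absorbed into a geometric bound with ratio
    \<open>2 * l\<close>, as the lemmas on fractional series demand.\<close>
  have "real (Suc n) \<le> 2 ^ n" for n
    by (induction n) (auto simp: algebra_simps intro: order_trans[OF _ add_mono])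
  then have "\<bar>l\<bar> ^ n * real (Suc n) \<le> (2 * \<bar>l\<bar>) ^ n" for n
    using mult_left_mono[of "real (Suc n)" "2 ^ n" "\<bar>l\<bar> ^ n"] by (simp add: power_mult_distrib mult.commute)
  then have a: "\<bar>a n\<bar> \<le> (2 * l) ^ n" for n
    using l by (auto simp: a_def abs_mult power_abs)
  have b: "\<bar>(- l) ^ n\<bar> \<le> (2 * l) ^ n" for n
    using l by (auto simp: power_abs intro: power_mono)
  have eq: "e s - l * q s = fractional_series \<rho> a 1 s" if s: "0 < s" for s
  proof -
    define z where "z n = s powr (\<rho> * real n + (1 + \<rho>) - 1) / Gamma (\<rho> * real n + (1 + \<rho>))" for n
    have sum: "summable (\<lambda>n. c n * z n)"
      if "\<And>n. \<bar>c n\<bar> \<le> (2 * l) ^ n" for c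
      unfolding z_def
      by (rule summable_rabs_cancel[OF summable_fractional_series[where R = "2 * l"]]) (use that \<rho> s in auto)
    have "e s - l * q s = 1 - l * (fractional_series \<rho> (\<lambda>n. (- l) ^ n) (1 + \<rho>) s + fractional_series \<rho> a (1 + \<rho>) s)"
      using fractional_series_power_shift[of \<rho> 1 s l] \<rho> s
      by (simp add: e_series q_series[folded a_def] right_diff_distrib distrib_left)
    also have "fractional_series \<rho> (\<lambda>n. (- l) ^ n) (1 + \<rho>) s + fractional_series \<rho> a (1 + \<rho>) s =
        (\<Sum>n. ((- l) ^ n + a n) * z n)"
      unfolding fractional_series_def z_def[symmetric]
      by (subst suminf_add[OF sum[OF b] sum[OF a]]) (simp only: distrib_right)
    also have "1 - l * \<dots> = 1 + (\<Sum>n. - l * (((- l) ^ n + a n) * z n))"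
    proof -
      have "summable (\<lambda>n. ((- l) ^ n + a n) * z n)"
        using summable_add[OF sum[OF b] sum[OF a]] by (simp only: distrib_right)
      from suminf_mult[OF this, of "- l"] show ?thesis by simp
    qed
    \<comment> \<open>The product rule in \<open>l\<close> for \<open>(- l) ^ Suc n\<close> becomes
      the recursion \<open>a (Suc n) = - l * ((- l) ^ n + a n)\<close>.\<close>
    also have "(\<lambda>n. - l * (((- l) ^ n + a n) * z n)) =
        (\<lambda>n. a (Suc n) * z n)"
    proof -
      have "a (Suc n) = - l * ((- l) ^ n + a n)" for n by (simp add: a_def algebra_simps)
      then show ?thesis by (simp only: mult.assoc)
    qed
    also have "1 + (\<Sum>n. a (Suc n) * z n) = fractional_series \<rho> a 1 s"
      using fractional_series_shift[OF \<rho>(1) zero_less_one a, of s] s by (simp add: fractional_series_def z_def a_def)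
    finally show ?thesis .
  qed
  have "((\<lambda>s. (\<tau> - s) powr (\<rho> - 1) * fractional_series \<rho> a 1 s) has_integral
      Gamma \<rho> * fractional_series \<rho> a (1 + \<rho>) \<tau>) {0..\<tau>}"
    by (rule fractional_integral_series[OF _ _ _ a]) (use \<rho> l \<tau> in auto)
  then have "((\<lambda>s. (\<tau> - s) powr (\<rho> - 1) * (e s - l * q s)) has_integral
      Gamma \<rho> * fractional_series \<rho> a (1 + \<rho>) \<tau>) {0..\<tau>}"
    by (rule has_integral_spike[rotated 2, where S = "{0}"]) (auto simp: eq)
  then show "Gamma \<rho> * (q \<tau> - q 0) = integral {0..\<tau>} (\<lambda>s. (\<tau> - s) powr (\<rho> - 1) * (e s - l * q s))"
    using q_series[OF \<tau>] by (simp add: integral_unique a_def[abs_def])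
qed (intro continuous_intros)+

lemma q_nonneg:
  assumes "0 \<le> t"
  shows "0 \<le> q t"
proof -
  have "- q t \<le> 0"
  proof (rule caputo_nonpos[where z = "\<lambda>t. - q t" and T = t and d = "\<lambda>t. - (e t - l * q t)", OF _ \<rho> l])
    show "has_caputo_derivative \<rho> (\<lambda>t. - q t) (- (e s - l * q s)) s" if "0 < s" for s
      by (rule has_caputo_derivative_linear[OF bounded_linear_minus[OF bounded_linear_ident] continuous_q \<rho> that caputo_q[OF that]])
  qed (use assms e_nonneg in \<open>auto intro!: continuous_intros\<close>)
  then show ?thesis by simp
qed

text \<open>At a maximum of \<open>q\<close> its Caputo derivative \<open>e - l * q\<close> is
  nonnegative, hence \<open>l * q \<le> e \<le> 1\<close> there.\<close>

lemma q_le: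
  assumes "0 \<le> t"
  shows "l * q t \<le> 1"
proof -
  obtain s where s: "s \<in> {0..t}" "\<And>x. x \<in> {0..t} \<Longrightarrow> q x \<le> q s"
    using continuous_attains_sup[OF _ _ continuous_q[of t]] assms by auto
  have "l * q s \<le> 1"
  proof (cases "s = 0")
    case False
    then have s0: "0 < s" using s by auto
    have "0 \<le> s powr (-\<rho>) * (q s - q 0)" using q_nonneg[of s] s0 by simp
    also have "\<dots> \<le> Gamma (1 - \<rho>) * (e s - l * q s)"
      by (rule caputo_derivative_at_max[OF continuous_q \<rho> s0 _ caputo_q[OF s0]]) (use s in auto)
    finally show ?thesis using Gamma_pos e_le_1[of s] s0 by (simp add: zero_le_mult_iff)
  qed simp
  then show ?thesis using s(2)[of t] assms l by (meson atLeastAtMost_iff mult_left_mono order_refl order_trans less_imp_le)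
qed

text \<open>\<open>r\<close> may be singular at 0, out of reach of the maximum principle;
  \<open>q = t * r t / \<rho>\<close> is continuous there, and the sign and the bound of
  \<open>r\<close> are read off from it.\<close>

lemma r_nonneg:
  assumes "0 \<le> t"
  shows "0 \<le> r t"
proof (cases "t = 0")
  case False
  then have "r t = \<rho> * q t / t" using assms \<rho> by (simp add: r_def q_def powr_diff)
  then show ?thesis using q_nonneg[of t] assms \<rho> by simp
qed (simp add: r_def)

lemma r_0 [simp]: "r 0 = 0"
  by (simp add: r_def)

lemma r_measurable [measurable]: "r \<in> borel_measurable borel"
proof -
  have [measurable]: "mittag_leffler \<rho> \<rho> \<in> borel_measurable borel"
    using \<rho> by (intro borel_measurable_continuous_onI continuous_intros)
  show ?thesis unfolding r_def[abs_def] by measurable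
qed

lemma r_has_integral:
  assumes "0 \<le> t"
  shows "(r has_integral (1 - e t) / l) {0..t}"
proof (cases "t = 0")
  case False
  then have t: "0 < t" using assms by simp
  \<comment> \<open>Ordinary integration as the fractional integral of order 1. The factor
    \<open>(t - s) powr 0\<close> is 1 except at \<open>s = t\<close>, where it is 0; hence the null
    set \<open>{t}\<close> below.\<close>
  have "((\<lambda>s. (t - s) powr (1 - 1) * fractional_series \<rho> (\<lambda>n. (- l) ^ n) \<rho> s) has_integral
      Gamma 1 * fractional_series \<rho> (\<lambda>n. (- l) ^ n) (\<rho> + 1) t) {0..t}"
    by (rule fractional_integral_series[where R = l]) (use \<rho> l t in \<open>auto simp: power_abs\<close>)
  moreover have "fractional_series \<rho> (\<lambda>n. (- l) ^ n) (1 + \<rho>) t = (1 - e t) / l"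
    using fractional_series_power_shift[of \<rho> 1 t l] \<rho> l t by (simp add: e_series field_simps)
  ultimately have "((\<lambda>s. (t - s) powr (1 - 1) * fractional_series \<rho> (\<lambda>n. (- l) ^ n) \<rho> s) has_integral
      (1 - e t) / l) {0..t}"
    by (simp add: add.commute)
  then show ?thesis
    by (rule has_integral_spike[rotated 2, where S = "{t}"]) (auto simp: r_series)
qed (use has_integral_refl(1)[of r "0::real"] in auto)

lemma r_set_integrable:
  assumes "0 \<le> t"
  shows "set_integrable lborel {0..t} r"
  by (rule set_integrable_lborel_nonneg) (use r_has_integral[OF assms] r_nonneg in auto)

lemma e_antimono:
  assumes "0 \<le> s" "s \<le> t"
  shows "e t \<le> e s"
proof -
  have "integral {0..s} r \<le> integral {0..t} r"
    using r_has_integral[of s] r_has_integral[of t] assms r_nonneg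
    by (intro integral_subset_le) auto
  then have "(1 - e s) / l \<le> (1 - e t) / l"
    using r_has_integral[of s] r_has_integral[of t] assms by (simp add: integral_unique)
  then show ?thesis using l by (simp add: divide_le_cancel)
qed

text \<open>As \<open>e\<close> decreases, \<open>- e\<close> has its maximum over
  \<open>[0, t]\<close> at \<open>t\<close>, and the lower bound for the derivative at a maximum
  becomes \<open>t powr (-\<rho>) * (1 - e t) \<le> Gamma (1 - \<rho>) * l * e t\<close>.\<close>

lemma e_lower:
  assumes "0 < t"
  shows "1 \<le> e t * (1 + Gamma (1 - \<rho>) * l * t powr \<rho>)"
proof -
  have "t powr (-\<rho>) * (- e t - - e 0) \<le> Gamma (1 - \<rho>) * - (- l * e t)"
  proof (rule caputo_derivative_at_max[where z = "\<lambda>t. - e t", OF _ \<rho> assms])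
    show "has_caputo_derivative \<rho> (\<lambda>t. - e t) (- (- l * e t)) t"
      by (rule has_caputo_derivative_linear[OF bounded_linear_minus[OF bounded_linear_ident] continuous_e \<rho> assms caputo_e[OF assms]])
  qed (auto intro!: continuous_intros e_antimono)
  then have "t powr \<rho> * (t powr (-\<rho>) * (1 - e t)) \<le> t powr \<rho> * (Gamma (1 - \<rho>) * (l * e t))"
    by (intro mult_left_mono) auto
  moreover have "t powr \<rho> * (t powr (-\<rho>) * (1 - e t)) = 1 - e t"
    using assms by (simp add: powr_minus)
  ultimately show ?thesis by (simp add: algebra_simps)
qed

lemma e_pos:
  assumes "0 \<le> t"
  shows "0 < e t"
proof (cases "t = 0")
  case False
  then have "e t \<noteq> 0" using e_lower[of t] assms by auto
  then show ?thesis using e_nonneg[OF assms] by simp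
qed simp

text \<open>In the Volterra equation \<open>e s\<close> is bounded below by \<open>e t\<close>; what
  is left is the integral of the kernel, \<open>t powr \<rho> / \<rho>\<close>.\<close>

lemma e_upper:
  assumes "0 < t"
  shows "l * t powr \<rho> * e t \<le> \<rho> * Gamma \<rho>"
proof -
  have "((\<lambda>s. (t - s) powr (\<rho> - 1) * s powr (1 - 1)) has_integral Gamma \<rho> * Gamma 1 / Gamma (1 + \<rho>) * t powr (1 + \<rho> - 1)) {0..t}"
    using \<rho> assms by (intro has_integral_fractional_power) auto
  moreover have "Gamma (1 + \<rho>) = \<rho> * Gamma \<rho>"
    using Gamma_plus1[of \<rho>] \<rho> nonpos_Ints_nonpos[of \<rho>] by (auto simp: add.commute)
  ultimately have "((\<lambda>s. (t - s) powr (\<rho> - 1) * s powr (1 - 1)) has_integral t powr \<rho> / \<rho>) {0..t}"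
    using Gamma_pos by simp
  from has_integral_mult_left[OF this, of "e t"]
  have "t powr \<rho> / \<rho> * e t \<le> Gamma \<rho> * ((1 - e t) / l)"
    by (rule has_integral_le[OF _ e_volterra[OF assms]])
      (auto intro!: mult_left_mono e_antimono mult_nonneg_nonneg e_nonneg)
  also have "\<dots> \<le> Gamma \<rho> * (1 / l)"
    using Gamma_pos e_nonneg[of t] assms l by (intro mult_left_mono divide_right_mono) auto
  finally show ?thesis using l \<rho> by (simp add: field_simps)
qed

lemma r_upper:
  assumes "0 < t"
  shows "l * t * r t \<le> \<rho>"
proof -
  have "t * r t = \<rho> * q t" using assms \<rho> by (simp add: r_def q_def powr_diff)
  then have "l * t * r t = \<rho> * (l * q t)" by (simp add: mult_ac)
  also have "\<dots> \<le> \<rho> * 1" using q_le[of t] \<rho> assms by (intro mult_left_mono) auto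
  finally show ?thesis by simp
qed

text \<open>The recursion at \<open>\<mu> = \<rho>\<close>. Positivity of the left-hand side bounds
  \<open>r\<close> by the pure power, and convolution with a source yields the Volterra equation of
  the Duhamel integral.\<close>

lemma r_volterra:
  assumes "0 < t"
  shows "((\<lambda>s. (t - s) powr (\<rho> - 1) * r s) has_integral (t powr (\<rho> - 1) - Gamma \<rho> * r t) / l) {0..t}"
proof -
  have "((\<lambda>s. (t - s) powr (\<rho> - 1) * fractional_series \<rho> (\<lambda>n. (- l) ^ n) \<rho> s) has_integral
      Gamma \<rho> * fractional_series \<rho> (\<lambda>n. (- l) ^ n) (\<rho> + \<rho>) t) {0..t}"
    by (rule fractional_integral_series[where R = l]) (use \<rho> l assms in \<open>auto simp: power_abs\<close>)
  moreover have "Gamma \<rho> * fractional_series \<rho> (\<lambda>n. (- l) ^ n) (\<rho> + \<rho>) t = (t powr (\<rho> - 1) - Gamma \<rho> * r t) / l"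
    using fractional_series_power_shift[of \<rho> \<rho> t l] \<rho> l assms Gamma_pos by (simp add: r_series field_simps)
  ultimately have "((\<lambda>s. (t - s) powr (\<rho> - 1) * fractional_series \<rho> (\<lambda>n. (- l) ^ n) \<rho> s) has_integral
      (t powr (\<rho> - 1) - Gamma \<rho> * r t) / l) {0..t}"
    by (simp only:)
  then show ?thesis by (rule has_integral_eq[rotated]) (simp add: r_series)
qed

lemma r_le:
  assumes "0 \<le> t"
  shows "Gamma \<rho> * r t \<le> t powr (\<rho> - 1)"
proof (cases "t = 0")
  case False
  have "0 \<le> (t powr (\<rho> - 1) - Gamma \<rho> * r t) / l"
    by (rule has_integral_nonneg[OF r_volterra]) (use False assms r_nonneg in auto)
  then show ?thesis using l by (simp add: zero_le_divide_iff)
qed simp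

text \<open>For \<open>l * t powr \<rho> \<ge> 1\<close> the bound comes from \<open>r_upper\<close>, otherwise from \<open>r_le\<close>.\<close>

lemma r_interpolation:
  assumes "0 < \<epsilon>" "\<epsilon> \<le> 1" "0 < t"
  shows "l * r t \<le> (1 + 1 / Gamma \<rho>) * l powr \<epsilon> * t powr (\<rho> * \<epsilon> - 1)"
proof -
  \<comment> \<open>In the scaled variable the claim reads \<open>l * r t \<le> (1 + 1 / Gamma
    \<rho>) * (x powr \<epsilon> / t)\<close>; the summands 1 and \<open>1 / Gamma \<rho>\<close>
    serve the two cases.\<close>
  define x where "x = l * t powr \<rho>"
  have x: "x > 0" using l assms by (simp add: x_def)
  have eq: "l powr \<epsilon> * t powr (\<rho> * \<epsilon> - 1) = x powr \<epsilon> / t"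
    using l assms by (simp add: x_def powr_mult powr_powr powr_diff)
  have "l * r t \<le> (1 + 1 / Gamma \<rho>) * (x powr \<epsilon> / t)"
  proof (cases "x \<ge> 1")
    case True
    then have "1 \<le> x powr \<epsilon>" using assms by (intro ge_one_powr_ge_zero) auto
    have "l * r t \<le> 1 / t" using r_upper[OF assms(3)] assms \<rho> by (simp add: field_simps)
    also have "\<dots> \<le> x powr \<epsilon> / t" using \<open>1 \<le> x powr \<epsilon>\<close> assms by (intro divide_right_mono) auto
    also have "\<dots> \<le> (1 + 1 / Gamma \<rho>) * (x powr \<epsilon> / t)"
      using mult_right_mono[of 1 "1 + 1 / Gamma \<rho>" "x powr \<epsilon> / t"] Gamma_pos assms by simp
    finally show ?thesis .
  next
    case False
    then have "x powr 1 \<le> x powr \<epsilon>" using x assms by (intro powr_mono') auto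
    then have xe: "x \<le> x powr \<epsilon>" using x by simp
    have "r t \<le> t powr (\<rho> - 1) / Gamma \<rho>" using r_le[of t] assms Gamma_pos by (simp add: field_simps)
    then have "l * r t \<le> l * (t powr (\<rho> - 1) / Gamma \<rho>)" using l by (intro mult_left_mono) auto
    also have "\<dots> = 1 / Gamma \<rho> * (x / t)" using assms by (simp add: x_def powr_diff)
    also have "\<dots> \<le> 1 / Gamma \<rho> * (x powr \<epsilon> / t)"
      using Gamma_pos xe assms by (intro mult_left_mono divide_right_mono) auto
    also have "\<dots> \<le> (1 + 1 / Gamma \<rho>) * (x powr \<epsilon> / t)"
      using assms by (intro mult_right_mono) auto
    finally show ?thesis .
  qed
  then show ?thesis by (simp add: mult.assoc eq)
qed

section \<open>Convolution with the Duhamel kernel\<close>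

lemma r_mult_set_integrable:
  fixes h :: "real \<Rightarrow> real"
  assumes "0 \<le> a" "continuous_on {a..b} h"
  shows "set_integrable lborel {a..b} (\<lambda>x. r x * h x)"
proof (cases "a \<le> b")
  case True
  obtain B where B: "\<And>s. s \<in> {a..b} \<Longrightarrow> norm (h s) \<le> B"
    using continuous_on_Icc_bounded[OF assms(2)] by metis
  have "set_integrable lborel {0..b} (\<lambda>x. B * r x)"
    using True assms by (intro set_integrable_mult_right r_set_integrable) auto
  then have "set_integrable lborel {a..b} (\<lambda>x. B * r x)"
    by (rule set_integrable_subset) (use assms in auto)
  then show ?thesis
  proof (rule set_integrable_bound)
    have "(\<lambda>x. r x * (indicator {a..b} x *\<^sub>R h x)) \<in> borel_measurable borel"
      by (intro borel_measurable_times r_measurable borel_measurable_continuous_on_indicator assms) auto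
    then show "set_borel_measurable lborel {a..b} (\<lambda>x. r x * h x)"
      by (simp add: set_borel_measurable_def mult.left_commute)
    show "AE x in lborel. x \<in> {a..b} \<longrightarrow> norm (r x * h x) \<le> norm (B * r x)"
    proof (intro AE_I2 impI)
      fix x assume x: "x \<in> {a..b}"
      then have "\<bar>h x\<bar> \<le> \<bar>B\<bar>" using B[OF x] by auto
      then show "norm (r x * h x) \<le> norm (B * r x)"
        using mult_left_mono[of "\<bar>h x\<bar>" "\<bar>B\<bar>" "\<bar>r x\<bar>"] by (simp add: abs_mult mult.commute)
    qed
  qed
qed (simp add: set_integrable_def)

lemma r_mult_integrable:
  fixes h :: "real \<Rightarrow> real"
  assumes "0 \<le> a" "continuous_on {a..b} h"
  shows "(\<lambda>x. r x * h x) integrable_on {a..b}"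
  by (rule set_borel_integral_eq_integral(1)[OF r_mult_set_integrable[OF assms]])

lemma powr_mult_integrable:
  fixes h :: "real \<Rightarrow> real"
  assumes t: "0 < t" and h: "continuous_on {0..t} h"
  shows "(\<lambda>s. (t - s) powr (\<rho> - 1) * h s) integrable_on {0..t}"
proof -
  obtain B where B0: "0 < B" and B: "\<And>s. s \<in> {0..t} \<Longrightarrow> norm (h s) \<le> B"
    using continuous_on_Icc_bounded[OF h] by metis
  define p where "p s = indicator {0<..t} s *\<^sub>R h s" for s
  have "continuous_on {0<..t} h" by (rule continuous_on_subset[OF h]) auto
  then have pm: "p \<in> borel_measurable borel"
    unfolding p_def by (intro borel_measurable_continuous_on_indicator) auto
  have "set_integrable lborel {0..t} (\<lambda>s. (t - s) powr (\<rho> - 1) * p s)"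
  proof (rule abel_integral_set_integrable[OF \<rho> t pm, where C = "B * t powr \<rho>"])
    fix s assume "0 < s" "s \<le> t"
    then show "\<bar>p s\<bar> \<le> B * t powr \<rho> * s powr (-\<rho>)"
      using B[of s] B0 \<rho> by (intro bound_by_powr_minus) (auto simp: p_def)
  qed (simp add: p_def)
  then have "(\<lambda>s. (t - s) powr (\<rho> - 1) * p s) integrable_on {0..t}"
    by (rule set_borel_integral_eq_integral)
  then show ?thesis
    by (rule integrable_spike[of _ _ "{0}"]) (auto simp: p_def)
qed

text \<open>The convolution \<open>w\<close> of \<open>r\<close> and \<open>g\<close> satisfies \<open>J w = (J g - w) / l\<close>, where \<open>J\<close> is the fractional integral:
  this is \<open>r_volterra\<close> convolved with \<open>g\<close>.\<close>

lemma duhamel_volterra: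
  fixes g :: "real \<Rightarrow> real"
  assumes t: "0 < t" and g: "continuous_on {0..t} g"
  defines "w \<equiv> \<lambda>t. integral {0..t} (\<lambda>\<eta>. r \<eta> * g (t - \<eta>))"
  shows "Gamma \<rho> * w t = integral {0..t} (\<lambda>s. (t - s) powr (\<rho> - 1) * (g s - l * w s))"
proof -
  obtain B where B0: "0 < B" and B: "\<And>s. s \<in> {0..t} \<Longrightarrow> norm (g s) \<le> B"
    using continuous_on_Icc_bounded[OF g] by metis
  define p where "p s = indicator {0..t} s *\<^sub>R g s" for s
  \<comment> \<open>Fubini wants a kernel that is nonnegative on the whole line, and the sign of
    \<open>r\<close> is known for nonnegative times only.\<close>
  define b where "b x = indicator {0<..} x * r x" for x
  \<comment> \<open>The value given by \<open>r_volterra\<close> on an interval of length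
    \<open>t - s\<close>. It is 0 at \<open>s = t\<close>, so the half-open and the closed interval
    give the same integral.\<close>
  define k where "k s = ((t - s) powr (\<rho> - 1) - Gamma \<rho> * r (t - s)) / l" for s
  have pm: "p \<in> borel_measurable borel"
    unfolding p_def by (intro borel_measurable_continuous_on_indicator g) auto
  have pB: "\<bar>p s\<bar> \<le> B" for s using B[of s] B0 by (auto simp: p_def indicator_def)
  have k: "((\<lambda>\<xi>. (t - \<xi>) powr (\<rho> - 1) * b (\<xi> - s)) has_integral k s) {s..t}" if s: "0 \<le> s" "s < t" for s
  proof -
    have "((\<lambda>\<xi>. ((t - s) - (\<xi> - s)) powr (\<rho> - 1) * r (\<xi> - s)) has_integral k s) {s..t}"
      using has_integral_affinity'[of "\<lambda>x. ((t - s) - x) powr (\<rho> - 1) * r x" "k s" 0 "t - s" 1 "- s"]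
        r_volterra[of "t - s"] s by (simp add: k_def)
    then show ?thesis
      by (rule has_integral_spike[rotated 2, where S = "{s}"]) (auto simp: b_def)
  qed
  have k_bound: "0 \<le> k s" "k s \<le> (t - s) powr (\<rho> - 1) / l" if "s \<le> t" for s
    using r_le[of "t - s"] r_nonneg[of "t - s"] Gamma_pos l that
    by (auto simp: k_def intro!: divide_right_mono)
  have kp: "set_integrable lborel {0..t} (\<lambda>s. k s * p s)"
  proof (rule set_integrable_lborel_bound)
    have "(\<lambda>s. (t - s) powr (\<rho> - 1) * (B / l)) integrable_on {0..t}"
      by (rule powr_mult_integrable[OF t]) simp
    then show "set_integrable lborel {0..t} (\<lambda>s. (t - s) powr (\<rho> - 1) * (B / l))"
      using B0 l by (intro set_integrable_lborel_nonneg) auto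
    show "\<bar>k s * p s\<bar> \<le> (t - s) powr (\<rho> - 1) * (B / l)" if "s \<in> {0..t}" for s
      using mult_mono[OF k_bound(2) pB[of s], of s] k_bound(1)[of s] that l by (simp add: abs_mult)
  qed (use pm in \<open>auto simp: k_def[abs_def]\<close>)
  have kp': "set_integrable lborel {0..<t} (\<lambda>s. k s * p s)"
    by (rule set_integrable_subset[OF kp]) auto
  have "((\<lambda>\<xi>. (t - \<xi>) powr (\<rho> - 1) * integral {0..\<xi>} (\<lambda>s. b (\<xi> - s) * p s)) has_integral
      (LBINT s:{0..<t}. k s * p s)) {0..t}"
    by (rule fubini_triangle[OF _ _ pm _ _ k kp']) (auto simp: b_def[abs_def] r_nonneg indicator_def)
  moreover have "(LBINT s:{0..<t}. k s * p s) = integral {0..t} (\<lambda>s. k s * p s)"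
  proof -
    have "indicator {0..<t} s * (k s * p s) = indicator {0..t} s * (k s * p s)" for s
      by (auto simp: indicator_def k_def)
    then show ?thesis
      using set_borel_integral_eq_integral(2)[OF kp]
      by (simp only: set_lebesgue_integral_def real_scaleR_def)
  qed
  ultimately have fub: "((\<lambda>\<xi>. (t - \<xi>) powr (\<rho> - 1) * integral {0..\<xi>} (\<lambda>s. b (\<xi> - s) * p s)) has_integral
      integral {0..t} (\<lambda>s. k s * p s)) {0..t}"
    by (simp only:)
  have w: "integral {0..\<xi>} (\<lambda>s. b (\<xi> - s) * p s) = w \<xi>" if \<xi>: "0 \<le> \<xi>" "\<xi> \<le> t" for \<xi>
  proof -
    have "integral {0..\<xi>} (\<lambda>s. b (\<xi> - s) * p s) = integral {0..\<xi>} (\<lambda>s. b s * p (\<xi> - s))"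
      using integral_reflect_interval[of \<xi> "\<lambda>s. b (\<xi> - s) * p s"] by simp
    also have "\<dots> = w \<xi>"
      unfolding w_def by (rule integral_spike[of "{0}"]) (use \<xi> in \<open>auto simp: b_def p_def\<close>)
    finally show ?thesis .
  qed
  have Jw: "((\<lambda>\<xi>. (t - \<xi>) powr (\<rho> - 1) * w \<xi>) has_integral integral {0..t} (\<lambda>s. k s * p s)) {0..t}"
    by (rule has_integral_eq[OF _ fub]) (auto simp: w)
  have Jg: "(\<lambda>s. (t - s) powr (\<rho> - 1) * g s) integrable_on {0..t}"
    by (rule powr_mult_integrable[OF t g])
  have "(\<lambda>s. r s * g (t - s)) integrable_on {0..t}"
    by (rule r_mult_integrable) (auto intro!: continuous_intros continuous_on_compose2[OF g])
  then have "((\<lambda>s. r s * g (t - s)) has_integral w t) {0..t}" unfolding w_def by (rule integrable_integral)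
  from has_integral_reflect_interval[OF this]
  have rg: "((\<lambda>s. r (t - s) * g s) has_integral w t) {0..t}" by simp
  have "((\<lambda>s. k s * p s) has_integral (integral {0..t} (\<lambda>s. (t - s) powr (\<rho> - 1) * g s) - Gamma \<rho> * w t) / l) {0..t}"
  proof (rule has_integral_eq[rotated])
    show "((\<lambda>s. ((t - s) powr (\<rho> - 1) * g s - Gamma \<rho> * (r (t - s) * g s)) / l) has_integral
        (integral {0..t} (\<lambda>s. (t - s) powr (\<rho> - 1) * g s) - Gamma \<rho> * w t) / l) {0..t}"
      by (intro has_integral_divide has_integral_diff integrable_integral Jg has_integral_mult_right rg)
  qed (simp add: k_def p_def algebra_simps)
  then have "integral {0..t} (\<lambda>s. k s * p s) = (integral {0..t} (\<lambda>s. (t - s) powr (\<rho> - 1) * g s) - Gamma \<rho> * w t) / l"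
    by (rule integral_unique)
  note Jw = Jw[unfolded this]
  have "((\<lambda>s. (t - s) powr (\<rho> - 1) * g s - l * ((t - s) powr (\<rho> - 1) * w s)) has_integral
      integral {0..t} (\<lambda>s. (t - s) powr (\<rho> - 1) * g s) -
      l * ((integral {0..t} (\<lambda>s. (t - s) powr (\<rho> - 1) * g s) - Gamma \<rho> * w t) / l)) {0..t}"
    by (intro has_integral_diff integrable_integral Jg has_integral_mult_right Jw)
  moreover have "X - l * ((X - Gamma \<rho> * w t) / l) = Gamma \<rho> * w t" for X
    using l by simp
  moreover have "(t - s) powr (\<rho> - 1) * g s - l * ((t - s) powr (\<rho> - 1) * w s) = (t - s) powr (\<rho> - 1) * (g s - l * w s)" for s
    by (simp add: algebra_simps)
  ultimately have "((\<lambda>s. (t - s) powr (\<rho> - 1) * (g s - l * w s)) has_integral Gamma \<rho> * w t) {0..t}"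
    by (simp only:)
  then show ?thesis by (simp add: integral_unique)
qed

end

section \<open>Orthonormal bases\<close>

lemma sconj_0 [simp]: "sconj (0::'a::scalar_field) = 0"
  using sconj_add[of "0::'a" 0] by simp

lemma mult_sconj_of_real: "x * sconj x = of_real ((norm x)\<^sup>2)" for x :: "'a::scalar_field"
  by (simp add: mult_sconj of_real_def)

lemma sconj_of_real [simp]: "sconj (of_real r :: 'a::scalar_field) = of_real r"
proof (cases "r = 0")
  case False
  have "of_real r * sconj (of_real r :: 'a) = of_real r * of_real r"
    by (simp add: mult_sconj_of_real power2_eq_square)
  then show ?thesis using False by simp
qed simp

lemma norm_sconj [simp]: "norm (sconj x) = norm x" for x :: "'a::scalar_field"
proof (cases "x = 0")
  case False
  have "norm x * norm (sconj x) = norm x * norm x"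
    unfolding norm_mult[symmetric] by (simp add: mult_sconj_of_real power2_eq_square norm_mult)
  then show ?thesis using False by simp
qed simp

lemma sum_Basis_power2: "(\<Sum>b\<in>Basis. (x \<bullet> b)\<^sup>2) = (norm x)\<^sup>2" for x :: "'a::euclidean_space"
  unfolding power2_norm_eq_inner by (subst (2) euclidean_inner) (simp add: power2_eq_square)

section \<open>Geometry of the scalar product\<close>

context hilbert_space
begin

lemma ip_0_left [simp]: "ip 0 y = 0"
  using ip_add[of 0 0 y] by simp

lemma ip_0_right [simp]: "ip x 0 = 0"
  using ip_sconj[of x 0] by simp

lemma ip_add_right: "ip x (y + z) = ip x y + ip x z"
  unfolding ip_sconj[of x "y + z"] ip_sconj[of x y] ip_sconj[of x z] by (simp add: ip_add sconj_add)

lemma ip_scl_right: "ip x (scl c y) = sconj c * ip x y"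
  unfolding ip_sconj[of x "scl c y"] ip_sconj[of x y] by (simp add: ip_scl sconj_mult)

lemma ip_scaleR: "ip (r *\<^sub>R x) y = r *\<^sub>R ip x y"
  using ip_scl[of "of_real r" x y] by (simp add: scl_of_real scaleR_conv_of_real)

lemma ip_diff: "ip (x - y) z = ip x z - ip y z"
  using ip_add[of "x - y" y z] by simp

lemma ip_diff_right: "ip x (y - z) = ip x y - ip x z"
  using ip_add_right[of x "y - z" z] by simp

lemma ip_sum: "ip (sum f F) y = (\<Sum>k\<in>F. ip (f k) y)"
  by (induction F rule: infinite_finite_induct) (auto simp: ip_add)

lemma ip_sum_right: "ip y (sum f F) = (\<Sum>k\<in>F. ip y (f k))"
  by (induction F rule: infinite_finite_induct) (auto simp: ip_add_right)

lemma ip_cauchy_schwarz: "norm (ip x y) \<le> norm x * norm y"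
proof (cases "y = 0")
  case False
  define n where "n = (norm y)\<^sup>2"
  have n: "n > 0" using False by (simp add: n_def)
  define c where "c = ip x y / of_real n"
  define z where "z = x - scl c y"
  have zy: "ip z y = 0"
    using n by (simp add: z_def ip_diff ip_scl ip_self c_def flip: n_def)
  have "ip z z = ip z x"
    by (subst (2) z_def) (simp add: ip_diff_right ip_scl_right zy)
  also have "\<dots> = ip x x - c * ip y x"
    by (simp add: z_def ip_diff ip_scl)
  also have "c * ip y x = of_real ((norm (ip x y))\<^sup>2 / n)"
    using mult_sconj_of_real[of "ip x y"] by (simp add: c_def ip_sconj[of y x])
  finally have "(of_real ((norm z)\<^sup>2) :: 's) = of_real ((norm x)\<^sup>2 - (norm (ip x y))\<^sup>2 / n)"
    by (simp only: ip_self of_real_diff)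
  then have "(norm z)\<^sup>2 = (norm x)\<^sup>2 - (norm (ip x y))\<^sup>2 / n" by (simp only: of_real_eq_iff)
  then have "(norm (ip x y))\<^sup>2 / n \<le> (norm x)\<^sup>2" using zero_le_power2[of "norm z"] by linarith
  then have "(norm (ip x y))\<^sup>2 \<le> (norm x * norm y)\<^sup>2"
    using n by (simp add: n_def power_mult_distrib divide_le_eq)
  then show ?thesis by (rule power2_le_imp_le) simp
qed simp

lemma bounded_linear_ip: "bounded_linear (\<lambda>x. ip x y)"
  by (rule bounded_linear_intro[of _ "norm y"]) (auto simp: ip_add ip_scaleR ip_cauchy_schwarz)

lemma bounded_linear_ip_right: "bounded_linear (\<lambda>x. ip y x)"
proof (rule bounded_linear_intro[of _ "norm y"])
  show "ip y (r *\<^sub>R x) = r *\<^sub>R ip y x" for r x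
    using ip_scl_right[of y "of_real r" x] by (simp add: scl_of_real scaleR_conv_of_real)
qed (use ip_cauchy_schwarz[of y] in \<open>auto simp: ip_add_right mult.commute\<close>)

lemma norm_scl: "norm (scl c x) = norm c * norm x"
proof -
  have "of_real ((norm (scl c x))\<^sup>2) = (c * sconj c) * ip x x"
    by (simp only: ip_self[symmetric] ip_scl ip_scl_right) (simp only: mult_ac)
  also have "\<dots> = of_real ((norm c * norm x)\<^sup>2)"
    by (simp add: mult_sconj_of_real ip_self power_mult_distrib)
  finally have "(norm (scl c x))\<^sup>2 = (norm c * norm x)\<^sup>2" by (simp only: of_real_eq_iff)
  then show ?thesis by (simp add: power2_eq_iff_nonneg)
qed

lemma bounded_linear_scl: "bounded_linear (\<lambda>c. scl c x)"
proof (rule bounded_linear_intro[of _ "norm x"])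
  show "scl (r *\<^sub>R c) x = r *\<^sub>R scl c x" for r c
    by (simp only: scl_of_real[symmetric] scaleR_conv_of_real scale_scale)
qed (simp_all add: scale_left_distrib norm_scl)

lemma norm_power2_ip: "of_real ((norm (x + y))\<^sup>2) = (of_real ((norm x)\<^sup>2 + (norm y)\<^sup>2) :: 's)" if "ip x y = 0"
proof -
  have "ip y x = 0" using ip_sconj[of y x] that by simp
  then show ?thesis
    using that by (simp only: ip_self[symmetric] ip_add ip_add_right of_real_add) simp
qed

lemma pythagoras: "(norm (x + y))\<^sup>2 = (norm x)\<^sup>2 + (norm y)\<^sup>2" if "ip x y = 0"
  using norm_power2_ip[OF that] by (simp only: of_real_eq_iff)

end

section \<open>Fourier expansions\<close>

locale orthonormal_basis = hilbert_space scl ip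
  for scl :: "'s::scalar_field \<Rightarrow> 'h::banach \<Rightarrow> 'h" and ip :: "'h \<Rightarrow> 'h \<Rightarrow> 's" +
  fixes v :: "nat \<Rightarrow> 'h"
  assumes onb: "complete_orthonormal ip v"
begin

lemma ip_basis: "ip (v j) (v k) = (if j = k then 1 else 0)"
  using onb by (simp add: complete_orthonormal_def)

lemma basis_complete: "(\<And>k. ip x (v k) = 0) \<Longrightarrow> x = 0"
  using onb by (simp add: complete_orthonormal_def)

lemma basis_eqI: "(\<And>k. ip x (v k) = ip y (v k)) \<Longrightarrow> x = y"
  using basis_complete[of "x - y"] by (simp add: ip_diff)

lemma coeff_finite_sum:
  "finite F \<Longrightarrow> ip (\<Sum>k\<in>F. scl (a k) (v k)) (v j) = (if j \<in> F then a j else 0)"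
  by (simp add: ip_sum ip_scl ip_basis if_distrib[of "\<lambda>x. _ * x"] sum.delta' cong: if_cong)

lemma norm_finite_sum:
  assumes "finite F"
  shows "(norm (\<Sum>k\<in>F. scl (a k) (v k)))\<^sup>2 = (\<Sum>k\<in>F. (norm (a k))\<^sup>2)"
proof -
  have "of_real ((norm (\<Sum>k\<in>F. scl (a k) (v k)))\<^sup>2) = (\<Sum>j\<in>F. sconj (a j) * ip (\<Sum>k\<in>F. scl (a k) (v k)) (v j))"
    unfolding ip_self[symmetric] by (subst ip_sum_right) (simp add: ip_scl_right)
  also have "\<dots> = (\<Sum>j\<in>F. of_real ((norm (a j))\<^sup>2))"
    using assms by (intro sum.cong) (simp_all add: coeff_finite_sum mult.commute mult_sconj_of_real)
  finally show ?thesis by (simp only: of_real_eq_iff flip: of_real_sum)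
qed

lemma norm_remainder:
  assumes "finite F"
  shows "(norm (x - (\<Sum>k\<in>F. scl (ip x (v k)) (v k))))\<^sup>2 = (norm x)\<^sup>2 - (\<Sum>k\<in>F. (norm (ip x (v k)))\<^sup>2)"
proof -
  define S where "S = (\<Sum>k\<in>F. scl (ip x (v k)) (v k))"
  have "ip (x - S) (scl (ip x (v k)) (v k)) = 0" if "k \<in> F" for k
    using that assms by (simp add: ip_scl_right ip_diff S_def coeff_finite_sum)
  then have "ip (x - S) S = 0"
    by (subst (2) S_def) (simp add: ip_sum_right)
  from pythagoras[OF this] show ?thesis
    using norm_finite_sum[OF assms, of "\<lambda>k. ip x (v k)"] by (simp add: S_def)
qed

lemma summable_basis:
  assumes "summable (\<lambda>k. (norm (a k))\<^sup>2)"
  shows "summable (\<lambda>k. scl (a k) (v k))"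
  unfolding summable_Cauchy
proof (intro allI impI)
  fix e :: real assume e: "e > 0"
  then obtain N where N: "\<And>m n. m \<ge> N \<Longrightarrow> norm (\<Sum>k\<in>{m..<n}. (norm (a k))\<^sup>2) < e\<^sup>2"
    using assms unfolding summable_Cauchy by (meson zero_less_power)
  have "norm (\<Sum>k\<in>{m..<n}. scl (a k) (v k)) < e" if "m \<ge> N" for m n
  proof (rule power2_less_imp_less)
    show "(norm (\<Sum>k\<in>{m..<n}. scl (a k) (v k)))\<^sup>2 < e\<^sup>2"
      using N[OF that, of n] by (simp add: norm_finite_sum)
  qed (use e in simp)
  then show "\<exists>N. \<forall>m\<ge>N. \<forall>n. norm (\<Sum>k\<in>{m..<n}. scl (a k) (v k)) < e" by blast
qed

definition elem :: "(nat \<Rightarrow> 's) \<Rightarrow> 'h" where "elem a = (\<Sum>k. scl (a k) (v k))"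

lemma coeff_elem:
  assumes "summable (\<lambda>k. (norm (a k))\<^sup>2)"
  shows "ip (elem a) (v j) = a j"
proof -
  have "ip (elem a) (v j) = (\<Sum>k. ip (scl (a k) (v k)) (v j))"
    unfolding elem_def by (rule bounded_linear.suminf[OF bounded_linear_ip summable_basis[OF assms]])
  also have "\<dots> = (\<Sum>k. if k = j then a j else 0)"
    by (rule suminf_cong) (simp add: ip_scl ip_basis)
  also have "\<dots> = a j" using sums_single[of j "\<lambda>_. a j"] by (simp add: sums_iff)
  finally show ?thesis .
qed

lemma bessel_finite: "finite F \<Longrightarrow> (\<Sum>k\<in>F. (norm (ip x (v k)))\<^sup>2) \<le> (norm x)\<^sup>2"
  using norm_remainder[of F x] zero_le_power2[of "norm (x - (\<Sum>k\<in>F. scl (ip x (v k)) (v k)))"] by linarith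

lemma bessel: "summable (\<lambda>k. (norm (ip x (v k)))\<^sup>2)"
  by (rule bounded_imp_summable[of _ "(norm x)\<^sup>2"]) (auto simp: bessel_finite)

lemma elem_coeffs: "elem (\<lambda>k. ip x (v k)) = x"
  by (rule basis_eqI) (simp add: coeff_elem bessel)

lemma parseval: "(\<lambda>k. (norm (ip x (v k)))\<^sup>2) sums (norm x)\<^sup>2"
proof -
  have "(\<lambda>n. \<Sum>k<n. scl (ip x (v k)) (v k)) \<longlonglongrightarrow> x"
    using summable_LIMSEQ[OF summable_basis[OF bessel[of x]]] elem_coeffs[of x] by (simp only: elem_def)
  then have "(\<lambda>n. (norm (\<Sum>k<n. scl (ip x (v k)) (v k)))\<^sup>2) \<longlonglongrightarrow> (norm x)\<^sup>2" by (intro tendsto_intros)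
  then show ?thesis by (simp add: sums_def norm_finite_sum)
qed

lemma norm_le_coeffs:
  assumes "\<And>n. (\<Sum>k<n. (norm (ip x (v k)))\<^sup>2) \<le> B\<^sup>2" "0 \<le> B"
  shows "norm x \<le> B"
proof (rule power2_le_imp_le[OF _ assms(2)])
  show "(norm x)\<^sup>2 \<le> B\<^sup>2"
    using parseval[of x] assms(1) by (metis suminf_le_const sums_iff)
qed

text \<open>The remainder formula holds for every finite index set, so convergence along the net of
  finite sets reduces to a nonnegative real series. Unordered sums are needed because the solution
  formula sums over the complement of an index set.\<close>

lemma fourier_has_sum: "((\<lambda>k. scl (ip x (v k)) (v k)) has_sum x) UNIV"
proof -
  have "((\<lambda>k. (norm (ip x (v k)))\<^sup>2) has_sum (norm x)\<^sup>2) UNIV"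
    by (rule sums_nonneg_imp_has_sum[OF parseval]) simp
  then have "((\<lambda>F. (norm x)\<^sup>2 - (\<Sum>k\<in>F. (norm (ip x (v k)))\<^sup>2)) \<longlongrightarrow> (norm x)\<^sup>2 - (norm x)\<^sup>2) (finite_subsets_at_top UNIV)"
    unfolding has_sum_def by (intro tendsto_intros)
  then have "((\<lambda>F. (norm (x - (\<Sum>k\<in>F. scl (ip x (v k)) (v k))))\<^sup>2) \<longlongrightarrow> 0) (finite_subsets_at_top UNIV)"
    by (subst tendsto_cong[where g = "\<lambda>F. (norm x)\<^sup>2 - (\<Sum>k\<in>F. (norm (ip x (v k)))\<^sup>2)"])
      (auto simp: norm_remainder intro!: eventually_finite_subsets_at_top_weakI)
  then have "((\<lambda>F. sqrt ((norm (x - (\<Sum>k\<in>F. scl (ip x (v k)) (v k))))\<^sup>2)) \<longlongrightarrow> sqrt 0) (finite_subsets_at_top UNIV)"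
    by (rule tendsto_real_sqrt)
  then have "((\<lambda>F. norm ((\<Sum>k\<in>F. scl (ip x (v k)) (v k)) - x)) \<longlongrightarrow> 0) (finite_subsets_at_top UNIV)"
    by (simp add: norm_minus_commute)
  then show ?thesis
    unfolding has_sum_def by (simp only: tendsto_norm_zero_iff LIM_zero_iff)
qed

lemma fourier_has_sum_on:
  assumes "\<And>k. k \<in> K \<Longrightarrow> ip x (v k) = 0" "\<And>k. k \<notin> K \<Longrightarrow> ip x (v k) = a k"
  shows "((\<lambda>k. scl (a k) (v k)) has_sum x) (- K)"
proof -
  have "((\<lambda>k. scl (a k) (v k)) has_sum x) (- K) \<longleftrightarrow> ((\<lambda>k. scl (ip x (v k)) (v k)) has_sum x) UNIV"
    by (rule has_sum_cong_neutral) (use assms in auto)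
  then show ?thesis using fourier_has_sum by simp
qed

text \<open>The M-test in l2: by Parseval the squared norm of the remainder is the tail of the
  squared coefficients, which \<open>M\<close> bounds uniformly in \<open>t\<close>.\<close>

lemma continuous_on_fourier:
  assumes cont: "\<And>k. continuous_on S (\<lambda>t. ip (u t) (v k))"
    and bound: "\<And>t k. t \<in> S \<Longrightarrow> norm (ip (u t) (v k)) \<le> M k" and M: "summable (\<lambda>k. (M k)\<^sup>2)"
  shows "continuous_on S u"
proof -
  define P where "P n t = (\<Sum>k<n. scl (ip (u t) (v k)) (v k))" for n t
  have unif: "uniform_limit S P u sequentially"
  proof (rule uniform_limitI)
    fix e :: real assume e: "e > 0"
    have "(\<lambda>n. \<Sum>k. (M (k + n))\<^sup>2) \<longlonglongrightarrow> 0" by (rule suminf_exist_split2[OF M])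
    then have "\<forall>\<^sub>F n in sequentially. (\<Sum>k. (M (k + n))\<^sup>2) < e\<^sup>2"
      by (rule order_tendstoD) (use e in simp)
    then show "\<forall>\<^sub>F n in sequentially. \<forall>t\<in>S. dist (P n t) (u t) < e"
    proof eventually_elim
      case (elim n)
      show ?case
      proof
        fix t assume t: "t \<in> S"
        have s: "summable (\<lambda>k. (norm (ip (u t) (v k)))\<^sup>2)" by (rule bessel)
        have "(norm (u t - P n t))\<^sup>2 = (norm (u t))\<^sup>2 - (\<Sum>k<n. (norm (ip (u t) (v k)))\<^sup>2)"
          unfolding P_def by (rule norm_remainder) simp
        also have "\<dots> = (\<Sum>k. (norm (ip (u t) (v (k + n))))\<^sup>2)"
          using suminf_minus_initial_segment[OF s, of n] parseval[of "u t"] by (simp add: sums_iff)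
        also have "\<dots> \<le> (\<Sum>k. (M (k + n))\<^sup>2)"
          by (rule suminf_le[OF _ summable_ignore_initial_segment[OF s] summable_ignore_initial_segment[OF M]])
            (simp add: bound[OF t] power_mono)
        also have "\<dots> < e\<^sup>2" by (rule elim)
        finally have "norm (u t - P n t) < e" by (rule power2_less_imp_less) (use e in simp)
        then show "dist (P n t) (u t) < e" by (simp add: dist_norm norm_minus_commute)
      qed
    qed
  qed
  have cont_P: "continuous_on S (P n)" for n
  proof -
    show ?thesis
      unfolding P_def by (rule continuous_on_sum) (rule bounded_linear.continuous_on[OF bounded_linear_scl cont])
  qed
  show ?thesis
    by (rule uniform_limit_theorem[OF always_eventually unif]) (simp_all add: cont_P)
qed

text \<open>Real coordinates of a vector: the scalar field is itself a Euclidean space.\<close>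

definition coordinate_functionals :: "('h \<Rightarrow> real) set" where
  "coordinate_functionals = {l. \<exists>n w. l = (\<lambda>x. \<Sum>(k, b)\<in>{..<n} \<times> Basis. w k b * (ip x (v k) \<bullet> b)) \<and>
     (\<Sum>(k, b)\<in>{..<n} \<times> Basis. (w k b)\<^sup>2) \<le> 1}"

lemma sum_coordinates:
  "(\<Sum>(k, b)\<in>{..<n} \<times> Basis. (ip x (v k) \<bullet> b)\<^sup>2) = (\<Sum>k<n. (norm (ip x (v k)))\<^sup>2)"
  by (simp add: sum_Basis_power2 flip: sum.cartesian_product)

lemma bounded_linear_coordinate_functional:
  assumes "l \<in> coordinate_functionals"
  shows "bounded_linear l"
proof -
  obtain n w where l: "l = (\<lambda>x. \<Sum>(k, b)\<in>{..<n} \<times> Basis. w k b * (ip x (v k) \<bullet> b))"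
    using assms by (auto simp: coordinate_functionals_def)
  have "bounded_linear (\<lambda>x. w k b * (ip x (v k) \<bullet> b))" for k b
    by (intro bounded_linear_const_mult bounded_linear_compose[OF bounded_linear_inner_left bounded_linear_ip])
  then show ?thesis unfolding l case_prod_beta by (intro bounded_linear_sum)
qed

lemma coordinate_functional_le:
  assumes "l \<in> coordinate_functionals"
  shows "\<bar>l x\<bar> \<le> norm x"
proof -
  obtain n w where l: "l = (\<lambda>x. \<Sum>(k, b)\<in>{..<n} \<times> Basis. w k b * (ip x (v k) \<bullet> b))"
    and w: "(\<Sum>(k, b)\<in>{..<n} \<times> Basis. (w k b)\<^sup>2) \<le> 1"
    using assms by (auto simp: coordinate_functionals_def)
  have "(l x)\<^sup>2 \<le> (\<Sum>(k, b)\<in>{..<n} \<times> Basis. (w k b)\<^sup>2) * (\<Sum>(k, b)\<in>{..<n} \<times> Basis. (ip x (v k) \<bullet> b)\<^sup>2)"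
    unfolding l case_prod_beta by (rule Cauchy_Schwarz_ineq_sum)
  also have "\<dots> \<le> 1 * (norm x)\<^sup>2"
    unfolding sum_coordinates using w by (intro mult_mono bessel_finite sum_nonneg) auto
  finally have "\<bar>l x\<bar>\<^sup>2 \<le> (norm x)\<^sup>2" by simp
  then show ?thesis by (rule power2_le_imp_le) simp
qed

text \<open>The functionals are finite real combinations of coordinates with weights of Euclidean
  norm at most 1; duality in finite dimension recovers the norm of each truncation, and Parseval the
  norm of the vector.\<close>

lemma coordinate_functionals_norming:
  assumes "\<And>l. l \<in> coordinate_functionals \<Longrightarrow> \<bar>l x\<bar> \<le> B"
  shows "norm x \<le> B"
proof (rule norm_le_coeffs)
  have "(\<lambda>x. \<Sum>(k, b)\<in>{..<0} \<times> Basis. 0 * (ip x (v k) \<bullet> b)) \<in> coordinate_functionals"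
    unfolding coordinate_functionals_def mem_Collect_eq by (intro exI conjI, rule refl) simp
  from assms[OF this] show B: "0 \<le> B" by simp
  fix n
  define s where "s = sqrt (\<Sum>k<n. (norm (ip x (v k)))\<^sup>2)"
  have s2: "s\<^sup>2 = (\<Sum>k<n. (norm (ip x (v k)))\<^sup>2)" unfolding s_def by (simp add: sum_nonneg)
  have s0: "s \<ge> 0" unfolding s_def by (simp add: sum_nonneg)
  have "s \<le> B"
  proof (cases "s = 0")
    case False
    \<comment> \<open>The truncated coordinate vector divided by its own norm \<open>s\<close>:
      testing with it returns \<open>s\<close>.\<close>
    define w where "w k b = ip x (v k) \<bullet> b / s" for k b
    have "(\<Sum>(k, b)\<in>{..<n} \<times> Basis. (w k b)\<^sup>2) = (\<Sum>(k, b)\<in>{..<n} \<times> Basis. (ip x (v k) \<bullet> b)\<^sup>2) / s\<^sup>2"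
      by (simp add: w_def power_divide sum_divide_distrib case_prod_beta)
    also have "\<dots> = 1" using False by (simp add: sum_coordinates flip: s2)
    finally have "(\<lambda>x. \<Sum>(k, b)\<in>{..<n} \<times> Basis. w k b * (ip x (v k) \<bullet> b)) \<in> coordinate_functionals"
      unfolding coordinate_functionals_def mem_Collect_eq by (intro exI[of _ n] exI[of _ w] conjI) auto
    from assms[OF this] have "(\<Sum>(k, b)\<in>{..<n} \<times> Basis. w k b * (ip x (v k) \<bullet> b)) \<le> B" by simp
    moreover have "(\<Sum>(k, b)\<in>{..<n} \<times> Basis. w k b * (ip x (v k) \<bullet> b)) = (\<Sum>(k, b)\<in>{..<n} \<times> Basis. (ip x (v k) \<bullet> b)\<^sup>2) / s"
      by (simp add: w_def power2_eq_square sum_divide_distrib case_prod_beta)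
    moreover have "\<dots> = s\<^sup>2 / s" by (simp only: sum_coordinates s2)
    moreover have "s\<^sup>2 / s = s" by (simp add: power2_eq_square)
    ultimately show ?thesis by simp
  qed (use B in simp)
  then show "(\<Sum>k<n. (norm (ip x (v k)))\<^sup>2) \<le> B\<^sup>2"
    unfolding s2[symmetric] using s0 by (rule power_mono)
qed

lemma norm_le_coeff_norms:
  assumes "\<And>k. norm (ip x (v k)) \<le> C * norm (ip y (v k))" "0 \<le> C"
  shows "norm x \<le> C * norm y"
proof (rule norm_le_coeffs)
  fix n
  have "(\<Sum>k<n. (norm (ip x (v k)))\<^sup>2) \<le> (\<Sum>k<n. (C * norm (ip y (v k)))\<^sup>2)"
    by (intro sum_mono power_mono assms(1) norm_ge_zero)
  also have "\<dots> \<le> C\<^sup>2 * (norm y)\<^sup>2"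
    by (simp only: power_mult_distrib flip: sum_distrib_left) (intro mult_left_mono bessel_finite, auto)
  finally show "(\<Sum>k<n. (norm (ip x (v k)))\<^sup>2) \<le> (C * norm y)\<^sup>2" by (simp add: power_mult_distrib)
qed (use assms in simp)

text \<open>Continuity descends from a function with larger coefficients. It passes from
  \<open>A\<close> to the power \<open>\<epsilon>\<close> applied to \<open>f\<close> down to
  \<open>f\<close>, and from the image of the Duhamel integral under \<open>A\<close> down to the
  integral itself.\<close>

lemma continuous_on_coeff_norms:
  assumes w: "continuous_on S w" and C: "0 \<le> C"
    and le: "\<And>s t k. s \<in> S \<Longrightarrow> t \<in> S \<Longrightarrow> norm (ip (u s - u t) (v k)) \<le> C * norm (ip (w s - w t) (v k))"
  shows "continuous_on S u"
proof -
  have "((\<lambda>s. norm (u s - u t)) \<longlongrightarrow> 0) (at t within S)" if t: "t \<in> S" for t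
  proof (rule tendsto_sandwich[OF _ _ tendsto_const])
    have "((\<lambda>s. C * norm (w s - w t)) \<longlongrightarrow> C * norm (w t - w t)) (at t within S)"
      using w t unfolding continuous_on_def by (intro tendsto_intros) auto
    then show "((\<lambda>s. C * norm (w s - w t)) \<longlongrightarrow> 0) (at t within S)" by simp
    show "\<forall>\<^sub>F s in at t within S. norm (u s - u t) \<le> C * norm (w s - w t)"
      unfolding eventually_at_filter using t
      by (intro always_eventually) (auto intro!: norm_le_coeff_norms le C)
  qed simp
  then show ?thesis
    unfolding continuous_on_def by (simp only: tendsto_norm_zero_iff LIM_zero_iff) simp
qed

lemma summable_coeff_norms:
  assumes "\<And>k. norm (a k) \<le> C * norm (ip y (v k))"
  shows "summable (\<lambda>k. (norm (a k))\<^sup>2)"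
proof (rule summable_comparison_test'[where N = 0])
  show "summable (\<lambda>k. C\<^sup>2 * (norm (ip y (v k)))\<^sup>2)" by (intro summable_mult bessel)
  show "norm ((norm (a n))\<^sup>2) \<le> C\<^sup>2 * (norm (ip y (v n)))\<^sup>2" for n
    using power_mono[OF assms[of n], of 2] by (simp add: power_mult_distrib)
qed

end

sublocale spectral_operator \<subseteq> orthonormal_basis scl ip v
  by unfold_locales (rule onb)

section \<open>Spectral description of the domain\<close>

context spectral_operator
begin

lemma lam_ge: "lam 0 \<le> lam k" "0 < lam k"
  using lam_mono lam_pos by (auto simp: mono_def intro: less_le_trans)

lemma coeff_A:
  assumes "x \<in> D"
  shows "ip (A x) (v k) = of_real (lam k) * ip x (v k)"
proof -
  have "ip (A x) (v k) = ip x (A (v k))"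
    using selfadjoint eigen(1)[of k] assms unfolding selfadjoint_op_def by blast
  then show ?thesis by (simp add: eigen(2) ip_scl_right)
qed

text \<open>Self-adjointness includes maximality: \<open>x\<close> is in \<open>D\<close> as soon as
  some \<open>y\<close> satisfies \<open>ip (A z) x = ip z y\<close> for all \<open>z\<close> in
  \<open>D\<close>. The candidate with coefficients \<open>lam k * ip x (v k)\<close> does so on
  partial sums and therefore in the limit.\<close>

lemma in_domainI:
  assumes "summable (\<lambda>k. (lam k * norm (ip x (v k)))\<^sup>2)"
  shows "x \<in> D" "A x = elem (\<lambda>k. of_real (lam k) * ip x (v k))"
proof -
  define y where "y = elem (\<lambda>k. of_real (lam k) * ip x (v k))"
  have y: "ip y (v k) = of_real (lam k) * ip x (v k)" for k
    unfolding y_def using assms lam_ge(2) by (intro coeff_elem) (simp add: norm_mult abs_of_pos)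
  have "ip (A z) x = ip z y" if z: "z \<in> D" for z
  proof -
    have limx: "(\<lambda>n. \<Sum>k<n. scl (ip x (v k)) (v k)) \<longlonglongrightarrow> x"
      and limy: "(\<lambda>n. \<Sum>k<n. scl (ip y (v k)) (v k)) \<longlonglongrightarrow> y"
      using summable_LIMSEQ[OF summable_basis[OF bessel]] elem_coeffs unfolding elem_def by metis+
    have "ip (A z) (\<Sum>k<n. scl (ip x (v k)) (v k)) = ip z (\<Sum>k<n. scl (ip y (v k)) (v k))" for n
      by (simp add: ip_sum_right ip_scl_right coeff_A[OF z] y sconj_mult mult_ac)
    moreover have "(\<lambda>n. ip (A z) (\<Sum>k<n. scl (ip x (v k)) (v k))) \<longlonglongrightarrow> ip (A z) x"
      by (rule bounded_linear.tendsto[OF bounded_linear_ip_right limx])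
    moreover have "(\<lambda>n. ip z (\<Sum>k<n. scl (ip y (v k)) (v k))) \<longlonglongrightarrow> ip z y"
      by (rule bounded_linear.tendsto[OF bounded_linear_ip_right limy])
    ultimately show ?thesis by (simp add: LIMSEQ_unique)
  qed
  then have "x \<in> D \<and> y = A x" using selfadjoint unfolding selfadjoint_op_def by blast
  then show "x \<in> D" "A x = elem (\<lambda>k. of_real (lam k) * ip x (v k))" by (simp_all add: y_def)
qed

end

section \<open>The fractional evolution equation\<close>

locale fractional_problem = spectral_operator scl ip D A lam v
  for scl :: "'s::scalar_field \<Rightarrow> 'h::banach \<Rightarrow> 'h" and ip :: "'h \<Rightarrow> 'h \<Rightarrow> 's"
    and D A and lam :: "nat \<Rightarrow> real" and v +
  fixes \<rho> T \<epsilon> :: real and f :: "real \<Rightarrow> 'h"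
  assumes \<rho>: "0 < \<rho>" "\<rho> < 1" and T: "0 < T" and \<epsilon>: "0 < \<epsilon>" "\<epsilon> < 1"
    and f: "continuous_power_dom ip lam v \<epsilon> {0..T} f"
begin

abbreviation ek where "ek k \<equiv> relaxation.e \<rho> (lam k)"
abbreviation rk where "rk k \<equiv> relaxation.r \<rho> (lam k)"

lemma relax: "relaxation \<rho> (lam k)"
  by unfold_locales (use \<rho> lam_ge(2) in auto)

text \<open>The power \<open>\<epsilon>\<close> of \<open>A\<close> applied to \<open>f t\<close>.
  Continuity of \<open>f\<close> in the power norm becomes ordinary continuity of
  \<open>F\<close>.\<close>

definition F :: "real \<Rightarrow> 'h" where
  "F t = elem (\<lambda>k. lam k powr \<epsilon> *\<^sub>R ip (f t) (v k))"

lemma lam_powr_power2: "(lam k powr \<epsilon>)\<^sup>2 = lam k powr (2 * \<epsilon>)"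
  by (simp add: power2_eq_square flip: powr_add)

lemma coeff_F:
  assumes "t \<in> {0..T}"
  shows "ip (F t) (v k) = lam k powr \<epsilon> *\<^sub>R ip (f t) (v k)"
proof -
  have "f t \<in> power_dom ip lam v \<epsilon>" using f assms by (auto simp: continuous_power_dom_def)
  then have "summable (\<lambda>k. (norm (lam k powr \<epsilon> *\<^sub>R ip (f t) (v k)))\<^sup>2)"
    by (simp add: power_dom_def power_mult_distrib lam_powr_power2)
  then show ?thesis unfolding F_def by (rule coeff_elem)
qed

lemma coeff_f:
  assumes "t \<in> {0..T}"
  shows "ip (f t) (v k) = lam k powr (-\<epsilon>) *\<^sub>R ip (F t) (v k)"
  using lam_ge(2)[of k] by (simp add: coeff_F[OF assms] powr_minus)

lemma continuous_F: "continuous_on {0..T} F"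
  unfolding continuous_on_def
proof
  fix t assume t: "t \<in> {0..T}"
  have "power_norm ip lam v \<epsilon> (f s - f t) = norm (F s - F t)" if s: "s \<in> {0..T}" for s
  proof -
    have "(norm (ip (F s - F t) (v k)))\<^sup>2 = lam k powr (2 * \<epsilon>) * (norm (ip (f s - f t) (v k)))\<^sup>2" for k
      by (simp add: ip_diff coeff_F[OF s] coeff_F[OF t] power_mult_distrib lam_powr_power2
          flip: scaleR_diff_right)
    then show ?thesis
      using parseval[of "F s - F t"] by (simp add: power_norm_def sums_iff)
  qed
  moreover have "((\<lambda>s. power_norm ip lam v \<epsilon> (f s - f t)) \<longlongrightarrow> 0) (at t within {0..T})"
    using f t by (auto simp: continuous_power_dom_def)
  ultimately have "((\<lambda>s. norm (F s - F t)) \<longlongrightarrow> 0) (at t within {0..T})"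
    by (rule_tac Lim_transform_eventually) (auto simp: eventually_at_filter)
  then show "(F \<longlongrightarrow> F t) (at t within {0..T})"
    by (simp only: tendsto_norm_zero_iff LIM_zero_iff)
qed

lemma continuous_f: "continuous_on {0..T} f"
proof (rule continuous_on_coeff_norms[OF continuous_F])
  fix s t k assume st: "s \<in> {0..T}" "t \<in> {0..T}"
  have "lam k powr (-\<epsilon>) \<le> lam 0 powr (-\<epsilon>)" using lam_ge lam_pos \<epsilon> by (intro powr_mono2') auto
  then show "norm (ip (f s - f t) (v k)) \<le> lam 0 powr (-\<epsilon>) * norm (ip (F s - F t) (v k))"
    by (simp add: ip_diff coeff_f[OF st(1)] coeff_f[OF st(2)] mult_right_mono flip: scaleR_diff_right)
qed simp

lemma continuous_coeff: "continuous_on S u \<Longrightarrow> continuous_on S (\<lambda>t. ip (u t) x)"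
  by (rule bounded_linear.continuous_on[OF bounded_linear_ip])

section \<open>The image of the Duhamel integral under \<open>A\<close>\<close>

lemma rk_integrable:
  fixes h :: "real \<Rightarrow> 's"
  assumes "0 \<le> a" "continuous_on {a..b} h"
  shows "(\<lambda>\<eta>. rk k \<eta> *\<^sub>R h \<eta>) integrable_on {a..b}"
proof (rule integrable_componentwise)
  fix i :: 's assume "i \<in> Basis"
  have "(\<lambda>\<eta>. rk k \<eta> * (h \<eta> \<bullet> i)) integrable_on {a..b}"
    by (rule relaxation.r_mult_integrable[OF relax assms(1)]) (intro continuous_intros assms)
  then show "(\<lambda>\<eta>. (rk k \<eta> *\<^sub>R h \<eta>) \<bullet> i) integrable_on {a..b}" by simp
qed

text \<open>The constant of \<open>r_interpolation\<close>, divided by the exponent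
  \<open>\<rho> * \<epsilon>\<close> that integrating
  \<open>\<eta> powr (\<rho> * \<epsilon> - 1)\<close> produces.\<close>

definition kernel_const :: real where "kernel_const = (1 + 1 / Gamma \<rho>) / (\<rho> * \<epsilon>)"

lemma kernel_const_pos: "kernel_const > 0"
  unfolding kernel_const_def using \<rho> \<epsilon> Gamma_real_pos[OF \<rho>(1)]
  by (intro divide_pos_pos add_pos_pos mult_pos_pos) auto

text \<open>Coefficients of the Duhamel kernel, multiplied by \<open>A\<close> to the power
  \<open>1 - \<epsilon>\<close> and integrated against \<open>\<Phi>\<close>. The limits and
  \<open>\<Phi>\<close> are left free so that increments in time have the same form.\<close>

definition kernel_coeff :: "real \<Rightarrow> real \<Rightarrow> (real \<Rightarrow> 'h) \<Rightarrow> nat \<Rightarrow> 's" where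
  "kernel_coeff a b \<Phi> k = lam k *\<^sub>R integral {a..b} (\<lambda>\<eta>. rk k \<eta> *\<^sub>R (lam k powr (-\<epsilon>) *\<^sub>R ip (\<Phi> \<eta>) (v k)))"

text \<open>An instance of the integral Minkowski inequality. The first \<open>n\<close>
  coefficients are assembled into one vector, which is the integral of \<open>q\<close>; the scalar
  kernel bound is uniform in \<open>k\<close>, so Bessel gives \<open>norm (q \<eta>)\<close> at
  most a multiple of \<open>\<eta> powr (\<rho> * \<epsilon> - 1) * B\<close>, independently of
  \<open>n\<close>.\<close>

lemma kernel_coeff_sum_le:
  assumes ab: "0 \<le> a" "a \<le> b" and \<Phi>: "continuous_on {a..b} \<Phi>" and B: "\<And>\<eta>. \<eta> \<in> {a..b} \<Longrightarrow> norm (\<Phi> \<eta>) \<le> B"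
  shows "(\<Sum>k<n. (norm (kernel_coeff a b \<Phi> k))\<^sup>2) \<le> (kernel_const * (b powr (\<rho> * \<epsilon>) - a powr (\<rho> * \<epsilon>)) * B)\<^sup>2"
proof -
  define C where "C = 1 + 1 / Gamma \<rho>"
  define c where "c k \<eta> = lam k *\<^sub>R (rk k \<eta> *\<^sub>R (lam k powr (-\<epsilon>) *\<^sub>R ip (\<Phi> \<eta>) (v k)))" for k \<eta>
  define q where "q \<eta> = (\<Sum>k<n. scl (c k \<eta>) (v k))" for \<eta>
  define y where "y = (\<Sum>k<n. scl (kernel_coeff a b \<Phi> k) (v k))"
  have C: "C > 0" unfolding C_def using Gamma_real_pos[OF \<rho>(1)] by (intro add_pos_pos) auto
  have B0: "B \<ge> 0" by (rule order_trans[OF norm_ge_zero B[of a]]) (use ab in simp)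
  have "((\<lambda>\<eta>. scl (c k \<eta>) (v k)) has_integral scl (kernel_coeff a b \<Phi> k) (v k)) {a..b}" for k
  proof -
    have "(\<lambda>\<eta>. rk k \<eta> *\<^sub>R (lam k powr (-\<epsilon>) *\<^sub>R ip (\<Phi> \<eta>) (v k))) integrable_on {a..b}"
      by (intro rk_integrable ab continuous_on_scaleR continuous_on_const continuous_coeff \<Phi>)
    from has_integral_cmul[OF integrable_integral[OF this], of "lam k"]
    have "(c k has_integral kernel_coeff a b \<Phi> k) {a..b}"
      by (simp only: c_def[abs_def] kernel_coeff_def)
    from has_integral_linear[OF this bounded_linear_scl] show ?thesis by (simp only: o_def)
  qed
  then have q: "(q has_integral y) {a..b}"
    unfolding q_def y_def by (intro has_integral_sum) auto
  have rho_eps: "0 < \<rho> * \<epsilon>" using \<rho> \<epsilon> by simp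
  have pw: "((\<lambda>\<eta>. C * \<eta> powr (\<rho> * \<epsilon> - 1) * B) has_integral C * ((b powr (\<rho> * \<epsilon>) / (\<rho> * \<epsilon>) - a powr (\<rho> * \<epsilon>) / (\<rho> * \<epsilon>))) * B) {a..b}"
  proof (intro has_integral_mult_left has_integral_mult_right fundamental_theorem_of_calculus_interior ab)
    show "continuous_on {a..b} (\<lambda>\<eta>. \<eta> powr (\<rho> * \<epsilon>) / (\<rho> * \<epsilon>))"
      using ab rho_eps by (intro continuous_intros continuous_on_powr') auto
    fix x assume x: "x \<in> {a<..<b}"
    show "((\<lambda>\<eta>. \<eta> powr (\<rho> * \<epsilon>) / (\<rho> * \<epsilon>)) has_vector_derivative x powr (\<rho> * \<epsilon> - 1)) (at x)"
      unfolding has_real_derivative_iff_has_vector_derivative[symmetric]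
      using x ab rho_eps by (auto intro!: derivative_eq_intros)
  qed
  have "norm (q \<eta>) \<le> C * \<eta> powr (\<rho> * \<epsilon> - 1) * B" if \<eta>: "\<eta> \<in> {a..b}" for \<eta>
  proof (rule power2_le_imp_le)
    define R where "R = C * \<eta> powr (\<rho> * \<epsilon> - 1)"
    have R: "R \<ge> 0" using C by (simp add: R_def)
    have "norm (c k \<eta>) \<le> R * norm (ip (\<Phi> \<eta>) (v k))" for k
    proof (cases "\<eta> = 0")
      case True
      then show ?thesis using R by (simp add: c_def relaxation.r_0[OF relax])
    next
      case False
      then have \<eta>0: "0 < \<eta>" using \<eta> ab by auto
      have "lam k * rk k \<eta> \<le> C * lam k powr \<epsilon> * \<eta> powr (\<rho> * \<epsilon> - 1)"
        unfolding C_def using relaxation.r_interpolation[OF relax] \<epsilon> \<eta>0 by simp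
      then have "lam k * rk k \<eta> * lam k powr (-\<epsilon>) \<le> C * lam k powr \<epsilon> * \<eta> powr (\<rho> * \<epsilon> - 1) * lam k powr (-\<epsilon>)"
        by (rule mult_right_mono) simp
      also have "\<dots> = R" using lam_ge(2)[of k] by (simp add: R_def powr_minus)
      finally have "lam k * rk k \<eta> * lam k powr (-\<epsilon>) \<le> R" .
      from mult_right_mono[OF this norm_ge_zero[of "ip (\<Phi> \<eta>) (v k)"]] show ?thesis
        using lam_ge(2)[of k] relaxation.r_nonneg[OF relax, of \<eta> k] \<eta>0 by (simp add: c_def mult.assoc)
    qed
    then have "(\<Sum>k<n. (norm (c k \<eta>))\<^sup>2) \<le> (\<Sum>k<n. (R * norm (ip (\<Phi> \<eta>) (v k)))\<^sup>2)"
      by (intro sum_mono power_mono) auto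
    also have "\<dots> = R\<^sup>2 * (\<Sum>k<n. (norm (ip (\<Phi> \<eta>) (v k)))\<^sup>2)"
      by (simp add: power_mult_distrib sum_distrib_left)
    also have "\<dots> \<le> R\<^sup>2 * B\<^sup>2"
      using order_trans[OF bessel_finite power_mono[OF B[OF \<eta>] norm_ge_zero]] by (intro mult_left_mono) auto
    finally show "(norm (q \<eta>))\<^sup>2 \<le> (C * \<eta> powr (\<rho> * \<epsilon> - 1) * B)\<^sup>2"
      by (simp add: q_def norm_finite_sum R_def power_mult_distrib)
  qed (use C B0 in simp)
  then have "norm (integral {a..b} q) \<le> integral {a..b} (\<lambda>\<eta>. C * \<eta> powr (\<rho> * \<epsilon> - 1) * B)"
    using q pw by (intro integral_norm_bound_integral) auto
  also have "\<dots> = kernel_const * (b powr (\<rho> * \<epsilon>) - a powr (\<rho> * \<epsilon>)) * B"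
    using integral_unique[OF pw] by (simp add: kernel_const_def C_def diff_divide_distrib right_diff_distrib)
  finally have "norm y \<le> kernel_const * (b powr (\<rho> * \<epsilon>) - a powr (\<rho> * \<epsilon>)) * B"
    using integral_unique[OF q] by simp
  from power_mono[OF this norm_ge_zero, of 2] show ?thesis
    by (simp add: y_def norm_finite_sum)
qed

lemma kernel_coeff_elem:
  assumes ab: "0 \<le> a" "a \<le> b" and \<Phi>: "continuous_on {a..b} \<Phi>" and B: "\<And>\<eta>. \<eta> \<in> {a..b} \<Longrightarrow> norm (\<Phi> \<eta>) \<le> B"
  shows "ip (elem (kernel_coeff a b \<Phi>)) (v k) = kernel_coeff a b \<Phi> k"
    and "norm (elem (kernel_coeff a b \<Phi>)) \<le> kernel_const * (b powr (\<rho> * \<epsilon>) - a powr (\<rho> * \<epsilon>)) * B"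
proof -
  have "summable (\<lambda>k. (norm (kernel_coeff a b \<Phi> k))\<^sup>2)"
    by (rule bounded_imp_summable[of _ "(kernel_const * (b powr (\<rho> * \<epsilon>) - a powr (\<rho> * \<epsilon>)) * B)\<^sup>2"])
      (use kernel_coeff_sum_le[OF assms, of "Suc _"] in \<open>auto simp: lessThan_Suc_atMost\<close>)
  then show coeff: "ip (elem (kernel_coeff a b \<Phi>)) (v k) = kernel_coeff a b \<Phi> k" for k
    by (rule coeff_elem)
  have "B \<ge> 0" by (rule order_trans[OF norm_ge_zero B[of a]]) (use ab in simp)
  moreover have "a powr (\<rho> * \<epsilon>) \<le> b powr (\<rho> * \<epsilon>)" using ab \<rho> \<epsilon> by (intro powr_mono2) auto
  ultimately show "norm (elem (kernel_coeff a b \<Phi>)) \<le> kernel_const * (b powr (\<rho> * \<epsilon>) - a powr (\<rho> * \<epsilon>)) * B"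
    using kernel_const_pos kernel_coeff_sum_le[OF assms] by (intro norm_le_coeffs) (auto simp: coeff)
qed

definition duhamel_coeff :: "nat \<Rightarrow> real \<Rightarrow> 's" where
  "duhamel_coeff k t = integral {0..t} (\<lambda>\<eta>. rk k \<eta> *\<^sub>R ip (f (t - \<eta>)) (v k))"

lemma duhamel_eq: "duhamel \<rho> (lam k) (\<lambda>t. ip (f t) (v k)) = duhamel_coeff k"
  by (simp add: fun_eq_iff duhamel_def duhamel_coeff_def relaxation.r_def[OF relax])

lemma omega_kernel_coeff:
  assumes "t \<in> {0..T}"
  shows "lam k *\<^sub>R duhamel_coeff k t = kernel_coeff 0 t (\<lambda>\<eta>. F (t - \<eta>)) k"
  unfolding duhamel_coeff_def kernel_coeff_def using assms
  by (intro arg_cong[where f = "\<lambda>x. lam k *\<^sub>R x"] integral_cong) (simp add: coeff_f)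

text \<open>The Duhamel integral after application of \<open>A\<close>, built from its coefficients
  before the integral itself. Square summability and continuity of the latter are deduced from this
  one, since the eigenvalues are bounded below.\<close>

definition Aw :: "real \<Rightarrow> 'h" where "Aw t = elem (kernel_coeff 0 t (\<lambda>\<eta>. F (t - \<eta>)))"

lemma continuous_F_shift: "t \<le> T \<Longrightarrow> 0 \<le> a \<Longrightarrow> b \<le> t \<Longrightarrow> continuous_on {a..b} (\<lambda>\<eta>. F (t - \<eta>))"
  by (rule continuous_on_compose2[OF continuous_F]) (auto intro!: continuous_intros)

lemma coeff_Aw:
  assumes "t \<in> {0..T}"
  shows "ip (Aw t) (v k) = lam k *\<^sub>R duhamel_coeff k t"
proof -
  obtain B where B: "\<And>t. t \<in> {0..T} \<Longrightarrow> norm (F t) \<le> B" using continuous_on_Icc_bounded[OF continuous_F] by metis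
  show ?thesis
    unfolding omega_kernel_coeff[OF assms] Aw_def
    by (rule kernel_coeff_elem[where B = B]) (use assms B continuous_F_shift in auto)
qed

text \<open>Splitting \<open>Aw t - Aw s\<close> into the integral over \<open>[0, s]\<close> of the increment of \<open>F\<close> and the integral over
  \<open>[s, t]\<close> avoids differences of the kernel.\<close>

lemma Aw_increment:
  assumes st: "0 \<le> s" "s \<le> t" "t \<le> T"
    and d: "\<And>\<eta>. \<eta> \<in> {0..s} \<Longrightarrow> norm (F (t - \<eta>) - F (s - \<eta>)) \<le> d"
    and B: "\<And>t. t \<in> {0..T} \<Longrightarrow> norm (F t) \<le> B"
  shows "norm (Aw t - Aw s) \<le> kernel_const * s powr (\<rho> * \<epsilon>) * d + kernel_const * (t powr (\<rho> * \<epsilon>) - s powr (\<rho> * \<epsilon>)) * B"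
proof -
  define \<Phi> where "\<Phi> \<eta> = F (t - \<eta>) - F (s - \<eta>)" for \<eta>
  define x1 where "x1 = elem (kernel_coeff 0 s \<Phi>)"
  define x2 where "x2 = elem (kernel_coeff s t (\<lambda>\<eta>. F (t - \<eta>)))"
  have \<Phi>: "continuous_on {0..s} \<Phi>"
    unfolding \<Phi>_def using st by (intro continuous_intros continuous_F_shift) auto
  have F2: "continuous_on {s..t} (\<lambda>\<eta>. F (t - \<eta>))" "continuous_on {0..t} (\<lambda>\<eta>. F (t - \<eta>))"
      "continuous_on {0..s} (\<lambda>\<eta>. F (t - \<eta>))" "continuous_on {0..s} (\<lambda>\<eta>. F (s - \<eta>))"
    using st by (auto intro!: continuous_F_shift)
  have x1: "ip x1 (v k) = kernel_coeff 0 s \<Phi> k" "norm x1 \<le> kernel_const * (s powr (\<rho> * \<epsilon>) - 0 powr (\<rho> * \<epsilon>)) * d" for k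
    unfolding x1_def using kernel_coeff_elem[of 0 s \<Phi> d] st d \<Phi> by (simp_all add: \<Phi>_def)
  have x2: "ip x2 (v k) = kernel_coeff s t (\<lambda>\<eta>. F (t - \<eta>)) k"
      "norm x2 \<le> kernel_const * (t powr (\<rho> * \<epsilon>) - s powr (\<rho> * \<epsilon>)) * B" for k
    unfolding x2_def using kernel_coeff_elem[of s t "\<lambda>\<eta>. F (t - \<eta>)" B] st B F2 by simp_all
  have "Aw t - Aw s = x1 + x2"
  proof (rule basis_eqI)
    fix k
    have int: "(\<lambda>\<eta>. rk k \<eta> *\<^sub>R (lam k powr (-\<epsilon>) *\<^sub>R ip (F (t' - \<eta>)) (v k))) integrable_on {a..b}"
      if "continuous_on {a..b} (\<lambda>\<eta>. F (t' - \<eta>))" "0 \<le> a" for a b t'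
      using that by (intro rk_integrable continuous_intros continuous_coeff) auto
    have "kernel_coeff 0 t (\<lambda>\<eta>. F (t - \<eta>)) k = kernel_coeff 0 s (\<lambda>\<eta>. F (t - \<eta>)) k + kernel_coeff s t (\<lambda>\<eta>. F (t - \<eta>)) k"
      unfolding kernel_coeff_def scaleR_add_right[symmetric]
      by (simp only: Henstock_Kurzweil_Integration.integral_combine[OF st(1,2) int[OF F2(2) order_refl]])
    moreover have "kernel_coeff 0 s \<Phi> k = kernel_coeff 0 s (\<lambda>\<eta>. F (t - \<eta>)) k - kernel_coeff 0 s (\<lambda>\<eta>. F (s - \<eta>)) k"
      by (simp only: kernel_coeff_def \<Phi>_def ip_diff scaleR_diff_right
          Henstock_Kurzweil_Integration.integral_diff[OF int[OF F2(3) order_refl] int[OF F2(4) order_refl]])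
    ultimately show "ip (Aw t - Aw s) (v k) = ip (x1 + x2) (v k)"
      using st by (simp add: ip_diff ip_add x1 x2 coeff_Aw omega_kernel_coeff)
  qed
  then show ?thesis using x1(2) x2(2) norm_triangle_ineq[of x1 x2] by simp
qed

text \<open>Uniform continuity of \<open>F\<close> handles the first term of
  \<open>Aw_increment\<close>, and that of \<open>t powr (\<rho> * \<epsilon>)\<close> the
  second.\<close>

lemma continuous_Aw: "continuous_on {0..T} Aw"
proof -
  obtain B where B: "0 < B" "\<And>t. t \<in> {0..T} \<Longrightarrow> norm (F t) \<le> B" using continuous_on_Icc_bounded[OF continuous_F] by metis
  have ucF: "uniformly_continuous_on {0..T} F"
    by (intro compact_uniformly_continuous continuous_F) auto
  have "uniformly_continuous_on {0..T} (\<lambda>t. t powr (\<rho> * \<epsilon>))"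
    using \<rho> \<epsilon> by (intro compact_uniformly_continuous continuous_on_powr' continuous_intros) auto
  note ucp = this
  have "\<exists>d>0. \<forall>s t. 0 \<le> s \<and> s \<le> t \<and> t \<le> T \<and> t - s < d \<longrightarrow> norm (Aw t - Aw s) < e" if e: "e > 0" for e
  proof -
    define M where "M = kernel_const"
    have M: "M > 0" using kernel_const_pos by (simp add: M_def)
    define e1 where "e1 = e / (2 * (M * (T powr (\<rho> * \<epsilon>) + 1)))"
    define e2 where "e2 = e / (2 * (M * B))"
    have pos: "0 < M * (T powr (\<rho> * \<epsilon>) + 1)" using M by (intro mult_pos_pos add_nonneg_pos) auto
    have e12: "e1 > 0" "e2 > 0" using e M B pos unfolding e1_def e2_def by (auto intro!: divide_pos_pos mult_pos_pos)
    obtain d1 where d1: "d1 > 0" "\<And>x y. x \<in> {0..T} \<Longrightarrow> y \<in> {0..T} \<Longrightarrow> dist y x < d1 \<Longrightarrow> dist (F y) (F x) < e1"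
      using ucF e12(1) unfolding uniformly_continuous_on_def by metis
    obtain d2 where d2: "d2 > 0" "\<And>x y. x \<in> {0..T} \<Longrightarrow> y \<in> {0..T} \<Longrightarrow> dist y x < d2 \<Longrightarrow>
        dist (y powr (\<rho> * \<epsilon>)) (x powr (\<rho> * \<epsilon>)) < e2"
      using ucp e12(2) unfolding uniformly_continuous_on_def by metis
    have "norm (Aw t - Aw s) < e" if st: "0 \<le> s" "s \<le> t" "t \<le> T" "t - s < min d1 d2" for s t
    proof -
      have "norm (Aw t - Aw s) \<le> M * s powr (\<rho> * \<epsilon>) * e1 + M * (t powr (\<rho> * \<epsilon>) - s powr (\<rho> * \<epsilon>)) * B"
        unfolding M_def
      proof (rule Aw_increment[OF st(1-3) _ B(2)])
        fix \<eta> assume "\<eta> \<in> {0..s}"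
        then have "dist (F (t - \<eta>)) (F (s - \<eta>)) < e1" using st by (intro d1(2)) (auto simp: dist_real_def)
        then show "norm (F (t - \<eta>) - F (s - \<eta>)) \<le> e1" by (simp add: dist_norm)
      qed
      also have "\<dots> < (M * (T powr (\<rho> * \<epsilon>) + 1)) * e1 + M * e2 * B"
      proof (rule add_le_less_mono)
        have "s powr (\<rho> * \<epsilon>) \<le> T powr (\<rho> * \<epsilon>) + 1"
          using powr_mono2[of "\<rho> * \<epsilon>" s T] st \<rho> \<epsilon> by simp
        then show "M * s powr (\<rho> * \<epsilon>) * e1 \<le> (M * (T powr (\<rho> * \<epsilon>) + 1)) * e1"
          using M e12 by (intro mult_right_mono mult_left_mono) auto
        have "t powr (\<rho> * \<epsilon>) - s powr (\<rho> * \<epsilon>) < e2"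
          using d2(2)[of s t] st by (auto simp: dist_real_def)
        then show "M * (t powr (\<rho> * \<epsilon>) - s powr (\<rho> * \<epsilon>)) * B < M * e2 * B"
          using M B by (intro mult_strict_right_mono mult_strict_left_mono) auto
      qed
      also have "(M * (T powr (\<rho> * \<epsilon>) + 1)) * e1 = e / 2"
      proof -
        have "P * (e / (2 * P)) = e / 2" if "0 < P" for P :: real using that by simp
        from this[OF pos] show ?thesis by (simp only: e1_def)
      qed
      also have "M * e2 * B = e / 2" unfolding e2_def using M B by simp
      finally show ?thesis by simp
    qed
    then show ?thesis using d1(1) d2(1) by (intro exI[of _ "min d1 d2"]) auto
  qed
  note unif = this
  show ?thesis
    unfolding continuous_on_iff
  proof (intro ballI allI impI)
    fix x e :: real assume x: "x \<in> {0..T}" and e: "e > 0"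
    obtain d where d: "d > 0" "\<And>s t. 0 \<le> s \<Longrightarrow> s \<le> t \<Longrightarrow> t \<le> T \<Longrightarrow> t - s < d \<Longrightarrow> norm (Aw t - Aw s) < e"
      using unif[OF e] by blast
    have "dist (Aw y) (Aw x) < e" if "y \<in> {0..T}" "dist y x < d" for y
      using d(2)[of x y] d(2)[of y x] x that
      by (cases "x \<le> y") (auto simp: dist_norm norm_minus_commute)
    then show "\<exists>d>0. \<forall>y\<in>{0..T}. dist y x < d \<longrightarrow> dist (Aw y) (Aw x) < e" using d(1) by blast
  qed
qed

section \<open>The Duhamel integral and its scalar equations\<close>

definition om :: "real \<Rightarrow> 'h" where "om t = elem (\<lambda>k. duhamel_coeff k t)"

lemma omega_le:
  assumes "t \<in> {0..T}"
  shows "norm (duhamel_coeff k t) \<le> 1 / lam 0 * norm (ip (Aw t) (v k))"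
proof -
  have "lam 0 * norm (duhamel_coeff k t) \<le> lam k * norm (duhamel_coeff k t)"
    using lam_ge by (intro mult_right_mono) auto
  also have "\<dots> = norm (ip (Aw t) (v k))" using lam_ge(2)[of k] by (simp add: coeff_Aw[OF assms])
  finally show ?thesis using lam_pos by (simp add: pos_le_divide_eq mult.commute)
qed

lemma coeff_om:
  assumes "t \<in> {0..T}"
  shows "ip (om t) (v k) = duhamel_coeff k t"
  unfolding om_def by (rule coeff_elem[OF summable_coeff_norms[OF omega_le[OF assms]]])

lemma continuous_om: "continuous_on {0..T} om"
proof (rule continuous_on_coeff_norms[OF continuous_Aw])
  fix s t k assume st: "s \<in> {0..T}" "t \<in> {0..T}"
  have "lam 0 * norm (duhamel_coeff k s - duhamel_coeff k t) \<le> lam k * norm (duhamel_coeff k s - duhamel_coeff k t)"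
    using lam_ge by (intro mult_right_mono) auto
  also have "\<dots> = norm (ip (Aw s - Aw t) (v k))"
    using lam_ge(2)[of k]
    by (simp add: ip_diff coeff_Aw[OF st(1)] coeff_Aw[OF st(2)] flip: scaleR_diff_right)
  also have "duhamel_coeff k s - duhamel_coeff k t = ip (om s - om t) (v k)"
    by (simp only: ip_diff coeff_om[OF st(1)] coeff_om[OF st(2)])
  finally show "norm (ip (om s - om t) (v k)) \<le> 1 / lam 0 * norm (ip (Aw s - Aw t) (v k))"
    using lam_pos by (simp add: pos_le_divide_eq mult.commute)
qed (use lam_pos in simp)

lemma continuous_omega: "continuous_on {0..T} (duhamel_coeff k)"
  by (rule continuous_on_eq[OF continuous_coeff[OF continuous_om] coeff_om])

lemma omega_0 [simp]: "duhamel_coeff k 0 = 0"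
  by (simp add: duhamel_coeff_def)

lemma omega_inner:
  assumes "t \<in> {0..T}"
  shows "duhamel_coeff k t \<bullet> b = integral {0..t} (\<lambda>\<eta>. rk k \<eta> * (ip (f (t - \<eta>)) (v k) \<bullet> b))"
proof -
  have "continuous_on {0..t} (\<lambda>\<eta>. f (t - \<eta>))"
    by (rule continuous_on_compose2[OF continuous_f]) (use assms in \<open>auto intro!: continuous_intros\<close>)
  then have "(\<lambda>\<eta>. rk k \<eta> *\<^sub>R ip (f (t - \<eta>)) (v k)) integrable_on {0..t}"
    by (intro rk_integrable continuous_coeff) simp
  from integral_linear[OF this bounded_linear_inner_left[of b]] show ?thesis
    by (simp add: duhamel_coeff_def o_def)
qed

lemma omega_volterra:
  assumes t: "0 < t" "t \<le> T"
  shows "Gamma \<rho> * (duhamel_coeff k t \<bullet> b) =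
    integral {0..t} (\<lambda>s. (t - s) powr (\<rho> - 1) * (ip (f s) (v k) \<bullet> b - lam k * (duhamel_coeff k s \<bullet> b)))"
proof -
  have g: "continuous_on {0..t} (\<lambda>s. ip (f s) (v k) \<bullet> b)"
    by (intro continuous_intros continuous_coeff continuous_on_subset[OF continuous_f]) (use t in auto)
  have "Gamma \<rho> * (duhamel_coeff k t \<bullet> b) = integral {0..t} (\<lambda>s. (t - s) powr (\<rho> - 1) * (ip (f s) (v k) \<bullet> b -
      lam k * integral {0..s} (\<lambda>\<eta>. rk k \<eta> * (ip (f (s - \<eta>)) (v k) \<bullet> b))))"
    using relaxation.duhamel_volterra[OF relax t(1) g, of k] t by (simp add: omega_inner)
  also have "\<dots> = integral {0..t} (\<lambda>s. (t - s) powr (\<rho> - 1) * (ip (f s) (v k) \<bullet> b - lam k * (duhamel_coeff k s \<bullet> b)))"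
    by (rule integral_cong) (use t in \<open>simp add: omega_inner\<close>)
  finally show ?thesis .
qed

lemma caputo_omega:
  assumes t: "0 < t" "t \<le> T"
  shows "has_caputo_derivative \<rho> (\<lambda>s. duhamel_coeff k s \<bullet> b) (ip (f t) (v k) \<bullet> b - lam k * (duhamel_coeff k t \<bullet> b)) t"
proof (rule caputo_fractional_integral_real[OF \<rho> t(1)])
  have w: "continuous_on {0..t} (duhamel_coeff k)" "continuous_on {0..t} (\<lambda>s. ip (f s) (v k))"
    using continuous_on_subset[OF continuous_omega, of "{0..t}"]
      continuous_coeff[OF continuous_on_subset[OF continuous_f, of "{0..t}"]] t by auto
  show "continuous_on {0..t} (\<lambda>s. duhamel_coeff k s \<bullet> b)" by (intro continuous_intros w)
  show "continuous_on {0..t} (\<lambda>s. ip (f s) (v k) \<bullet> b - lam k * (duhamel_coeff k s \<bullet> b))"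
    by (intro continuous_intros w)
qed (use t omega_volterra in simp)

text \<open>Taking a real component of a coefficient is a bounded linear map, so it commutes with
  the Caputo derivative, while \<open>A\<close> becomes multiplication by \<open>lam k\<close>. The
  difference of the two sides then solves a homogeneous scalar equation with initial value
  0.\<close>

lemma scalar_solution_unique:
  assumes u: "continuous_on {0..T} u"
    and d: "\<And>t. 0 < t \<Longrightarrow> t \<le> T \<Longrightarrow> u t \<in> D \<and> has_caputo_derivative \<rho> u (f t - A (u t)) t"
    and t: "t \<in> {0..T}"
  shows "ip (u t) (v k) = ek k t *\<^sub>R ip (u 0) (v k) + duhamel_coeff k t"
proof (rule euclidean_eqI)
  fix b :: 's assume "b \<in> Basis"
  define c where "c = ip (u 0) (v k) \<bullet> b"
  define y where "y s = ip (u s) (v k) \<bullet> b" for s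
  define z where "z s = y s - duhamel_coeff k s \<bullet> b - c * ek k s" for s
  have lin: "bounded_linear (\<lambda>x. ip x (v k) \<bullet> b)"
    by (rule bounded_linear_compose[OF bounded_linear_inner_left bounded_linear_ip])
  have y: "continuous_on {0..T} y" unfolding y_def by (rule bounded_linear.continuous_on[OF lin u])
  have w: "continuous_on {0..T} (\<lambda>s. duhamel_coeff k s \<bullet> b)" by (intro continuous_intros continuous_omega)
  have yw: "continuous_on {0..T} (\<lambda>s. y s - duhamel_coeff k s \<bullet> b)" by (intro continuous_on_diff y w)
  have e: "continuous_on {0..T} (ek k)" by (rule relaxation.continuous_e[OF relax])
  have ce: "continuous_on {0..T} (\<lambda>s. c * ek k s)" by (intro continuous_on_mult continuous_on_const e)
  have "z t = 0"
  proof (rule caputo_unique_zero[where T = T and l = "lam k" and z = z and s = t, OF _ \<rho> lam_ge(2)])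
    show "continuous_on {0..T} z" unfolding z_def by (intro continuous_on_diff yw ce)
    show "z 0 = 0" by (simp add: z_def y_def c_def relaxation.e_0[OF relax])
    fix s assume s: "0 < s" "s \<le> T"
    have sub: "{0..s} \<subseteq> {0..T}" using s by auto
    have "has_caputo_derivative \<rho> y (ip (f s - A (u s)) (v k) \<bullet> b) s"
      unfolding y_def using d[OF s] by (intro has_caputo_derivative_linear[OF lin continuous_on_subset[OF u sub] \<rho> s(1)]) simp
    then have "has_caputo_derivative \<rho> y (ip (f s) (v k) \<bullet> b - lam k * y s) s"
      using d[OF s] by (simp add: ip_diff coeff_A y_def inner_diff_left flip: scaleR_conv_of_real)
    from has_caputo_derivative_diff[OF continuous_on_subset[OF y sub] continuous_on_subset[OF w sub] \<rho> s(1) this caputo_omega[OF s]]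
    have 1: "has_caputo_derivative \<rho> (\<lambda>s. y s - duhamel_coeff k s \<bullet> b) (- lam k * (y s - duhamel_coeff k s \<bullet> b)) s"
      by (simp add: algebra_simps)
    have 2: "has_caputo_derivative \<rho> (\<lambda>s. c * ek k s) (c * (- lam k * ek k s)) s"
      by (rule has_caputo_derivative_linear[OF bounded_linear_mult_right relaxation.continuous_e[OF relax] \<rho> s(1)
            relaxation.caputo_e[OF relax s(1)]])
    from has_caputo_derivative_diff[OF continuous_on_subset[OF yw sub] continuous_on_subset[OF ce sub] \<rho> s(1) 1 2]
    show "has_caputo_derivative \<rho> z (- lam k * z s) s"
      unfolding z_def by (simp add: algebra_simps)
  qed (use t in auto)
  then show "ip (u t) (v k) \<bullet> b = (ek k t *\<^sub>R ip (u 0) (v k) + duhamel_coeff k t) \<bullet> b"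
    by (simp add: z_def y_def c_def inner_add_left mult.commute)
qed

section \<open>Mild solutions with initial value \<open>c\<close> in \<open>H\<close>\<close>

definition mild :: "'h \<Rightarrow> real \<Rightarrow> 'h" where
  "mild c t = elem (\<lambda>k. ek k t *\<^sub>R ip c (v k)) + om t"

text \<open>The factor \<open>t powr \<rho>\<close> makes the coefficients of the series bounded uniformly in \<open>t\<close>.\<close>

definition A_mild :: "'h \<Rightarrow> real \<Rightarrow> 'h" where
  "A_mild c t = t powr (-\<rho>) *\<^sub>R elem (\<lambda>k. (lam k * t powr \<rho> * ek k t) *\<^sub>R ip c (v k)) + Aw t"

lemma ek_bounds: "0 \<le> t \<Longrightarrow> 0 < ek k t" "0 \<le> t \<Longrightarrow> ek k t \<le> 1"
    "0 < t \<Longrightarrow> \<bar>lam k * t powr \<rho> * ek k t\<bar> \<le> \<rho> * Gamma \<rho>"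
  using relaxation.e_pos[OF relax, of t k] relaxation.e_le_1[OF relax, of t k] relaxation.e_upper[OF relax, of t k]
    lam_ge(2)[of k]
  by (auto simp: abs_mult)

lemma coeff_e_elem:
  "0 \<le> t \<Longrightarrow> ip (elem (\<lambda>k. ek k t *\<^sub>R ip c (v k))) (v j) = ek j t *\<^sub>R ip c (v j)"
  "0 < t \<Longrightarrow> ip (elem (\<lambda>k. (lam k * t powr \<rho> * ek k t) *\<^sub>R ip c (v k))) (v j) =
    (lam j * t powr \<rho> * ek j t) *\<^sub>R ip c (v j)"
proof -
  assume "0 \<le> t"
  then show "ip (elem (\<lambda>k. ek k t *\<^sub>R ip c (v k))) (v j) = ek j t *\<^sub>R ip c (v j)"
    using ek_bounds(1,2)[of t]
    by (intro coeff_elem summable_coeff_norms[where y = c and C = 1]) (simp add: abs_of_pos mult_left_le_one_le less_imp_le)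
next
  assume "0 < t"
  then show "ip (elem (\<lambda>k. (lam k * t powr \<rho> * ek k t) *\<^sub>R ip c (v k))) (v j) =
      (lam j * t powr \<rho> * ek j t) *\<^sub>R ip c (v j)"
    by (intro coeff_elem summable_coeff_norms[where y = c and C = "\<rho> * Gamma \<rho>"])
      (simp only: norm_scaleR, intro mult_right_mono ek_bounds(3), auto)
qed

lemma coeff_mild: "t \<in> {0..T} \<Longrightarrow> ip (mild c t) (v k) = ek k t *\<^sub>R ip c (v k) + duhamel_coeff k t"
  by (simp add: mild_def ip_add coeff_e_elem coeff_om)

lemma coeff_A_mild:
  assumes "0 < t" "t \<le> T"
  shows "ip (A_mild c t) (v k) = lam k *\<^sub>R ip (mild c t) (v k)"
proof -
  have "ip (A_mild c t) (v k) = t powr (-\<rho>) *\<^sub>R (lam k * t powr \<rho> * ek k t) *\<^sub>R ip c (v k) + lam k *\<^sub>R duhamel_coeff k t"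
    unfolding A_mild_def ip_add ip_scaleR using assms
    by (simp only: coeff_e_elem(2)[OF assms(1)] coeff_Aw[of t k] atLeastAtMost_iff less_imp_le)
  moreover have "t powr (-\<rho>) * (lam k * t powr \<rho> * ek k t) = lam k * ek k t"
    using assms by (simp add: powr_minus)
  ultimately show ?thesis
    using assms by (simp add: coeff_mild scaleR_add_right)
qed

lemma continuous_mild: "continuous_on {0..T} (mild c)"
  unfolding mild_def
proof (intro continuous_on_add continuous_om continuous_on_fourier)
  show "summable (\<lambda>k. (norm (ip c (v k)))\<^sup>2)" by (rule bessel)
  show "continuous_on {0..T} (\<lambda>t. ip (elem (\<lambda>k. ek k t *\<^sub>R ip c (v k))) (v k))" for k
    by (rule continuous_on_eq[OF continuous_on_scaleR[OF relaxation.continuous_e[OF relax] continuous_on_const]])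
      (simp add: coeff_e_elem)
  show "norm (ip (elem (\<lambda>k. ek k t *\<^sub>R ip c (v k))) (v k)) \<le> norm (ip c (v k))" if "t \<in> {0..T}" for t k
    using that ek_bounds(1,2)[of t k] by (simp add: coeff_e_elem mult_left_le_one_le less_imp_le)
qed

lemma continuous_A_mild: "continuous_on {0<..T} (A_mild c)"
  unfolding A_mild_def
proof (intro continuous_on_add continuous_on_scaleR)
  show "continuous_on {0<..T} (\<lambda>t. t powr (-\<rho>))" by (intro continuous_intros) auto
  show "continuous_on {0<..T} Aw" by (rule continuous_on_subset[OF continuous_Aw]) auto
  show "continuous_on {0<..T} (\<lambda>t. elem (\<lambda>k. (lam k * t powr \<rho> * ek k t) *\<^sub>R ip c (v k)))"
  proof (rule continuous_on_fourier)
    show "summable (\<lambda>k. (\<rho> * Gamma \<rho> * norm (ip c (v k)))\<^sup>2)"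
      unfolding power_mult_distrib by (intro summable_mult bessel)
    show "continuous_on {0<..T} (\<lambda>t. ip (elem (\<lambda>k. (lam k * t powr \<rho> * ek k t) *\<^sub>R ip c (v k))) (v k))" for k
    proof -
      have "continuous_on {0<..T} (ek k)"
        by (rule continuous_on_subset[OF relaxation.continuous_e[OF relax, of T]]) auto
      then have "continuous_on {0<..T} (\<lambda>t. (lam k * t powr \<rho> * ek k t) *\<^sub>R ip c (v k))"
        by (intro continuous_intros) auto
      then show ?thesis by (rule continuous_on_eq) (simp add: coeff_e_elem)
    qed
    show "norm (ip (elem (\<lambda>k. (lam k * t powr \<rho> * ek k t) *\<^sub>R ip c (v k))) (v k)) \<le> \<rho> * Gamma \<rho> * norm (ip c (v k))"
      if "t \<in> {0<..T}" for t k
      using that by (simp only: coeff_e_elem(2) greaterThanAtMost_iff norm_scaleR) (intro mult_right_mono ek_bounds(3), auto)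
  qed
qed

lemma mild_domain:
  assumes "0 < t" "t \<le> T"
  shows "mild c t \<in> D" "A (mild c t) = A_mild c t"
proof -
  have "(lam k * norm (ip (mild c t) (v k)))\<^sup>2 = (norm (ip (A_mild c t) (v k)))\<^sup>2" for k
    using lam_ge(2)[of k] by (simp add: coeff_A_mild[OF assms] abs_mult)
  then have "summable (\<lambda>k. (lam k * norm (ip (mild c t) (v k)))\<^sup>2)" by (simp add: bessel)
  from in_domainI[OF this] show "mild c t \<in> D" "A (mild c t) = A_mild c t"
    using elem_coeffs[of "A_mild c t"] by (simp_all add: coeff_A_mild[OF assms] scaleR_conv_of_real)
qed

text \<open>The singular bound that the inversion theorem asks for. As \<open>c\<close> need not lie
  in \<open>D\<close>, the blow-up at 0 cannot be excluded; its rate comes from the uniform bound on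
  \<open>lam k * t powr \<rho> * ek k t\<close>.\<close>

lemma norm_A_mild: "\<exists>C. \<forall>t. 0 < t \<longrightarrow> t \<le> T \<longrightarrow> norm (f t - A_mild c t) \<le> C * t powr (-\<rho>)"
proof -
  obtain B where B: "0 < B" "\<And>t. t \<in> {0..T} \<Longrightarrow> norm (f t - Aw t) \<le> B"
    using continuous_on_Icc_bounded[OF continuous_on_diff[OF continuous_f continuous_Aw]] by metis
  have "norm (f t - A_mild c t) \<le> (B * T powr \<rho> + \<rho> * Gamma \<rho> * norm c) * t powr (-\<rho>)" if t: "0 < t" "t \<le> T" for t
  proof -
    define x where "x = elem (\<lambda>k. (lam k * t powr \<rho> * ek k t) *\<^sub>R ip c (v k))"
    have "norm x \<le> \<rho> * Gamma \<rho> * norm c"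
    proof (rule norm_le_coeff_norms)
      show "norm (ip x (v k)) \<le> \<rho> * Gamma \<rho> * norm (ip c (v k))" for k
        unfolding x_def using t by (simp only: coeff_e_elem(2) norm_scaleR) (intro mult_right_mono ek_bounds(3), auto)
    qed (use \<rho> Gamma_real_pos[OF \<rho>(1)] in simp)
    then have 1: "norm (t powr (-\<rho>) *\<^sub>R x) \<le> \<rho> * Gamma \<rho> * norm c * t powr (-\<rho>)"
      using mult_right_mono[of "norm x" "\<rho> * Gamma \<rho> * norm c" "t powr (-\<rho>)"] by (simp add: mult.commute)
    have 2: "norm (f t - Aw t) \<le> B * T powr \<rho> * t powr (-\<rho>)"
      using B(1) B(2)[of t] t \<rho> by (intro bound_by_powr_minus) auto
    have "norm (f t - A_mild c t) = norm ((f t - Aw t) - t powr (-\<rho>) *\<^sub>R x)"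
      by (simp add: A_mild_def x_def algebra_simps)
    also have "\<dots> \<le> B * T powr \<rho> * t powr (-\<rho>) + \<rho> * Gamma \<rho> * norm c * t powr (-\<rho>)"
      by (rule order_trans[OF norm_triangle_ineq4 add_mono[OF 2 1]])
    finally show ?thesis by (simp add: distrib_right)
  qed
  then show ?thesis by blast
qed

text \<open>Superposition of the Volterra equations of \<open>ek k\<close> and of the Duhamel
  coefficient. The formula for \<open>A_mild\<close> holds at positive times, so the point 0 is
  dropped as a null set.\<close>

lemma mild_volterra:
  assumes t: "0 < t" "t \<le> T"
  shows "((\<lambda>s. (t - s) powr (\<rho> - 1) * (ip (f s - A_mild c s) (v k) \<bullet> b)) has_integral
    Gamma \<rho> * (ip (mild c t) (v k) \<bullet> b - ip (mild c 0) (v k) \<bullet> b)) {0..t}"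
proof -
  define a where "a = ip c (v k) \<bullet> b"
  define g where "g s = ip (f s) (v k) \<bullet> b - lam k * (duhamel_coeff k s \<bullet> b)" for s
  have "continuous_on {0..t} g"
    unfolding g_def
    by (intro continuous_intros continuous_coeff continuous_on_subset[OF continuous_f] continuous_on_subset[OF continuous_omega])
      (use t in auto)
  then have "(\<lambda>s. (t - s) powr (\<rho> - 1) * g s) integrable_on {0..t}"
    by (rule relaxation.powr_mult_integrable[OF relax t(1)])
  then have 1: "((\<lambda>s. (t - s) powr (\<rho> - 1) * g s) has_integral Gamma \<rho> * (duhamel_coeff k t \<bullet> b)) {0..t}"
    using omega_volterra[OF t, of k b] by (simp add: has_integral_iff g_def)
  have 2: "((\<lambda>s. lam k * a * ((t - s) powr (\<rho> - 1) * ek k s)) has_integral lam k * a * (Gamma \<rho> * ((1 - ek k t) / lam k))) {0..t}"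
    by (rule has_integral_mult_right[OF relaxation.e_volterra[OF relax t(1)]])
  have "((\<lambda>s. (t - s) powr (\<rho> - 1) * (ip (f s - A_mild c s) (v k) \<bullet> b)) has_integral
      Gamma \<rho> * (duhamel_coeff k t \<bullet> b) - lam k * a * (Gamma \<rho> * ((1 - ek k t) / lam k))) {0..t}"
    using has_integral_diff[OF 1 2]
  proof (rule has_integral_spike[rotated 2, where S = "{0}"])
    fix s assume s: "s \<in> {0..t} - {0}"
    then have "ip (A_mild c s) (v k) \<bullet> b = lam k * (ek k s * a + duhamel_coeff k s \<bullet> b)"
      using t by (simp add: coeff_A_mild coeff_mild inner_add_left a_def)
    then show "(t - s) powr (\<rho> - 1) * (ip (f s - A_mild c s) (v k) \<bullet> b) =
        (t - s) powr (\<rho> - 1) * g s - lam k * a * ((t - s) powr (\<rho> - 1) * ek k s)"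
      by (simp add: ip_diff inner_diff_left g_def algebra_simps)
  qed auto
  moreover have "Gamma \<rho> * (duhamel_coeff k t \<bullet> b) - lam k * a * (Gamma \<rho> * ((1 - ek k t) / lam k)) =
      Gamma \<rho> * (ip (mild c t) (v k) \<bullet> b - ip (mild c 0) (v k) \<bullet> b)"
  proof -
    have "lam k * a * (Gamma \<rho> * ((1 - ek k t) / lam k)) = Gamma \<rho> * ((1 - ek k t) * a)"
      using lam_ge(2)[of k] by simp
    moreover have "ip (mild c t) (v k) \<bullet> b - ip (mild c 0) (v k) \<bullet> b = duhamel_coeff k t \<bullet> b - (1 - ek k t) * a"
      using t by (simp add: coeff_mild inner_add_left a_def relaxation.e_0[OF relax] algebra_simps)
    ultimately show ?thesis by (simp only: right_diff_distrib)
  qed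
  ultimately show ?thesis by (simp only:)
qed

text \<open>A coordinate functional involves finitely many coefficients, so its Volterra equation is
  a finite sum of scalar ones. The passage to the infinite series is left to the norming property,
  and no series is differentiated termwise.\<close>

lemma caputo_mild:
  assumes t: "0 < t" "t \<le> T"
  shows "has_caputo_derivative \<rho> (mild c) (f t - A_mild c t) t"
proof -
  obtain C where C: "\<And>s. 0 < s \<Longrightarrow> s \<le> T \<Longrightarrow> norm (f s - A_mild c s) \<le> C * s powr (-\<rho>)"
    using norm_A_mild by blast
  show ?thesis
  proof (rule caputo_fractional_integral[where g = "\<lambda>s. f s - A_mild c s" and C = C and \<Lambda> = coordinate_functionals, OF \<rho> t(1)])
    show "continuous_on {0..t} (mild c)" by (rule continuous_on_subset[OF continuous_mild]) (use t in auto)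
    show "continuous_on {0<..t} (\<lambda>s. f s - A_mild c s)"
      by (intro continuous_on_diff continuous_on_subset[OF continuous_f] continuous_on_subset[OF continuous_A_mild]) (use t in auto)
    fix l \<tau> assume l: "l \<in> coordinate_functionals" and \<tau>: "0 \<le> \<tau>" "\<tau> \<le> t"
    obtain n w where lw: "l = (\<lambda>x. \<Sum>(k, b)\<in>{..<n} \<times> Basis. w k b * (ip x (v k) \<bullet> b))"
      using l by (auto simp: coordinate_functionals_def)
    show "Gamma \<rho> * (l (mild c \<tau>) - l (mild c 0)) = integral {0..\<tau>} (\<lambda>s. (\<tau> - s) powr (\<rho> - 1) * l (f s - A_mild c s))"
    proof (cases "\<tau> = 0")
      case False
      then have \<tau>0: "0 < \<tau>" "\<tau> \<le> T" using \<tau> t by auto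
      have "((\<lambda>s. \<Sum>i\<in>{..<n} \<times> Basis. w (fst i) (snd i) * ((\<tau> - s) powr (\<rho> - 1) * (ip (f s - A_mild c s) (v (fst i)) \<bullet> snd i)))
          has_integral (\<Sum>i\<in>{..<n} \<times> Basis. w (fst i) (snd i) * (Gamma \<rho> *
            (ip (mild c \<tau>) (v (fst i)) \<bullet> snd i - ip (mild c 0) (v (fst i)) \<bullet> snd i)))) {0..\<tau>}"
        by (intro has_integral_sum has_integral_mult_right mild_volterra \<tau>0) auto
      from integral_unique[OF this] show ?thesis
        by (simp add: lw case_prod_beta sum_distrib_left right_diff_distrib mult.left_commute flip: sum_subtractf)
    qed simp
  qed (use C t coordinate_functionals_norming coordinate_functional_le bounded_linear_coordinate_functional in auto)
qed

section \<open>The conditions at the two interior times\<close>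

lemma duhamel_coeff_zero:
  assumes "\<And>s. s \<in> {0<..T} \<Longrightarrow> ip (f s) (v k) = 0" "t \<in> {0..T}"
  shows "duhamel_coeff k t = 0"
proof -
  have "duhamel_coeff k t = integral {0..t} (\<lambda>\<eta>. 0)"
    \<comment> \<open>Orthogonality is known at positive times, whereas \<open>\<eta> = t\<close>
      evaluates \<open>f\<close> at 0; this single point is dropped.\<close>
    unfolding duhamel_coeff_def by (rule integral_spike[of "{t}"]) (use assms in auto)
  then show ?thesis by simp
qed

text \<open>By \<open>e_upper\<close>, \<open>lam k * \<xi> powr \<rho> * \<alpha>\<close> is
  bounded on the set, while the eigenvalues tend to infinity. Finiteness gives the resonant sum in
  the solution formula its meaning.\<close>

lemma finite_resonant:
  assumes "0 < \<alpha>" "0 < \<xi>"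
  shows "finite {k. ek k \<xi> = \<alpha>}"
proof -
  define B where "B = \<rho> * Gamma \<rho> / (\<xi> powr \<rho> * \<alpha>)"
  have "eventually (\<lambda>k. B < lam k) sequentially" using lam_lim by (simp add: filterlim_at_top_dense)
  then obtain N where N: "\<And>k. k \<ge> N \<Longrightarrow> B < lam k" by (auto simp: eventually_sequentially)
  have "k < N" if "ek k \<xi> = \<alpha>" for k
  proof (rule ccontr)
    assume "\<not> k < N"
    then have "B < lam k" using N by simp
    moreover have "lam k * \<xi> powr \<rho> * \<alpha> \<le> \<rho> * Gamma \<rho>"
      using ek_bounds(3)[OF assms(2), of k] that by simp
    then have "lam k \<le> B" using assms by (simp add: B_def pos_le_divide_eq mult.assoc)
    ultimately show False by simp
  qed
  then have "{k. ek k \<xi> = \<alpha>} \<subseteq> {..<N}" by auto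
  then show ?thesis by (rule finite_subset) simp
qed

text \<open>The last two identities express \<open>u 0\<close>, and through it
  \<open>\<phi>\<close>, by the data alone. Uniqueness and the series representations are both read
  off from here.\<close>

lemma nonlocal_solution_coeff:
  assumes sol: "nonlocal_solution D A \<rho> T \<alpha> \<xi>\<^sub>0 \<xi>\<^sub>2 f W u \<phi>"
    and \<xi>: "0 < \<xi>\<^sub>0" "\<xi>\<^sub>0 \<le> T" "0 < \<xi>\<^sub>2" "\<xi>\<^sub>2 \<le> T"
  shows "t \<in> {0..T} \<Longrightarrow> ip (u t) (v k) = ek k t *\<^sub>R ip (u 0) (v k) + duhamel_coeff k t"
    and "ip (u 0) (v k) = (1 / ek k \<xi>\<^sub>2) *\<^sub>R (ip W (v k) - duhamel_coeff k \<xi>\<^sub>2)"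
    and "ip \<phi> (v k) = (ek k \<xi>\<^sub>0 - \<alpha>) *\<^sub>R ip (u 0) (v k) + duhamel_coeff k \<xi>\<^sub>0"
proof -
  obtain Du where Du: "\<And>t. t \<in> {0<..T} \<Longrightarrow> has_caputo_derivative \<rho> u (Du t) t \<and> Du t + A (u t) = f t"
    using sol unfolding nonlocal_solution_def by blast
  have u: "continuous_on {0..T} u" "\<And>t. t \<in> {0<..T} \<Longrightarrow> u t \<in> D" "u \<xi>\<^sub>0 = \<alpha> *\<^sub>R u 0 + \<phi>" "u \<xi>\<^sub>2 = W"
    using sol unfolding nonlocal_solution_def by blast+
  have "u t \<in> D \<and> has_caputo_derivative \<rho> u (f t - A (u t)) t" if "0 < t" "t \<le> T" for t
  proof -
    have "Du t = f t - A (u t)" using Du[of t] that by (simp add: eq_diff_eq)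
    then show ?thesis using Du[of t] u(2)[of t] that by simp
  qed
  note coeff = scalar_solution_unique[OF u(1) this]
  show "t \<in> {0..T} \<Longrightarrow> ip (u t) (v k) = ek k t *\<^sub>R ip (u 0) (v k) + duhamel_coeff k t"
    by (rule coeff)
  have "ek k \<xi>\<^sub>2 > 0" by (rule ek_bounds) (use \<xi> in simp)
  then show "ip (u 0) (v k) = (1 / ek k \<xi>\<^sub>2) *\<^sub>R (ip W (v k) - duhamel_coeff k \<xi>\<^sub>2)"
    using coeff[of \<xi>\<^sub>2 k] \<xi> by (simp add: u(4))
  have "\<phi> = u \<xi>\<^sub>0 - \<alpha> *\<^sub>R u 0" using u(3) by simp
  then show "ip \<phi> (v k) = (ek k \<xi>\<^sub>0 - \<alpha>) *\<^sub>R ip (u 0) (v k) + duhamel_coeff k \<xi>\<^sub>0"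
    using coeff[of \<xi>\<^sub>0 k] \<xi> by (simp add: ip_diff ip_scaleR scaleR_diff_left)
qed

lemma nonlocal_solution_exists:
  assumes \<xi>: "0 < \<xi>\<^sub>0" "\<xi>\<^sub>0 \<le> T" "0 < \<xi>\<^sub>2" "\<xi>\<^sub>2 \<le> T" and W: "W \<in> D"
  shows "\<exists>u \<phi>. nonlocal_solution D A \<rho> T \<alpha> \<xi>\<^sub>0 \<xi>\<^sub>2 f W u \<phi>"
proof -
  have \<xi>2: "\<xi>\<^sub>2 \<in> {0..T}" using \<xi> by simp
  define a where "a k = (1 / ek k \<xi>\<^sub>2) *\<^sub>R (ip W (v k) - duhamel_coeff k \<xi>\<^sub>2)" for k
  \<comment> \<open>\<open>e_lower\<close> gives \<open>1 / ek k t \<le> 1 + Gamma (1 - \<rho>) *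
    lam k * t powr \<rho>\<close> at the second time; the summand 1 is at most
    \<open>lam k / lam 0\<close>, which explains \<open>1 / lam 0\<close>.\<close>
  define C where "C = 1 / lam 0 + Gamma (1 - \<rho>) * \<xi>\<^sub>2 powr \<rho>"
  have e: "ek k \<xi>\<^sub>2 > 0" for k by (rule ek_bounds) (use \<xi> in simp)
  \<comment> \<open>The factor \<open>lam k\<close> lost by dividing by \<open>ek k\<close> is
    absorbed into the coefficients of \<open>A W\<close> minus the image of the Duhamel integral, an
    element of \<open>H\<close>.\<close>
  have a_le: "norm (a k) \<le> C * norm (ip (A W - Aw \<xi>\<^sub>2) (v k))" for k
  proof -
    have "1 / ek k \<xi>\<^sub>2 \<le> 1 + Gamma (1 - \<rho>) * lam k * \<xi>\<^sub>2 powr \<rho>"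
      using relaxation.e_lower[OF relax \<xi>(3), of k] e[of k] by (simp add: pos_divide_le_eq mult.commute)
    also have "\<dots> \<le> C * lam k"
      using lam_ge[of k] lam_pos by (simp add: C_def distrib_right field_simps)
    finally have "1 / ek k \<xi>\<^sub>2 * norm (ip W (v k) - duhamel_coeff k \<xi>\<^sub>2) \<le> C * lam k * norm (ip W (v k) - duhamel_coeff k \<xi>\<^sub>2)"
      by (rule mult_right_mono) simp
    moreover have "ip (A W - Aw \<xi>\<^sub>2) (v k) = lam k *\<^sub>R (ip W (v k) - duhamel_coeff k \<xi>\<^sub>2)"
      by (simp add: ip_diff coeff_A[OF W] coeff_Aw[OF \<xi>2] scaleR_diff_right) (simp add: scaleR_conv_of_real)
    ultimately show ?thesis using e[of k] lam_ge(2)[of k] by (simp add: a_def)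
  qed
  define c where "c = elem a"
  have c: "ip c (v k) = a k" for k
    unfolding c_def by (rule coeff_elem[OF summable_coeff_norms[OF a_le]])
  define u where "u = mild c"
  have "u \<xi>\<^sub>2 = W"
  proof (rule basis_eqI)
    show "ip (u \<xi>\<^sub>2) (v k) = ip W (v k)" for k
      using e[of k] by (simp add: u_def coeff_mild[OF \<xi>2] c a_def)
  qed
  moreover have "continuous_on {0..T} u" unfolding u_def by (rule continuous_mild)
  moreover have "\<forall>t\<in>{0<..T}. u t \<in> D" unfolding u_def by (auto intro: mild_domain)
  moreover have Au: "continuous_on {0<..T} (\<lambda>t. A (u t))"
    by (rule continuous_on_eq[OF continuous_A_mild[of c]]) (simp add: u_def mild_domain)
  moreover have "continuous_on {0<..T} (\<lambda>t. f t - A (u t))"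
    by (intro continuous_on_diff Au continuous_on_subset[OF continuous_f]) auto
  moreover have "\<forall>t\<in>{0<..T}. has_caputo_derivative \<rho> u (f t - A (u t)) t"
    using caputo_mild by (simp add: u_def mild_domain)
  \<comment> \<open>The initial value was chosen for the condition at the second time; the condition
    at the first time is met by taking it as the definition of \<open>\<phi>\<close>.\<close>
  ultimately have "nonlocal_solution D A \<rho> T \<alpha> \<xi>\<^sub>0 \<xi>\<^sub>2 f W u (u \<xi>\<^sub>0 - \<alpha> *\<^sub>R u 0)"
    unfolding nonlocal_solution_def by (auto intro!: exI[of _ "\<lambda>t. f t - A (u t)"])
  then show ?thesis by blast
qed

end

theorem theorem1p4:
  fixes scl :: "'s::scalar_field \<Rightarrow> 'h::banach \<Rightarrow> 'h" and ip :: "'h \<Rightarrow> 'h \<Rightarrow> 's"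
    and D :: "'h set" and A :: "'h \<Rightarrow> 'h" and lam :: "nat \<Rightarrow> real" and v :: "nat \<Rightarrow> 'h"
    and \<rho> T \<xi>\<^sub>0 \<xi>\<^sub>2 \<alpha> \<epsilon> :: real and W :: 'h and f :: "real \<Rightarrow> 'h"
    and K\<^sub>0 :: "nat set" and E :: "real \<Rightarrow> real" and \<omega> :: "nat \<Rightarrow> real \<Rightarrow> 's"
    and solution :: "(real \<Rightarrow> 'h) \<Rightarrow> 'h \<Rightarrow> bool"
  defines "K\<^sub>0 \<equiv> resonant_indices \<rho> \<alpha> \<xi>\<^sub>0 lam"
    and "E \<equiv> mittag_leffler \<rho> 1"
    and "\<omega> \<equiv> \<lambda>k. duhamel \<rho> (lam k) (\<lambda>t. ip (f t) (v k))"
    and "solution \<equiv> \<lambda>u \<phi>. nonlocal_solution D A \<rho> T \<alpha> \<xi>\<^sub>0 \<xi>\<^sub>2 f W u \<phi> \<and> (\<forall>k\<in>K\<^sub>0. ip \<phi> (v k) = 0)"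
  assumes "spectral_operator scl ip D A lam v"
    and "0 < \<rho>" "\<rho> < 1" and "0 < T"
    and "0 < \<xi>\<^sub>0" "\<xi>\<^sub>0 \<le> T" and "0 < \<xi>\<^sub>2" "\<xi>\<^sub>2 \<le> T" and "\<xi>\<^sub>2 \<noteq> \<xi>\<^sub>0"
    and "0 < \<alpha>" "\<alpha> < 1"
    and "W \<in> D"
    and "0 < \<epsilon>" "\<epsilon> < 1" and "continuous_power_dom ip lam v \<epsilon> {0..T} f"
    and "\<forall>t\<in>{0<..T}. \<forall>k\<in>K\<^sub>0. ip (f t) (v k) = 0"
  shows "(\<exists>u \<phi>. solution u \<phi>) \<and>
    (\<forall>u \<phi> u' \<phi>'. solution u \<phi> \<and> solution u' \<phi>' \<longrightarrow> \<phi> = \<phi>' \<and> (\<forall>t\<in>{0..T}. u t = u' t)) \<and>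
    (\<forall>u \<phi>. solution u \<phi> \<longrightarrow>
      ((\<lambda>k. scl (((E (- lam k * \<xi>\<^sub>0 powr \<rho>) - \<alpha>) / E (- lam k * \<xi>\<^sub>2 powr \<rho>)) *\<^sub>R (ip W (v k) - \<omega> k \<xi>\<^sub>2)
                  + \<omega> k \<xi>\<^sub>0) (v k))
        has_sum \<phi>) (- K\<^sub>0) \<and>
      (\<forall>t\<in>{0..T}.
        ((\<lambda>k. scl ((E (- lam k * t powr \<rho>) / (E (- lam k * \<xi>\<^sub>0 powr \<rho>) - \<alpha>)) *\<^sub>R (ip \<phi> (v k) - \<omega> k \<xi>\<^sub>0)
                    + \<omega> k t) (v k))
          has_sum (u t - (\<Sum>k\<in>K\<^sub>0.
            scl ((E (- lam k * t powr \<rho>) / E (- lam k * \<xi>\<^sub>2 powr \<rho>)) *\<^sub>R ip W (v k)) (v k)))) (- K\<^sub>0)))"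
proof -
  note K0 = assms(1) and E = assms(2) and \<omega> = assms(3) and sol = assms(4)
  interpret spectral_operator scl ip D A lam v by fact
  interpret fractional_problem scl ip D A lam v \<rho> T \<epsilon> f by unfold_locales fact+
  have E_eq: "E (- lam k * t powr \<rho>) = ek k t" for k t
    by (simp add: E relaxation.e_def[OF relax])
  have \<omega>_eq: "\<omega> k = duhamel_coeff k" for k
    by (simp add: \<omega> duhamel_eq)
  have K0_eq: "K\<^sub>0 = {k. ek k \<xi>\<^sub>0 = \<alpha>}"
    by (simp add: K0 resonant_indices_def relaxation.e_def[OF relax])
  have fin: "finite K\<^sub>0" unfolding K0_eq by (rule finite_resonant) fact+
  have dc0: "duhamel_coeff k t = 0" if "k \<in> K\<^sub>0" "t \<in> {0..T}" for k t
    by (rule duhamel_coeff_zero) (use assms(20) that in auto)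
  note coeff = nonlocal_solution_coeff[OF _ \<open>0 < \<xi>\<^sub>0\<close> \<open>\<xi>\<^sub>0 \<le> T\<close> \<open>0 < \<xi>\<^sub>2\<close> \<open>\<xi>\<^sub>2 \<le> T\<close>]
  have \<xi>: "\<xi>\<^sub>0 \<in> {0..T}" "\<xi>\<^sub>2 \<in> {0..T}"
    using \<open>0 < \<xi>\<^sub>0\<close> \<open>\<xi>\<^sub>0 \<le> T\<close> \<open>0 < \<xi>\<^sub>2\<close> \<open>\<xi>\<^sub>2 \<le> T\<close> by auto
  have exists: "\<exists>u \<phi>. solution u \<phi>"
  proof -
    obtain u \<phi> where u: "nonlocal_solution D A \<rho> T \<alpha> \<xi>\<^sub>0 \<xi>\<^sub>2 f W u \<phi>"
      using nonlocal_solution_exists[of \<xi>\<^sub>0 \<xi>\<^sub>2 W \<alpha>] assms by blast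
    \<comment> \<open>At a resonant index the factor of \<open>ip (u 0) (v k)\<close> is 0, and the
      remaining Duhamel coefficient vanishes by orthogonality of \<open>f\<close>.\<close>
    have "ip \<phi> (v k) = 0" if "k \<in> K\<^sub>0" for k
      using coeff(3)[OF u, of k] dc0[OF that \<xi>(1)] that by (simp add: K0_eq)
    then show ?thesis using u by (auto simp: sol)
  qed
  have unique: "\<phi> = \<phi>' \<and> (\<forall>t\<in>{0..T}. u t = u' t)" if "solution u \<phi>" "solution u' \<phi>'" for u \<phi> u' \<phi>'
  proof -
    have u: "nonlocal_solution D A \<rho> T \<alpha> \<xi>\<^sub>0 \<xi>\<^sub>2 f W u \<phi>" "nonlocal_solution D A \<rho> T \<alpha> \<xi>\<^sub>0 \<xi>\<^sub>2 f W u' \<phi>'"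
      using that by (auto simp: sol)
    have "ip \<phi> (v k) = ip \<phi>' (v k)" for k
      by (simp only: coeff(2,3)[OF u(1)] coeff(2,3)[OF u(2)])
    moreover have "ip (u t) (v k) = ip (u' t) (v k)" if "t \<in> {0..T}" for t k
      by (simp only: coeff(1)[OF u(1) that] coeff(1)[OF u(2) that] coeff(2)[OF u(1)] coeff(2)[OF u(2)])
    ultimately show ?thesis by (auto intro: basis_eqI)
  qed
  show ?thesis
  proof (intro conjI allI impI ballI)
    fix u \<phi> u' \<phi>' t
    assume "solution u \<phi> \<and> solution u' \<phi>'"
    then have "\<phi> = \<phi>' \<and> (\<forall>t\<in>{0..T}. u t = u' t)" by (elim conjE) (rule unique)
    then show "\<phi> = \<phi>'" "t \<in> {0..T} \<Longrightarrow> u t = u' t" by simp_all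
  next
    fix u \<phi> assume "solution u \<phi>"
    then have u: "nonlocal_solution D A \<rho> T \<alpha> \<xi>\<^sub>0 \<xi>\<^sub>2 f W u \<phi>" and \<phi>: "\<And>k. k \<in> K\<^sub>0 \<Longrightarrow> ip \<phi> (v k) = 0"
      by (auto simp: sol)
    show "((\<lambda>k. scl (((E (- lam k * \<xi>\<^sub>0 powr \<rho>) - \<alpha>) / E (- lam k * \<xi>\<^sub>2 powr \<rho>)) *\<^sub>R (ip W (v k) - \<omega> k \<xi>\<^sub>2)
        + \<omega> k \<xi>\<^sub>0) (v k)) has_sum \<phi>) (- K\<^sub>0)"
      unfolding E_eq \<omega>_eq
      by (rule fourier_has_sum_on[OF \<phi>]) (simp_all add: coeff(2,3)[OF u])
    fix t assume t: "t \<in> {0..T}"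
    show "((\<lambda>k. scl ((E (- lam k * t powr \<rho>) / (E (- lam k * \<xi>\<^sub>0 powr \<rho>) - \<alpha>)) *\<^sub>R (ip \<phi> (v k) - \<omega> k \<xi>\<^sub>0)
          + \<omega> k t) (v k))
        has_sum (u t - (\<Sum>k\<in>K\<^sub>0. scl ((E (- lam k * t powr \<rho>) / E (- lam k * \<xi>\<^sub>2 powr \<rho>)) *\<^sub>R ip W (v k)) (v k)))) (- K\<^sub>0)"
      unfolding E_eq \<omega>_eq
    proof (rule fourier_has_sum_on)
      fix k assume k: "k \<in> K\<^sub>0"
      \<comment> \<open>Without Duhamel terms the coefficient of \<open>u t\<close> is exactly
        \<open>ek k t\<close> times the coefficient of \<open>W\<close>, divided by the value of
        \<open>ek k\<close> at the second time; the finite sum removes precisely this.\<close>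
      show "ip (u t - (\<Sum>k\<in>K\<^sub>0. scl ((ek k t / ek k \<xi>\<^sub>2) *\<^sub>R ip W (v k)) (v k))) (v k) = 0"
        using k by (simp add: ip_diff coeff_finite_sum[OF fin] coeff(1)[OF u t] coeff(2)[OF u]
            dc0[OF k t] dc0[OF k \<xi>(2)])
    next
      fix k assume k: "k \<notin> K\<^sub>0"
      \<comment> \<open>Off the resonant set the factor is nonzero, so division recovers the initial
        coefficient from \<open>\<phi>\<close>, which turns the general coefficient formula into the
        stated one.\<close>
      have "ip \<phi> (v k) - duhamel_coeff k \<xi>\<^sub>0 = (ek k \<xi>\<^sub>0 - \<alpha>) *\<^sub>R ip (u 0) (v k)"
        by (simp add: coeff(3)[OF u])
      moreover have "ek k \<xi>\<^sub>0 - \<alpha> \<noteq> 0" using k by (simp add: K0_eq)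
      ultimately show "ip (u t - (\<Sum>k\<in>K\<^sub>0. scl ((ek k t / ek k \<xi>\<^sub>2) *\<^sub>R ip W (v k)) (v k))) (v k) =
          (ek k t / (ek k \<xi>\<^sub>0 - \<alpha>)) *\<^sub>R (ip \<phi> (v k) - duhamel_coeff k \<xi>\<^sub>0) + duhamel_coeff k t"
        using k by (simp add: ip_diff coeff_finite_sum[OF fin] coeff(1)[OF u t])
    qed
  qed (rule exists)
qed

end
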